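(* Let $f\in S'(\mathbb R^n)$, and let $\lambda(f)=\{\lambda^\beta_{j,m}(f):\beta\in\mathbb N_0^n,\ j\in\mathbb N_0,\ m\in\mathbb Z^n\}$ with $\lambda^\beta_{j,m}(f)=2^{jn}(f,\Phi^\beta_{j,m})$. Then $f\in S(\mathbb R^n)$ if, and only if, it can be represented for any $s>0$ and any $\delta>0$ as $$f=\sum_{\beta\in\mathbb N_0^n,\,j\in\mathbb N_0,\,m\in\mathbb Z^n}\lambda^\beta_{j,m}(f)\,k^\beta_{j,m},\qquad \lambda(f)\in\mathfrak c^s(\mathbb R^n,\delta),$$ unconditional convergence being in $S'(\mathbb R^n)$.
   Context: Let $n\in\mathbb N$, $\mathbb N_0=\mathbb N\cup\{0\}$. $(f,\varphi)=f(\varphi)$ is the bilinear dual pairing of $S'(\mathbb R^n)$ and $S(\mathbb R^n)$. $\widehat\varphi(\xi)=(2\pi)^{-n/2}\int_{\mathbb R^n}e^{-ix\xi}\varphi(x)\,dx$, and $\varphi^\vee$ is the inverse Fourier transform. Quarks. Fix $J\in\mathbb N$ and a non-negative $C^\infty$ function $k$ on $\mathbb R^n$ with $\operatorname{supp}k\subset\{y\in\mathbb R^n:|y|<2^J,\ y_l>0\ \text{for } l=1,\dots,n\}$ and $\sum_{m\in\mathbb Z^n}k(x-m)=1$ for $x\in\mathbb R^n$. For $\beta\in\mathbb N_0^n$, $j\in\mathbb N_0$, $m\in\mathbb Z^n$, with $x^\beta=\prod_lx_l^{\beta_l}$, let $$k^\beta(x)=(2^{-J}x)^\beta k(x),\qquad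 k^\beta_{j,m}(x)=k^\beta(2^jx-m).$$ Let $\omega$ be a real $C^\infty$ function with $\operatorname{supp}\omega\subset(-\pi,\pi)^n$ and $\omega(x)=1$ if $|x|\le2$, and let $$\omega^\beta(x)=\frac{i^{|\beta|}2^{J|\beta|}}{(2\pi)^n\beta!}x^\beta\omega(x),\qquad \Omega^\beta(x)=\sum_{m\in\mathbb Z^n}(\omega^\beta)^\vee(m)e^{-imx}.$$ Let $\varphi_0$ be a non-negative $C^\infty$ function with $\varphi_0(x)=1$ if $|x|\le1$, $\varphi_0(x)=0$ if $|x|\ge3/2$, let $\varphi^0(x)=\varphi_0(x)-\varphi_0(2x)$, and let $\Phi^\beta_F,\Phi^\beta_M\in S(\mathbb R^n)$ be given by $(\Phi^\beta_F)^\vee=\varphi_0\Omega^\beta$, $(\Phi^\beta_M)^\vee=\varphi^0\Omega^\beta$. Put $\Phi^\beta_{0,m}(x)=\Phi^\beta_F(x-m)$ and $\Phi^\beta_{j,m}(x)=\Phi^\beta_M(2^jx-m)$ for $j\in\mathbb N$. Sequence space. For $s,\delta\in\mathbb R$, $\mathfrak c^s(\mathbb R^n,\delta)$ is the collection of all $\lambda=\{\lambda^\beta_{j,m}\in\mathbb C:\beta\in\mathbb N_0^n,j\in\mathbb N_0,m\in\mathbb Z^n\}$ such that $$\|\lambda|\mathfrak c^s(\mathbb R^n,\delta)\|=\sup_{\beta,j,m}2^{js}(1+2^{-j}|m|)^\delta|\lambda^\beta_{j,m}|<\infty.$$ *)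

theory Defs
  imports "HOL-Analysis.Analysis"
begin

section \<open>Smooth functions, Schwartz space and tempered distributions\<close>

text \<open>
  Partial derivatives of higher order are indexed by lists of coordinates. For smooth functions
  the order of differentiation is immaterial, so ranging over all lists amounts to ranging over
  all multi-indices.
\<close>

primrec partials :: "'n::finite list \<Rightarrow> (real ^ 'n \<Rightarrow> 'b::real_normed_vector) \<Rightarrow> real ^ 'n \<Rightarrow> 'b"
  where
    "partials [] f = f"
  | "partials (l # ls) f = (\<lambda>x. frechet_derivative (partials ls f) (at x) (axis l 1))"

definition smooth :: "(real ^ 'n::finite \<Rightarrow> 'b::real_normed_vector) \<Rightarrow> bool"
  where "smooth f \<longleftrightarrow> (\<forall>ls x. partials ls f differentiable (at x))"

definition supp :: "(real ^ 'n::finite \<Rightarrow> 'b::real_normed_vector) \<Rightarrow> (real ^ 'n) set"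
  where "supp f = closure {x. f x \<noteq> 0}"

definition schwartz :: "(real ^ 'n::finite \<Rightarrow> complex) set"
  where "schwartz = {\<phi>. smooth \<phi> \<and>
    (\<forall>k ls. bdd_above (range (\<lambda>x. (1 + norm x) ^ k * norm (partials ls \<phi> x))))}"

definition schwartz_seminorm :: "nat \<Rightarrow> 'n::finite list \<Rightarrow> (real ^ 'n \<Rightarrow> complex) \<Rightarrow> real"
  where "schwartz_seminorm k ls \<phi> = (SUP x. (1 + norm x) ^ k * norm (partials ls \<phi> x))"

definition schwartz_topology :: "(real ^ 'n::finite \<Rightarrow> complex) topology"
  where "schwartz_topology = topology_generated_by
    {{\<psi> \<in> schwartz. schwartz_seminorm k ls (\<lambda>x. \<psi> x - \<phi> x) < \<epsilon>} | \<phi> k ls \<epsilon>.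
       \<phi> \<in> schwartz \<and> 0 < \<epsilon>}"

text \<open>
  A distribution is represented by a function on all of \<open>real ^ 'n \<Rightarrow> complex\<close>; only its values on
  \<^const>\<open>schwartz\<close> matter. The bilinear pairing of \<open>f\<close> and \<open>\<phi>\<close> is the application \<open>f \<phi>\<close>.
\<close>

definition tempered_distribution :: "((real ^ 'n::finite \<Rightarrow> complex) \<Rightarrow> complex) \<Rightarrow> bool"
  where "tempered_distribution f \<longleftrightarrow>
    (\<forall>\<phi>\<in>schwartz. \<forall>\<psi>\<in>schwartz. f (\<lambda>x. \<phi> x + \<psi> x) = f \<phi> + f \<psi>) \<and>
    (\<forall>c. \<forall>\<phi>\<in>schwartz. f (\<lambda>x. c * \<phi> x) = c * f \<phi>) \<and>
    continuous_map schwartz_topology euclidean f"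

definition regular_distribution ::
    "(real ^ 'n::finite \<Rightarrow> complex) \<Rightarrow> (real ^ 'n \<Rightarrow> complex) \<Rightarrow> complex"
  where "regular_distribution g \<phi> = integral\<^sup>L lborel (\<lambda>x. g x * \<phi> x)"

text \<open>Membership of a tempered distribution in the Schwartz space, in the usual identification.\<close>

definition in_schwartz :: "((real ^ 'n::finite \<Rightarrow> complex) \<Rightarrow> complex) \<Rightarrow> bool"
  where "in_schwartz f \<longleftrightarrow> (\<exists>g\<in>schwartz. \<forall>\<phi>\<in>schwartz. f \<phi> = regular_distribution g \<phi>)"

text \<open>
  Unconditional convergence of a series of distributions: the net of finite partial sums
  converges to \<open>f\<close> when tested against each Schwartz function.
\<close>

definition has_distribution_sum ::
    "('i \<Rightarrow> (real ^ 'n::finite \<Rightarrow> complex) \<Rightarrow> complex) \<Rightarrow>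
     ((real ^ 'n \<Rightarrow> complex) \<Rightarrow> complex) \<Rightarrow> bool"
  where "has_distribution_sum u f \<longleftrightarrow> (\<forall>\<phi>\<in>schwartz. ((\<lambda>i. u i \<phi>) has_sum f \<phi>) UNIV)"

definition inv_fourier :: "(real ^ 'n::finite \<Rightarrow> complex) \<Rightarrow> real ^ 'n \<Rightarrow> complex"
  where "inv_fourier \<phi> \<xi> =
    complex_of_real ((2 * pi) powr (- real CARD('n) / 2)) *
    integral\<^sup>L lborel (\<lambda>x. exp (\<i> * complex_of_real (x \<bullet> \<xi>)) * \<phi> x)"

section \<open>Multi-indices and lattice points\<close>

definition mi_abs :: "nat ^ 'n::finite \<Rightarrow> nat"
  where "mi_abs \<beta> = (\<Sum>l\<in>UNIV. \<beta> $ l)"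

definition mi_fact :: "nat ^ 'n::finite \<Rightarrow> real"
  where "mi_fact \<beta> = (\<Prod>l\<in>UNIV. fact (\<beta> $ l))"

definition mi_power :: "real ^ 'n::finite \<Rightarrow> nat ^ 'n \<Rightarrow> real"
  where "mi_power x \<beta> = (\<Prod>l\<in>UNIV. (x $ l) ^ (\<beta> $ l))"

definition lattice_point :: "int ^ 'n::finite \<Rightarrow> real ^ 'n"
  where "lattice_point m = (\<chi> l. real_of_int (m $ l))"

section \<open>Quarks and coefficients\<close>

definition quark :: "nat \<Rightarrow> (real ^ 'n::finite \<Rightarrow> real) \<Rightarrow> nat ^ 'n \<Rightarrow> real ^ 'n \<Rightarrow> real"
  where "quark J k \<beta> x = mi_power ((1 / 2 ^ J) *\<^sub>R x) \<beta> * k x"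

definition quark_jm ::
    "nat \<Rightarrow> (real ^ 'n::finite \<Rightarrow> real) \<Rightarrow> nat ^ 'n \<Rightarrow> nat \<Rightarrow> int ^ 'n \<Rightarrow> real ^ 'n \<Rightarrow> complex"
  where "quark_jm J k \<beta> j m x = complex_of_real (quark J k \<beta> (2 ^ j *\<^sub>R x - lattice_point m))"

definition omega_beta ::
    "nat \<Rightarrow> (real ^ 'n::finite \<Rightarrow> real) \<Rightarrow> nat ^ 'n \<Rightarrow> real ^ 'n \<Rightarrow> complex"
  where "omega_beta J \<omega> \<beta> x =
    \<i> ^ mi_abs \<beta> *
    complex_of_real (2 ^ (J * mi_abs \<beta>) / ((2 * pi) ^ CARD('n) * mi_fact \<beta>) * mi_power x \<beta> * \<omega> x)"

definition Omega_beta ::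
    "nat \<Rightarrow> (real ^ 'n::finite \<Rightarrow> real) \<Rightarrow> nat ^ 'n \<Rightarrow> real ^ 'n \<Rightarrow> complex"
  where "Omega_beta J \<omega> \<beta> x =
    (\<Sum>\<^sub>\<infinity>m\<in>UNIV. inv_fourier (omega_beta J \<omega> \<beta>) (lattice_point m) *
      exp (- \<i> * complex_of_real (lattice_point m \<bullet> x)))"

definition Phi_jm ::
    "(nat ^ 'n::finite \<Rightarrow> real ^ 'n \<Rightarrow> complex) \<Rightarrow> (nat ^ 'n \<Rightarrow> real ^ 'n \<Rightarrow> complex) \<Rightarrow>
     nat ^ 'n \<Rightarrow> nat \<Rightarrow> int ^ 'n \<Rightarrow> real ^ 'n \<Rightarrow> complex"
  where "Phi_jm \<Phi>F \<Phi>M \<beta> j m x =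
    (if j = 0 then \<Phi>F \<beta> (x - lattice_point m) else \<Phi>M \<beta> (2 ^ j *\<^sub>R x - lattice_point m))"

definition quark_coeff ::
    "(nat ^ 'n::finite \<Rightarrow> real ^ 'n \<Rightarrow> complex) \<Rightarrow> (nat ^ 'n \<Rightarrow> real ^ 'n \<Rightarrow> complex) \<Rightarrow>
     ((real ^ 'n \<Rightarrow> complex) \<Rightarrow> complex) \<Rightarrow> nat ^ 'n \<Rightarrow> nat \<Rightarrow> int ^ 'n \<Rightarrow> complex"
  where "quark_coeff \<Phi>F \<Phi>M f \<beta> j m = 2 ^ (j * CARD('n)) * f (Phi_jm \<Phi>F \<Phi>M \<beta> j m)"

section \<open>The sequence space\<close>

definition c_norm ::
    "real \<Rightarrow> real \<Rightarrow> (nat ^ 'n::finite \<Rightarrow> nat \<Rightarrow> int ^ 'n \<Rightarrow> complex) \<Rightarrow> ennreal"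
  where "c_norm s \<delta> \<mu> = (SUP (\<beta>, j, m). ennreal
    (2 powr (real j * s) * (1 + norm (lattice_point m) / 2 ^ j) powr \<delta> * norm (\<mu> \<beta> j m)))"

definition c_space ::
    "real \<Rightarrow> real \<Rightarrow> (nat ^ 'n::finite \<Rightarrow> nat \<Rightarrow> int ^ 'n \<Rightarrow> complex) set"
  where "c_space s \<delta> = {\<mu>. c_norm s \<delta> \<mu> < \<infinity>}"

end

theory Submission
  imports Defs "HOL-Probability.Probability"
begin

text \<open>
  Let \<open>G\<close> be the Fourier transform of \<open>g \<in> S\<close>. By Fourier inversion the coefficients of \<open>g\<close> are
  \<open>i^|\<beta>| 2^{J|\<beta>|} / \<beta>!\<close> times the inverse Fourier transform at \<open>2^{-j} m\<close> of
  \<open>G(\<xi>) (2^{-j} \<xi>)^\<beta> \<phi>_j(\<xi>)\<close>, where \<open>(\<phi>_j)\<close> is the dyadic partition of unity: on the support of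
  the cut-offs \<open>\<Omega>^\<beta>\<close> is the Fourier series of \<open>\<omega>^\<beta>\<close>, hence a multiple of a monomial. Integration by
  parts gives decay in \<open>m\<close>, the decay of \<open>G\<close> on the dyadic shells gives decay in \<open>j\<close>, and \<open>\<beta>!\<close>
  beats the powers of \<open>2^J\<close>. Summing the series over \<open>\<beta>\<close> turns the monomials into an exponential,
  over \<open>m\<close> uses the partition of unity by translates of \<open>k\<close>, and over \<open>j\<close> gives \<open>g\<close> back.

  Conversely, the support of \<open>k\<close> lies in a ball of radius strictly less than \<open>2^J\<close>, so each derivative of
  \<open>k^\<beta>\<close> is bounded by a multiple of \<open>\<sigma>^|\<beta>|\<close> with \<open>\<sigma> < 1\<close>; with rapidly decaying coefficients the quark
  series converges absolutely in every Schwartz seminorm.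
\<close>

section \<open>Iterated partial derivatives\<close>

text \<open>Quarks and coefficients fit together because (2^j x - m) . (2^{-j} \<xi>) + 2^{-j} m .
  \<xi> = x . \<xi>. The kernel of the inverse Fourier transform thus splits into a phase, which
  belongs to the coefficient at (j, m), and a second factor whose expansion separates powers of 2^j
  x - m, carried by the quarks, from powers of 2^{-j} \<xi>, carried by the analysing functions. The
  scale 2^J cancels between the two sides, but it decides the estimates: it makes the quarks small
  for large |\<beta>|. The Fourier series of \<omega>^\<beta> represents it only inside the open
  cube of side 2 pi about 0. The cut-offs live in |x| <= 3/2, well within the ball of radius 2 < pi
  on which \<omega> = 1. Interchanges rest on summable majorants that are uniform in the space or
  frequency variable. Derivatives pass through integrals and series by means of remainders quadratic
  in the increment, since such bounds can be integrated and summed. The quantifiers over s and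
  \<delta> collapse: convergence involves neither, and all the coefficient conditions together say
  rapid decrease in j and 2^{-j} m, uniformly in \<beta>.\<close>

lemma partials_append: "partials (a @ b) f = partials a (partials b f)"
  by (induction a) auto

lemma smooth_partials: "smooth f \<Longrightarrow> smooth (partials ls f)"
  unfolding smooth_def by (metis partials_append)

lemma smooth_imp_differentiable: "smooth f \<Longrightarrow> f differentiable (at x)"
  unfolding smooth_def by (metis partials.simps(1))

text \<open>Gives smoothness from a class of differentiable functions closed under first partials,
  with no formula for the iterated ones. Scalar multiples of monomials form such a class.\<close>

lemma smooth_coinduct [consumes 1, case_names differentiable partial]:
  assumes "P f" and "\<And>g x. P g \<Longrightarrow> g differentiable (at x)"
    and "\<And>g l. P g \<Longrightarrow> P (partials [l] g)"
  shows "smooth f"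
proof -
  have "P (partials ls f)" for ls
  proof (induction ls)
    case (Cons l ls)
    then show ?case using assms(3)[of "partials ls f" l] by simp
  qed (use assms in auto)
  then show ?thesis unfolding smooth_def using assms(2) by blast
qed

lemma linear_axis_expansion:
  fixes L :: "real ^ 'n::finite \<Rightarrow> 'b::real_vector"
  assumes "linear L"
  shows "L h = (\<Sum>l\<in>UNIV. (h $ l) *\<^sub>R L (axis l 1))"
proof -
  have "h = (\<Sum>l\<in>UNIV. (h $ l) *\<^sub>R axis l 1)"
    by (simp add: vec_eq_iff axis_def if_distrib cong: if_cong)
  then show ?thesis
    using linear_sum[OF assms, of "\<lambda>l. (h $ l) *\<^sub>R axis l 1" UNIV] linear_scale[OF assms]
    by (metis (no_types, lifting) sum.cong)
qed

lemma smooth_has_derivative: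
  fixes f :: "real ^ 'n::finite \<Rightarrow> 'b::real_normed_vector"
  assumes "smooth f"
  shows "(f has_derivative (\<lambda>h. \<Sum>l\<in>UNIV. (h $ l) *\<^sub>R partials [l] f x)) (at x)"
proof -
  have d: "(f has_derivative frechet_derivative f (at x)) (at x)"
    using smooth_imp_differentiable[OF assms] frechet_derivative_works by blast
  then have "frechet_derivative f (at x) h = (\<Sum>l\<in>UNIV. (h $ l) *\<^sub>R partials [l] f x)" for h
    using linear_axis_expansion[of "frechet_derivative f (at x)" h] has_derivative_linear by auto
  then show ?thesis using d by presburger
qed

lemma has_derivative_imp_partial:
  assumes "\<And>x. (f has_derivative f' x) (at x)"
  shows "partials [l] f = (\<lambda>x. f' x (axis l 1))"
  using frechet_derivative_at[OF assms] by (simp add: fun_eq_iff)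

lemma smooth_continuous: "smooth f \<Longrightarrow> continuous_on UNIV f"
  by (simp add: continuous_at_imp_continuous_on differentiable_imp_continuous_within
      smooth_imp_differentiable)

lemma smooth_partials_continuous: "smooth f \<Longrightarrow> continuous_on UNIV (partials ls f)"
  by (simp add: smooth_continuous smooth_partials)

lemma smooth_measurable [measurable_dest]: "smooth f \<Longrightarrow> f \<in> borel_measurable borel"
  by (simp add: borel_measurable_continuous_onI smooth_continuous)

lemma partials_const: "partials ls (\<lambda>x. c) = (\<lambda>x. if ls = [] then c else 0)"
proof (induction ls)
  case (Cons l ls)
  have "partials [l] (\<lambda>x. d) = (\<lambda>x. 0)" for d :: 'b
    by (subst has_derivative_imp_partial[where f' = "\<lambda>x h. 0"]) auto
  then show ?case using Cons by (simp cong: if_cong)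
qed auto

lemma smooth_const: "smooth (\<lambda>x. c)"
  unfolding smooth_def partials_const by simp

lemma partials_bounded_linear:
  assumes "bounded_linear L" "smooth f"
  shows "partials ls (\<lambda>x. L (f x)) = (\<lambda>x. L (partials ls f x))"
proof (induction ls)
  case (Cons l ls)
  have "partials [l] (\<lambda>x. L (partials ls f x)) = (\<lambda>x. L (partials [l] (partials ls f) x))"
  proof (subst has_derivative_imp_partial[where
        f' = "\<lambda>x h. L (frechet_derivative (partials ls f) (at x) h)"])
    fix x
    show "((\<lambda>x. L (partials ls f x)) has_derivative
        (\<lambda>h. L (frechet_derivative (partials ls f) (at x) h))) (at x)"
      using bounded_linear.has_derivative[OF assms(1)] assms(2)
      by (metis frechet_derivative_works smooth_def)
  qed simp
  then show ?case using Cons by simp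
qed auto

lemma smooth_bounded_linear:
  assumes "bounded_linear L" "smooth f"
  shows "smooth (\<lambda>x. L (f x))"
  unfolding smooth_def partials_bounded_linear[OF assms]
proof (intro allI)
  fix ls x
  have "(partials ls f has_derivative frechet_derivative (partials ls f) (at x)) (at x)"
    using assms(2) by (metis frechet_derivative_works smooth_def)
  from bounded_linear.has_derivative[OF assms(1) this]
  show "(\<lambda>x. L (partials ls f x)) differentiable (at x)"
    unfolding differentiable_def by blast
qed

lemma partials_affine:
  fixes f :: "real ^ 'n::finite \<Rightarrow> 'b::real_normed_vector"
  assumes "smooth f"
  shows "partials ls (\<lambda>x. f (c *\<^sub>R x + t)) =
    (\<lambda>x. c ^ length ls *\<^sub>R partials ls f (c *\<^sub>R x + t))"
proof (induction ls)
  case (Cons l ls)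
  let ?d = "\<lambda>y. frechet_derivative (partials ls f) (at y)"
  have d: "(partials ls f has_derivative ?d y) (at y)" for y
    using assms by (metis frechet_derivative_works smooth_def)
  have "partials [l] (\<lambda>x. c ^ length ls *\<^sub>R partials ls f (c *\<^sub>R x + t)) =
     (\<lambda>x. c ^ length ls *\<^sub>R ?d (c *\<^sub>R x + t) (c *\<^sub>R axis l 1))"
  proof (subst has_derivative_imp_partial[where
        f' = "\<lambda>x h. c ^ length ls *\<^sub>R ?d (c *\<^sub>R x + t) (c *\<^sub>R h)"])
    fix x
    have "((\<lambda>x. c *\<^sub>R x + t) has_derivative (\<lambda>h. c *\<^sub>R h)) (at x)"
      by (auto intro!: derivative_eq_intros)
    from has_derivative_compose[OF this d]
    show "((\<lambda>x. c ^ length ls *\<^sub>R partials ls f (c *\<^sub>R x + t)) has_derivative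
       (\<lambda>h. c ^ length ls *\<^sub>R ?d (c *\<^sub>R x + t) (c *\<^sub>R h))) (at x)"
      by (intro has_derivative_scaleR_right)
  qed simp
  also have "\<dots> = (\<lambda>x. c ^ length (l # ls) *\<^sub>R partials (l # ls) f (c *\<^sub>R x + t))"
    using linear_scale[OF has_derivative_linear[OF d]] by (simp add: fun_eq_iff mult.commute)
  finally show ?case using Cons by simp
qed auto

lemma smooth_affine:
  fixes f :: "real ^ 'n::finite \<Rightarrow> 'b::real_normed_vector"
  assumes "smooth f"
  shows "smooth (\<lambda>x. f (c *\<^sub>R x + t))"
  unfolding smooth_def partials_affine[OF assms]
proof (intro allI)
  fix ls x
  have "(\<lambda>x. partials ls f (c *\<^sub>R x + t)) differentiable (at x)"
    using differentiable_chain_at[of "\<lambda>x. c *\<^sub>R x + t" x "partials ls f"] assms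
    by (simp add: smooth_def o_def)
  then show "(\<lambda>x. c ^ length ls *\<^sub>R partials ls f (c *\<^sub>R x + t)) differentiable (at x)"
    by simp
qed

lemma partials_add:
  assumes "smooth f" "smooth g"
  shows "partials ls (\<lambda>x. f x + g x) = (\<lambda>x. partials ls f x + partials ls g x)"
proof (induction ls)
  case (Cons l ls)
  have "partials [l] (\<lambda>x. partials ls f x + partials ls g x) =
      (\<lambda>x. frechet_derivative (partials ls f) (at x) (axis l 1) +
        frechet_derivative (partials ls g) (at x) (axis l 1))"
    by (rule has_derivative_imp_partial, rule has_derivative_add)
      (use assms in \<open>metis frechet_derivative_works smooth_def\<close>)+
  then show ?case using Cons by simp
qed auto

lemma smooth_add:
  assumes "smooth f" "smooth g"
  shows "smooth (\<lambda>x. f x + g x)"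
  unfolding smooth_def partials_add[OF assms]
  using assms by (simp add: smooth_def)

lemma smooth_uminus: "smooth f \<Longrightarrow> smooth (\<lambda>x. - f x)"
  by (rule smooth_bounded_linear[OF bounded_linear_minus[OF bounded_linear_ident]])

lemma smooth_diff: "smooth f \<Longrightarrow> smooth g \<Longrightarrow> smooth (\<lambda>x. f x - g x)"
  using smooth_add[of f "\<lambda>x. - g x"] smooth_uminus[of g] by simp

text \<open>Index set of the Leibniz rule: each coordinate of the list goes to one of the two
  factors. Repetitions stay separate pairs, so no binomial coefficients occur and there are exactly
  2^length terms.\<close>

primrec splits :: "'a list \<Rightarrow> ('a list \<times> 'a list) list" where
  "splits [] = [([], [])]"
| "splits (l # ls) = map (\<lambda>(a, b). (l # a, b)) (splits ls) @ map (\<lambda>(a, b). (a, l # b)) (splits ls)"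

lemma length_splits: "length (splits ls) = 2 ^ length ls"
  by (induction ls) auto

lemma splits_length: "(a, b) \<in> set (splits ls) \<Longrightarrow> length a + length b = length ls"
  by (induction ls arbitrary: a b) auto

lemma has_derivative_sum_list:
  assumes "\<And>p. p \<in> set ps \<Longrightarrow> (F p has_derivative F' p) (at x)"
  shows "((\<lambda>x. \<Sum>p\<leftarrow>ps. F p x) has_derivative (\<lambda>h. \<Sum>p\<leftarrow>ps. F' p h)) (at x)"
  using assms by (induction ps) (auto intro!: derivative_intros)

lemma partials_mult:
  fixes f g :: "real ^ 'n::finite \<Rightarrow> 'b::real_normed_algebra"
  assumes "smooth f" "smooth g"
  shows "partials ls (\<lambda>x. f x * g x) =
    (\<lambda>x. \<Sum>(a, b)\<leftarrow>splits ls. partials a f x * partials b g x)"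
proof (induction ls)
  case (Cons l ls)
  let ?D = "\<lambda>f a x. frechet_derivative (partials a f) (at x)"
  have d: "(partials a f has_derivative ?D f a x) (at x)"
    "(partials a g has_derivative ?D g a x) (at x)" for a x
    using assms by (metis frechet_derivative_works smooth_def)+
  have "partials [l] (\<lambda>x. \<Sum>p\<leftarrow>splits ls. partials (fst p) f x * partials (snd p) g x) =
    (\<lambda>x. \<Sum>p\<leftarrow>splits ls. partials (fst p) f x * ?D g (snd p) x (axis l 1) +
       ?D f (fst p) x (axis l 1) * partials (snd p) g x)"
    by (rule has_derivative_imp_partial, rule has_derivative_sum_list, rule has_derivative_mult)
      (rule d)+
  also have "\<dots> = (\<lambda>x. \<Sum>(a, b)\<leftarrow>splits (l # ls). partials a f x * partials b g x)"
    by (simp add: fun_eq_iff sum_list_addf comp_def case_prod_unfold add.commute)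
  finally show ?case using Cons by (simp add: case_prod_unfold)
qed auto

lemma smooth_mult:
  fixes f g :: "real ^ 'n::finite \<Rightarrow> 'b::real_normed_algebra"
  assumes "smooth f" "smooth g"
  shows "smooth (\<lambda>x. f x * g x)"
  unfolding smooth_def partials_mult[OF assms] case_prod_unfold
proof (intro allI)
  fix ls x
  have "partials a f differentiable (at x)" "partials a g differentiable (at x)" for a
    using assms by (auto simp: smooth_def)
  then have "(\<lambda>x. \<Sum>p\<leftarrow>ps. partials (fst p) f x * partials (snd p) g x) differentiable (at x)" for ps
    by (induction ps) simp_all
  then show "(\<lambda>x. \<Sum>p\<leftarrow>splits ls. partials (fst p) f x * partials (snd p) g x) differentiable (at x)" .
qed

lemma norm_sum_list_le:
  assumes "\<And>p. p \<in> set ps \<Longrightarrow> norm (F p) \<le> B"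
  shows "norm (\<Sum>p\<leftarrow>ps. F p) \<le> real (length ps) * B"
  using assms
proof (induction ps)
  case (Cons p ps)
  then have "norm (\<Sum>p\<leftarrow>p # ps. F p) \<le> B + real (length ps) * B"
    using norm_triangle_ineq[of "F p" "\<Sum>p\<leftarrow>ps. F p"] by fastforce
  then show ?case by (simp add: algebra_simps)
qed auto

text \<open>The bounds are required at the single point \<open>x\<close>, so that weights depending
  on \<open>x\<close> can be hidden in \<open>B\<close> and \<open>D\<close>.\<close>

lemma norm_partials_mult_le:
  fixes f g :: "real ^ 'n::finite \<Rightarrow> 'b::real_normed_algebra"
  assumes "smooth f" "smooth g"
    and "\<And>a. length a \<le> length ls \<Longrightarrow> norm (partials a f x) \<le> B"
    and "\<And>b. length b \<le> length ls \<Longrightarrow> norm (partials b g x) \<le> D"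
  shows "norm (partials ls (\<lambda>x. f x * g x) x) \<le> 2 ^ length ls * (B * D)"
proof -
  have "norm (case p of (a, b) \<Rightarrow> partials a f x * partials b g x) \<le> B * D"
    if "p \<in> set (splits ls)" for p
  proof -
    obtain a b where p: "p = (a, b)" by (cases p)
    have "norm (partials a f x) \<le> B" "norm (partials b g x) \<le> D"
      using assms(3,4) splits_length[of a b ls] that p by auto
    then have "norm (partials a f x) * norm (partials b g x) \<le> B * D"
      by (meson mult_mono norm_ge_zero order_trans)
    then show ?thesis using p norm_mult_ineq order_trans by fastforce
  qed
  from norm_sum_list_le[of "splits ls", OF this] show ?thesis
    unfolding partials_mult[OF assms(1,2)] by (simp add: length_splits)
qed

lemma partials_outside_supp:
  assumes "x \<notin> supp f"
  shows "partials ls f x = 0"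
  using assms
proof (induction ls arbitrary: x)
  case Nil
  then show ?case using closure_subset[of "{x. f x \<noteq> 0}"] by (auto simp: supp_def)
next
  case (Cons l ls)
  have "open (- supp f)" unfolding supp_def by (intro open_Compl closed_closure)
  then have "(partials ls f has_derivative (\<lambda>h. 0)) (at x)"
    using has_derivative_transform_within_open[of "\<lambda>x. 0" "\<lambda>h. 0" x UNIV "- supp f" "partials ls f"]
      Cons by auto
  then show ?case using frechet_derivative_at by (metis partials.simps(2))
qed

section \<open>Integration over coordinates and integrability by decay\<close>

lemma Basis_vec_eq_range_axis: "(Basis :: (real ^ 'n::finite) set) = range (\<lambda>l. axis l 1)"
  by (auto simp: Basis_vec_def)

lemma inj_axis: "inj (\<lambda>l. axis l 1 :: real ^ 'n::finite)"
  by (auto simp: inj_on_def axis_eq_axis)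

text \<open>Lebesgue measure is the image of a product measure indexed by the basis
  (\<open>lborel_eq\<close>). The basis vectors correspond to the coordinates, so the product
  formula for finite products of measures carries over.\<close>

lemma
  fixes f :: "'n::finite \<Rightarrow> real \<Rightarrow> 'c::{real_normed_field, banach, second_countable_topology}"
  assumes f: "\<And>l. integrable lborel (f l)"
  shows integrable_lborel_prod: "integrable lborel (\<lambda>x :: real ^ 'n. \<Prod>l\<in>UNIV. f l (x $ l))"
    and integral_lborel_prod:
      "(\<integral>x. (\<Prod>l\<in>UNIV. f l ((x :: real ^ 'n) $ l)) \<partial>lborel) = (\<Prod>l\<in>UNIV. integral\<^sup>L lborel (f l))"
proof -
  interpret product_sigma_finite "\<lambda>b :: real ^ 'n. lborel :: real measure"
    by standard
  let ?B = "Basis :: (real ^ 'n) set"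
  let ?T = "\<lambda>g :: real ^ 'n \<Rightarrow> real. \<Sum>b\<in>?B. g b *\<^sub>R b"
  have m [measurable]: "f l \<in> borel_measurable borel" for l
    using borel_measurable_integrable[OF f] by simp
  have fin: "finite ?B" by simp
  have T: "?T g $ l = g (axis l 1)" for g l
  proof -
    have "?T g $ l = ?T g \<bullet> axis l 1" by (simp add: inner_axis)
    also have "\<dots> = g (axis l 1)"
      by (simp add: inner_sum_left inner_Basis Basis_vec_eq_range_axis if_distrib cong: if_cong)
    finally show ?thesis .
  qed
  have eq: "(\<Prod>l\<in>UNIV. F l (axis l 1)) = (\<Prod>b\<in>?B. F (axis_index b) b)"
    for F :: "'n \<Rightarrow> real ^ 'n \<Rightarrow> 'c"
    unfolding Basis_vec_eq_range_axis by (subst prod.reindex) (auto simp: inj_axis)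
  have Teq: "(\<Prod>l\<in>UNIV. f l (?T g $ l)) = (\<Prod>b\<in>?B. f (axis_index b) (g b))" for g
    unfolding T by (rule eq[of "\<lambda>l b. f l (g b)"])
  have i: "integrable (\<Pi>\<^sub>M b\<in>?B. lborel) (\<lambda>g. \<Prod>b\<in>?B. f (axis_index b) (g b))"
    by (intro product_integrable_prod fin f)
  show "integrable lborel (\<lambda>x :: real ^ 'n. \<Prod>l\<in>UNIV. f l (x $ l))"
    by (subst lborel_eq, subst integrable_distr_eq, simp, simp, simp only: Teq, rule i)
  have "(\<integral>x. (\<Prod>l\<in>UNIV. f l ((x :: real ^ 'n) $ l)) \<partial>lborel) =
      (\<integral>g. (\<Prod>b\<in>?B. f (axis_index b) (g b)) \<partial>(\<Pi>\<^sub>M b\<in>?B. lborel))"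
    by (subst lborel_eq, subst integral_distr, simp, simp, simp only: Teq)
  also have "\<dots> = (\<Prod>b\<in>?B. integral\<^sup>L lborel (f (axis_index b)))"
    by (intro product_integral_prod fin f)
  also have "\<dots> = (\<Prod>l\<in>UNIV. integral\<^sup>L lborel (f l))"
    by (subst eq[of "\<lambda>l b. integral\<^sup>L lborel (f l)"]) simp
  finally show "(\<integral>x. (\<Prod>l\<in>UNIV. f l ((x :: real ^ 'n) $ l)) \<partial>lborel) =
      (\<Prod>l\<in>UNIV. integral\<^sup>L lborel (f l))" .
qed

lemma
  fixes f :: "'a::euclidean_space \<Rightarrow> 'b::{banach, second_countable_topology}"
  assumes c: "c \<noteq> 0" and [measurable]: "f \<in> borel_measurable borel"
  shows integrable_lborel_affine_iff:
      "integrable lborel (\<lambda>x. f (t + c *\<^sub>R x)) \<longleftrightarrow> integrable lborel f"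
    and integral_lborel_affine:
      "integral\<^sup>L lborel f = \<bar>c\<bar> ^ DIM('a) *\<^sub>R (LBINT x. f (t + c *\<^sub>R x))"
proof -
  note eq = lborel_affine[OF c, of t]
  have "integrable lborel f \<longleftrightarrow> integrable lborel (\<lambda>x. \<bar>c\<bar> ^ DIM('a) *\<^sub>R f (t + c *\<^sub>R x))"
    by (subst eq, subst integrable_density) (simp_all add: integrable_distr_eq)
  then show "integrable lborel (\<lambda>x. f (t + c *\<^sub>R x)) \<longleftrightarrow> integrable lborel f"
    using integrable_scaleR_right[of "\<bar>c\<bar> ^ DIM('a)" lborel "\<lambda>x. f (t + c *\<^sub>R x)"]
      integrable_scaleR_right[of "inverse (\<bar>c\<bar> ^ DIM('a))" lborel "\<lambda>x. \<bar>c\<bar> ^ DIM('a) *\<^sub>R f (t + c *\<^sub>R x)"] c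
    by auto
  show "integral\<^sup>L lborel f = \<bar>c\<bar> ^ DIM('a) *\<^sub>R (LBINT x. f (t + c *\<^sub>R x))"
    by (subst eq, subst integral_density) (simp_all add: integral_distr)
qed

lemma integrable_inverse_one_plus_square: "integrable lborel (\<lambda>x :: real. inverse (1 + x\<^sup>2))"
  using integrable_inverse_1_plus_square by (simp add: set_integrable_def)

text \<open>Source of the exponent 2n used throughout: this power of the weight dominates a product
  whose inverse is integrable over the space and summable over the lattice, one coordinate at a
  time.\<close>

lemma one_plus_norm_power_ge:
  fixes x :: "real ^ 'n::finite"
  shows "(\<Prod>l\<in>UNIV. 1 + (x $ l)\<^sup>2) \<le> (1 + norm x) ^ (2 * CARD('n))"
proof -
  have "1 + (x $ l)\<^sup>2 \<le> (1 + norm x)\<^sup>2" for l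
  proof -
    have "(x $ l)\<^sup>2 \<le> (norm x)\<^sup>2"
      using component_le_norm_cart[of x l] by (simp add: abs_le_square_iff[symmetric])
    moreover have "(1 + norm x)\<^sup>2 = 1 + 2 * norm x + (norm x)\<^sup>2" by (simp add: power2_sum)
    ultimately show ?thesis using norm_ge_zero[of x] by linarith
  qed
  then have "(\<Prod>l\<in>UNIV. 1 + (x $ l)\<^sup>2) \<le> (\<Prod>l\<in>(UNIV :: 'n set). (1 + norm x)\<^sup>2)"
    by (intro prod_mono) auto
  then show ?thesis by (simp add: power_mult)
qed

lemma integrable_of_decay:
  fixes f :: "real ^ 'n::finite \<Rightarrow> 'b::{banach, second_countable_topology}"
  assumes [measurable]: "f \<in> borel_measurable borel"
    and le: "\<And>x. (1 + norm x) ^ (2 * CARD('n)) * norm (f x) \<le> C"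
  shows "integrable lborel f"
proof (rule Bochner_Integration.integrable_bound)
  show "integrable lborel (\<lambda>x :: real ^ 'n. C * (\<Prod>l\<in>UNIV. inverse (1 + (x $ l)\<^sup>2)))"
    by (intro integrable_mult_right integrable_lborel_prod integrable_inverse_one_plus_square)
  show "AE x in lborel. norm (f x) \<le> norm (C * (\<Prod>l\<in>UNIV. inverse (1 + (x $ l)\<^sup>2)))"
  proof (intro always_eventually allI)
    fix x :: "real ^ 'n"
    let ?P = "\<Prod>l\<in>UNIV. 1 + (x $ l)\<^sup>2"
    have P: "?P > 0" by (intro prod_pos) (simp add: add_pos_nonneg)
    have "?P * norm (f x) \<le> C"
      using mult_right_mono[OF one_plus_norm_power_ge[of x] norm_ge_zero[of "f x"]] le[of x]
      by linarith
    then have "norm (f x) \<le> C / ?P" using P by (simp add: field_simps)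
    also have "\<dots> = C * (\<Prod>l\<in>UNIV. inverse (1 + (x $ l)\<^sup>2))"
      by (simp add: prod_inversef[symmetric] divide_inverse comp_def)
    finally show "norm (f x) \<le> norm (C * (\<Prod>l\<in>UNIV. inverse (1 + (x $ l)\<^sup>2)))" by simp
  qed
qed simp

section \<open>Schwartz functions\<close>

text \<open>Only finitely many lists have length at most \<open>N\<close>, so the individual bounds
  have a maximum.\<close>

lemma finite_lists_bound:
  fixes P :: "'n::finite list \<Rightarrow> real \<Rightarrow> bool"
  assumes "\<And>ls. \<exists>C. P ls C" and mono: "\<And>ls C D. P ls C \<Longrightarrow> C \<le> D \<Longrightarrow> P ls D"
  shows "\<exists>C\<ge>0. \<forall>ls. length ls \<le> N \<longrightarrow> P ls C"
proof -
  obtain c where c: "P ls (c ls)" for ls using assms(1) by metis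
  let ?A = "{ls :: 'n list. length ls \<le> N}"
  have fin: "finite ?A" using finite_lists_length_le[of "UNIV :: 'n set" N] by simp
  have "P ls (Max (insert 0 (c ` ?A)))" if "length ls \<le> N" for ls
    by (rule mono[OF c]) (use that fin in \<open>auto intro: Max_ge\<close>)
  then show ?thesis using fin by (intro exI[of _ "Max (insert 0 (c ` ?A))"]) auto
qed

lemma schwartz_smooth: "\<phi> \<in> schwartz \<Longrightarrow> smooth \<phi>"
  by (simp add: schwartz_def)

lemma schwartz_measurable: "\<phi> \<in> schwartz \<Longrightarrow> \<phi> \<in> borel_measurable borel"
  by (rule smooth_measurable[OF schwartz_smooth])

lemma schwartz_bound:
  assumes "\<phi> \<in> schwartz"
  shows "\<exists>C. \<forall>x. (1 + norm x) ^ k * norm (partials ls \<phi> x) \<le> C"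
  using assms unfolding schwartz_def by (auto simp: bdd_above_def)

lemma schwartz_bound_uniform:
  assumes "\<phi> \<in> schwartz"
  shows "\<exists>C\<ge>0. \<forall>ls. length ls \<le> N \<longrightarrow> (\<forall>x. (1 + norm x) ^ k * norm (partials ls \<phi> x) \<le> C)"
  by (rule finite_lists_bound[where P = "\<lambda>ls C. \<forall>x. (1 + norm x) ^ k * norm (partials ls \<phi> x) \<le> C"])
    (use schwartz_bound[OF assms] order_trans in blast)+

lemma schwartzI:
  assumes "smooth \<phi>" "\<And>k ls. \<exists>C. \<forall>x. (1 + norm x) ^ k * norm (partials ls \<phi> x) \<le> C"
  shows "\<phi> \<in> schwartz"
  using assms unfolding schwartz_def by (fastforce simp: bdd_above_def)

lemma schwartz_partials: "\<phi> \<in> schwartz \<Longrightarrow> partials ls \<phi> \<in> schwartz"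
  by (rule schwartzI) (simp_all add: schwartz_smooth smooth_partials schwartz_bound
      flip: partials_append)

text \<open>The multipliers of the Schwartz space. The exponent of growth may depend on the
  derivative.\<close>

definition slowly_increasing :: "(real ^ 'n::finite \<Rightarrow> complex) \<Rightarrow> bool" where
  "slowly_increasing g \<longleftrightarrow>
    smooth g \<and> (\<forall>ls. \<exists>C k. \<forall>x. norm (partials ls g x) \<le> C * (1 + norm x) ^ k)"

lemma slowly_increasing_uniform:
  assumes "slowly_increasing g"
  shows "\<exists>C\<ge>0. \<exists>k. \<forall>ls. length ls \<le> N \<longrightarrow> (\<forall>x. norm (partials ls g x) \<le> C * (1 + norm x) ^ k)"
proof -
  obtain c k where ck: "norm (partials ls g x) \<le> c ls * (1 + norm x) ^ k ls" for ls x
    using assms unfolding slowly_increasing_def by metis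
  obtain K where K: "\<And>ls. length ls \<le> N \<Longrightarrow> real (k ls) \<le> K"
    using finite_lists_bound[where P = "\<lambda>ls C. real (k ls) \<le> C" and N = N] by fastforce
  obtain C where C: "C \<ge> 0" "\<And>ls. length ls \<le> N \<Longrightarrow> c ls \<le> C"
    using finite_lists_bound[where P = "\<lambda>ls C. c ls \<le> C" and N = N] by fastforce
  have "norm (partials ls g x) \<le> C * (1 + norm x) ^ nat \<lceil>K\<rceil>" if "length ls \<le> N" for ls x
  proof -
    have "k ls \<le> nat \<lceil>K\<rceil>" using K[OF that] by linarith
    then have "c ls * (1 + norm x) ^ k ls \<le> C * (1 + norm x) ^ nat \<lceil>K\<rceil>"
      by (intro mult_mono power_increasing) (use C that in auto)
    then show ?thesis using ck[of ls x] by linarith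
  qed
  then show ?thesis using C(1) by blast
qed

lemma schwartz_imp_slowly_increasing:
  fixes \<phi> :: "real ^ 'n::finite \<Rightarrow> complex"
  assumes "\<phi> \<in> schwartz" shows "slowly_increasing \<phi>"
  unfolding slowly_increasing_def
proof (intro conjI allI)
  fix ls :: "'n list"
  obtain C where "\<forall>x. (1 + norm x) ^ 0 * norm (partials ls \<phi> x) \<le> C"
    using schwartz_bound[OF assms] by blast
  then show "\<exists>C k. \<forall>x. norm (partials ls \<phi> x) \<le> C * (1 + norm x) ^ k"
    by (intro exI[of _ C] exI[of _ 0]) simp
qed (simp add: assms schwartz_smooth)

lemma schwartz_mult:
  fixes g \<phi> :: "real ^ 'n::finite \<Rightarrow> complex"
  assumes g: "slowly_increasing g" and \<phi>: "\<phi> \<in> schwartz"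
  shows "(\<lambda>x. g x * \<phi> x) \<in> schwartz"
proof (rule schwartzI)
  have s: "smooth g" "smooth \<phi>" using assms by (auto simp: slowly_increasing_def schwartz_smooth)
  then show "smooth (\<lambda>x. g x * \<phi> x)" by (rule smooth_mult)
  fix k and ls :: "'n list"
  obtain C m where C: "C \<ge> 0" "\<And>a x. length a \<le> length ls \<Longrightarrow> norm (partials a g x) \<le> C * (1 + norm x) ^ m"
    using slowly_increasing_uniform[OF g, of "length ls"] by blast
  obtain D where D: "\<And>b x. length b \<le> length ls \<Longrightarrow> (1 + norm x) ^ (m + k) * norm (partials b \<phi> x) \<le> D"
    using schwartz_bound_uniform[OF \<phi>, of "length ls" "m + k"] by blast
  have "(1 + norm x) ^ k * norm (partials ls (\<lambda>x. g x * \<phi> x) x) \<le> 2 ^ length ls * (C * D)" for x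
  proof -
    have p: "(1 + norm x) > 0" by (simp add: add_pos_nonneg)
    have "norm (partials b \<phi> x) \<le> D / (1 + norm x) ^ (m + k)" if "length b \<le> length ls" for b
      using D[OF that, of x] p by (simp add: field_simps)
    from norm_partials_mult_le[OF s C(2) this]
    have "norm (partials ls (\<lambda>x. g x * \<phi> x) x) \<le>
        2 ^ length ls * (C * (1 + norm x) ^ m * (D / (1 + norm x) ^ (m + k)))" .
    also have "\<dots> = 2 ^ length ls * (C * D) / (1 + norm x) ^ k"
      using p by (simp add: power_add field_simps)
    finally show ?thesis using p by (simp add: field_simps)
  qed
  then show "\<exists>C. \<forall>x. (1 + norm x) ^ k * norm (partials ls (\<lambda>x. g x * \<phi> x) x) \<le> C" by blast
qed

lemma slowly_increasing_const: "slowly_increasing (\<lambda>x. c)"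
  unfolding slowly_increasing_def partials_const
  by (intro conjI allI smooth_const exI[of _ "norm c"] exI[of _ 0]) auto

lemma schwartz_cmult: "\<phi> \<in> schwartz \<Longrightarrow> (\<lambda>x. c * \<phi> x) \<in> schwartz"
  by (rule schwartz_mult[OF slowly_increasing_const])

section \<open>Monomials and their derivatives\<close>

definition monomial :: "nat ^ 'n::finite \<Rightarrow> real ^ 'n \<Rightarrow> complex" where
  "monomial \<beta> x = complex_of_real (mi_power x \<beta>)"

lemma monomial_altdef: "monomial \<beta> x = (\<Prod>l\<in>UNIV. complex_of_real (x $ l) ^ (\<beta> $ l))"
  by (simp add: monomial_def mi_power_def)

lemma norm_monomial_le:
  fixes x :: "real ^ 'n::finite"
  assumes "norm x \<le> R" shows "norm (monomial \<beta> x) \<le> R ^ mi_abs \<beta>"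
proof -
  have "norm (monomial \<beta> x) = (\<Prod>l\<in>UNIV. \<bar>x $ l\<bar> ^ (\<beta> $ l))"
    unfolding monomial_altdef by (simp add: prod_norm[symmetric] norm_power)
  also have "\<dots> \<le> (\<Prod>l\<in>(UNIV :: 'n set). R ^ (\<beta> $ l))"
    using component_le_norm_cart[of x] assms by (intro prod_mono) (auto intro!: power_mono intro: order_trans)
  finally show ?thesis by (simp add: mi_abs_def power_sum)
qed

lemma mi_abs_diff_axis:
  assumes "\<beta> $ l > 0" shows "Suc (mi_abs (\<beta> - axis l 1)) = mi_abs \<beta>"
proof -
  have "mi_abs \<beta> = (\<Sum>i\<in>UNIV. (\<beta> - axis l 1) $ i + (if i = l then 1 else 0))"
    unfolding mi_abs_def using assms by (intro sum.cong) (auto simp: axis_def)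
  also have "\<dots> = Suc (mi_abs (\<beta> - axis l 1))"
    unfolding sum.distrib by (simp add: mi_abs_def)
  finally show ?thesis by simp
qed

text \<open>Subtraction of multi-indices is truncated. This is harmless, since truncation happens
  only where the factor \<open>\<beta> $ l\<close> vanishes.\<close>

lemma monomial_has_derivative:
  fixes x :: "real ^ 'n::finite"
  shows "(monomial \<beta> has_derivative
    (\<lambda>h. \<Sum>l\<in>UNIV. complex_of_real (h $ l) * (of_nat (\<beta> $ l) * monomial (\<beta> - axis l 1) x))) (at x)"
proof -
  have d: "((\<lambda>x. complex_of_real (x $ l) ^ (\<beta> $ l)) has_derivative
      (\<lambda>h. of_nat (\<beta> $ l) * complex_of_real (h $ l) * complex_of_real (x $ l) ^ (\<beta> $ l - 1))) (at x)" for l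
    by (intro has_derivative_power bounded_linear_imp_has_derivative
        bounded_linear_compose[OF bounded_linear_of_real bounded_linear_vec_nth])
  have "(\<Prod>j\<in>UNIV - {l}. complex_of_real (x $ j) ^ (\<beta> $ j)) =
      (\<Prod>j\<in>UNIV - {l}. complex_of_real (x $ j) ^ ((\<beta> - axis l 1) $ j))" for l
    by (intro prod.cong) (auto simp: axis_def)
  then have "complex_of_real (x $ l) ^ (\<beta> $ l - 1) * (\<Prod>j\<in>UNIV - {l}. complex_of_real (x $ j) ^ (\<beta> $ j)) =
      monomial (\<beta> - axis l 1) x" for l
    unfolding monomial_altdef by (subst prod.remove[of UNIV l]) simp_all
  then have eq: "of_nat (\<beta> $ l) * complex_of_real (h $ l) * complex_of_real (x $ l) ^ (\<beta> $ l - 1) *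
      (\<Prod>j\<in>UNIV - {l}. complex_of_real (x $ j) ^ (\<beta> $ j)) =
      complex_of_real (h $ l) * (of_nat (\<beta> $ l) * monomial (\<beta> - axis l 1) x)" for l h
    by (simp add: mult_ac)
  have "((\<lambda>x. \<Prod>l\<in>UNIV. complex_of_real (x $ l) ^ (\<beta> $ l)) has_derivative
      (\<lambda>h. \<Sum>l\<in>UNIV. of_nat (\<beta> $ l) * complex_of_real (h $ l) * complex_of_real (x $ l) ^ (\<beta> $ l - 1) *
        (\<Prod>j\<in>UNIV - {l}. complex_of_real (x $ j) ^ (\<beta> $ j)))) (at x)"
    by (rule has_derivative_prod) (rule d)
  then show ?thesis unfolding eq by (simp only: monomial_altdef[abs_def])
qed

lemma partial_monomial:
  "partials [l] (monomial \<beta>) = (\<lambda>x. of_nat (\<beta> $ l) * monomial (\<beta> - axis l 1) x)"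
  by (subst has_derivative_imp_partial[OF monomial_has_derivative])
    (simp add: axis_def if_distrib if_distribR sum.delta cong: if_cong)

lemma smooth_monomial: "smooth (monomial \<beta> :: real ^ 'n::finite \<Rightarrow> complex)"
proof -
  let ?P = "\<lambda>g :: real ^ 'n \<Rightarrow> complex. \<exists>c \<beta>. g = (\<lambda>x. c * monomial \<beta> x)"
  have "?P (monomial \<beta>)" by (rule exI[of _ 1]) auto
  then show ?thesis
  proof (rule smooth_coinduct[of ?P])
    fix g :: "real ^ 'n \<Rightarrow> complex" and x l assume "?P g"
    then obtain c \<beta> where g: "g = (\<lambda>x. c * monomial \<beta> x)" by blast
    have d: "(g has_derivative (\<lambda>h. c * (\<Sum>l\<in>UNIV. complex_of_real (h $ l) *
        (of_nat (\<beta> $ l) * monomial (\<beta> - axis l 1) x)))) (at x)" for x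
      unfolding g by (intro has_derivative_mult_right monomial_has_derivative)
    show "g differentiable (at x)" using d unfolding differentiable_def by blast
    have "partials [l] g = (\<lambda>x. (c * of_nat (\<beta> $ l)) * monomial (\<beta> - axis l 1) x)"
      by (subst has_derivative_imp_partial[OF d])
        (simp add: axis_def if_distrib if_distribR sum.delta mult.assoc cong: if_cong)
    then show "?P (partials [l] g)" by blast
  qed
qed

text \<open>A derivative turns R^|\<beta>| into at most |\<beta>| R^(|\<beta>| - 1). Only a
  polynomial factor in |\<beta>| is lost, so the geometric factor survives differentiation.\<close>

lemma norm_partials_monomial_le:
  fixes x :: "real ^ 'n::finite"
  assumes R: "R > 0" and x: "norm x \<le> R"
  shows "norm (partials ls (monomial \<beta>) x) \<le> (real (mi_abs \<beta>) / R) ^ length ls * R ^ mi_abs \<beta>"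
proof (induction ls arbitrary: \<beta> rule: rev_induct)
  case Nil
  then show ?case using norm_monomial_le[OF x] by simp
next
  case (snoc l ls)
  \<comment> \<open>Reverse induction removes the derivative that is applied first, so what remains
    to be differentiated is again a multiple of a monomial.\<close>
  have eq: "partials (ls @ [l]) (monomial \<beta>) = (\<lambda>x. of_nat (\<beta> $ l) * partials ls (monomial (\<beta> - axis l 1)) x)"
    unfolding partials_append partial_monomial
    by (rule partials_bounded_linear[OF bounded_linear_mult_right smooth_monomial])
  show ?case
  proof (cases "\<beta> $ l = 0")
    case True
    then show ?thesis unfolding eq using R by simp
  next
    case False
    then have S: "Suc (mi_abs (\<beta> - axis l 1)) = mi_abs \<beta>" by (intro mi_abs_diff_axis) simp
    have le: "\<beta> $ l \<le> mi_abs \<beta>" unfolding mi_abs_def by (intro member_le_sum) auto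
    have "norm (partials (ls @ [l]) (monomial \<beta>) x) =
        real (\<beta> $ l) * norm (partials ls (monomial (\<beta> - axis l 1)) x)"
      unfolding eq by (simp add: norm_mult)
    also have "\<dots> \<le> real (mi_abs \<beta>) * ((real (mi_abs (\<beta> - axis l 1)) / R) ^ length ls * R ^ mi_abs (\<beta> - axis l 1))"
      using le by (intro mult_mono snoc.IH) auto
    also have "\<dots> \<le> real (mi_abs \<beta>) * ((real (mi_abs \<beta>) / R) ^ length ls * R ^ mi_abs (\<beta> - axis l 1))"
      using R S by (intro mult_left_mono mult_right_mono power_mono divide_right_mono) auto
    also have "\<dots> = (real (mi_abs \<beta>) / R) ^ length (ls @ [l]) * R ^ mi_abs \<beta>"
      unfolding S[symmetric] using R by simp
    finally show ?thesis .
  qed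
qed

lemma slowly_increasing_monomial: "slowly_increasing (monomial \<beta>)"
  unfolding slowly_increasing_def
proof (intro conjI allI smooth_monomial)
  fix ls
  \<comment> \<open>The radius in the preceding bound is taken at the point itself, R = 1 + norm
    x.\<close>
  have "norm (partials ls (monomial \<beta>) x) \<le> real (mi_abs \<beta>) ^ length ls * (1 + norm x) ^ mi_abs \<beta>" for x
  proof -
    have "(real (mi_abs \<beta>) / (1 + norm x)) ^ length ls \<le> real (mi_abs \<beta>) ^ length ls"
      by (intro power_mono) (auto simp: divide_le_eq add_pos_nonneg mult_le_cancel_left1)
    then have "(real (mi_abs \<beta>) / (1 + norm x)) ^ length ls * (1 + norm x) ^ mi_abs \<beta> \<le>
        real (mi_abs \<beta>) ^ length ls * (1 + norm x) ^ mi_abs \<beta>"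
      by (intro mult_right_mono) auto
    moreover have "norm (partials ls (monomial \<beta>) x) \<le>
        (real (mi_abs \<beta>) / (1 + norm x)) ^ length ls * (1 + norm x) ^ mi_abs \<beta>"
      by (rule norm_partials_monomial_le) (simp_all add: add_pos_nonneg)
    ultimately show ?thesis by linarith
  qed
  then show "\<exists>C k. \<forall>x. norm (partials ls (monomial \<beta>) x) \<le> C * (1 + norm x) ^ k" by blast
qed

lemma slowly_increasing_coordinate: "slowly_increasing (\<lambda>x. complex_of_real (x $ l))"
proof -
  have "monomial (axis l 1) = (\<lambda>x. complex_of_real (x $ l))"
    by (auto simp: monomial_altdef axis_def prod.delta if_distrib fun_eq_iff cong: if_cong)
  then show ?thesis using slowly_increasing_monomial by metis
qed

lemma schwartz_affine:
  assumes \<phi>: "\<phi> \<in> schwartz" and c: "c \<noteq> 0"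
  shows "(\<lambda>x. \<phi> (c *\<^sub>R x + t)) \<in> schwartz"
proof (rule schwartzI)
  show "smooth (\<lambda>x. \<phi> (c *\<^sub>R x + t))" using \<phi> by (intro smooth_affine schwartz_smooth)
  fix k ls
  obtain C where C: "\<And>x. (1 + norm x) ^ k * norm (partials ls \<phi> x) \<le> C"
    using schwartz_bound[OF \<phi>] by blast
  \<comment> \<open>Comparison constant for the two weights: |c| norm x <= norm (c x + t) + norm t,
    and norm t is absorbed by the factor 1 + norm t.\<close>
  define A where "A = 1 + (1 + norm t) / \<bar>c\<bar>"
  have A: "A > 0" unfolding A_def by (simp add: add_pos_nonneg)
  have "1 + norm x \<le> A * (1 + norm (c *\<^sub>R x + t))" for x
  proof -
    have "\<bar>c\<bar> * norm x \<le> norm (c *\<^sub>R x + t) + norm t"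
      using norm_triangle_ineq4[of "c *\<^sub>R x + t" t] by simp
    then have "norm x \<le> (norm (c *\<^sub>R x + t) + norm t) / \<bar>c\<bar>"
      using c by (simp add: field_simps)
    also have "\<dots> \<le> ((1 + norm t) * (1 + norm (c *\<^sub>R x + t))) / \<bar>c\<bar>"
      by (intro divide_right_mono) (auto simp: algebra_simps add_increasing)
    also have "\<dots> = (1 + norm t) / \<bar>c\<bar> * (1 + norm (c *\<^sub>R x + t))" by simp
    finally have "norm x \<le> (1 + norm t) / \<bar>c\<bar> * (1 + norm (c *\<^sub>R x + t))" .
    from add_mono[OF _ this, of 1 "1 * (1 + norm (c *\<^sub>R x + t))"]
    have "1 + norm x \<le> 1 * (1 + norm (c *\<^sub>R x + t)) +
        (1 + norm t) / \<bar>c\<bar> * (1 + norm (c *\<^sub>R x + t))"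
      by simp
    then show ?thesis unfolding A_def by (simp only: distrib_right)
  qed
  then have p: "(1 + norm x) ^ k \<le> A ^ k * (1 + norm (c *\<^sub>R x + t)) ^ k" for x
    by (metis add_nonneg_nonneg norm_ge_zero power_mono power_mult_distrib zero_le_one)
  have "(1 + norm x) ^ k * norm (partials ls (\<lambda>x. \<phi> (c *\<^sub>R x + t)) x) \<le>
      \<bar>c\<bar> ^ length ls * (A ^ k * C)" for x
  proof -
    have "(1 + norm x) ^ k * norm (partials ls \<phi> (c *\<^sub>R x + t)) \<le>
        A ^ k * ((1 + norm (c *\<^sub>R x + t)) ^ k * norm (partials ls \<phi> (c *\<^sub>R x + t)))"
      using mult_right_mono[OF p norm_ge_zero] by (simp add: mult.assoc)
    also have "\<dots> \<le> A ^ k * C" using C A by (intro mult_left_mono) auto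
    finally have "\<bar>c\<bar> ^ length ls * ((1 + norm x) ^ k * norm (partials ls \<phi> (c *\<^sub>R x + t))) \<le>
      \<bar>c\<bar> ^ length ls * (A ^ k * C)" by (intro mult_left_mono) auto
    then show ?thesis
      unfolding partials_affine[OF schwartz_smooth[OF \<phi>]]
      by (simp add: power_abs mult.left_commute)
  qed
  then show "\<exists>C. \<forall>x. (1 + norm x) ^ k * norm (partials ls (\<lambda>x. \<phi> (c *\<^sub>R x + t)) x) \<le> C" by blast
qed

lemma schwartz_integrable:
  fixes \<phi> :: "real ^ 'n::finite \<Rightarrow> complex"
  assumes "\<phi> \<in> schwartz" shows "integrable lborel \<phi>"
proof -
  obtain C where "\<And>x. (1 + norm x) ^ (2 * CARD('n)) * norm (partials [] \<phi> x) \<le> C"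
    using schwartz_bound[OF assms] by blast
  then show ?thesis
    by (intro integrable_of_decay[of _ C]) (use assms schwartz_measurable in auto)
qed

lemma smooth_compact_support_schwartz:
  assumes "smooth \<phi>" "bounded (supp \<phi>)"
  shows "\<phi> \<in> schwartz"
proof (rule schwartzI[OF assms(1)])
  fix k ls
  have "compact (supp \<phi>)" using assms(2) by (simp add: supp_def compact_eq_bounded_closed)
  moreover have "continuous_on (supp \<phi>) (\<lambda>x. (1 + norm x) ^ k * norm (partials ls \<phi> x))"
    by (intro continuous_intros continuous_on_subset[OF smooth_partials_continuous[OF assms(1)]]) auto
  ultimately have "bounded ((\<lambda>x. (1 + norm x) ^ k * norm (partials ls \<phi> x)) ` supp \<phi>)"
    by (intro compact_imp_bounded compact_continuous_image)
  then obtain C where "\<And>y. y \<in> (\<lambda>x. (1 + norm x) ^ k * norm (partials ls \<phi> x)) ` supp \<phi> \<Longrightarrow> \<bar>y\<bar> \<le> C"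
    unfolding bounded_real by blast
  then have C: "(1 + norm x) ^ k * norm (partials ls \<phi> x) \<le> C" if "x \<in> supp \<phi>" for x
    using that abs_le_D1 by blast
  have "(1 + norm x) ^ k * norm (partials ls \<phi> x) \<le> max C 0" for x
    using C[of x] by (cases "x \<in> supp \<phi>") (auto simp: partials_outside_supp)
  then show "\<exists>C. \<forall>x. (1 + norm x) ^ k * norm (partials ls \<phi> x) \<le> C" by blast
qed

section \<open>Fourier transform of Schwartz functions\<close>

lemma integrable_iexp_mult:
  fixes w :: "real ^ 'n::finite \<Rightarrow> complex"
  assumes "integrable lborel w"
  shows "integrable lborel (\<lambda>x. iexp (x \<bullet> \<xi>) * w x)"
proof (rule Bochner_Integration.integrable_bound[OF assms])
  have [measurable]: "w \<in> borel_measurable borel" using borel_measurable_integrable[OF assms] by simp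
  show "(\<lambda>x. iexp (x \<bullet> \<xi>) * w x) \<in> borel_measurable lborel" by measurable
qed (simp add: norm_mult)

text \<open>Unlike a limit of difference quotients, a quadratic bound valid for every increment can
  be integrated or summed. It therefore serves both for differentiation under the integral and for
  termwise differentiation of series.\<close>

lemma has_derivative_quadratic_remainder:
  fixes f :: "'a::real_normed_vector \<Rightarrow> 'b::real_normed_vector"
  assumes L: "bounded_linear L" and le: "\<And>h. norm (f (x + h) - f x - L h) \<le> B * (norm h)\<^sup>2"
  shows "(f has_derivative L) (at x)"
proof -
  have "((\<lambda>h. norm (f (x + h) - f x - L h) / norm h) \<longlongrightarrow> 0) (at 0)"
  proof (rule tendsto_0_le[where K = 1])
    show "((\<lambda>h. B * norm h) \<longlongrightarrow> 0) (at 0)"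
      by (intro tendsto_eq_intros) auto
    show "\<forall>\<^sub>F h in at 0. norm (norm (f (x + h) - f x - L h) / norm h) \<le> norm (B * norm h) * 1"
      unfolding eventually_at_filter
    proof (intro always_eventually allI impI)
      fix h :: 'a assume "h \<noteq> 0"
      then have "norm (f (x + h) - f x - L h) / norm h \<le> B * norm h"
        using le[of h] by (simp add: field_simps power2_eq_square)
      then show "norm (norm (f (x + h) - f x - L h) / norm h) \<le> norm (B * norm h) * 1" by simp
    qed
  qed
  then show ?thesis using L unfolding has_derivative_at by blast
qed

lemma norm_iexp_taylor: "norm (iexp t - 1 - \<i> * complex_of_real t) \<le> t\<^sup>2 / 2"
  using iexp_approx1[of t 1] by (simp add: numeral_2_eq_2 diff_diff_eq power2_eq_square)

lemma schwartz_weighted_integrable: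
  fixes \<phi> :: "real ^ 'n::finite \<Rightarrow> complex"
  assumes "\<phi> \<in> schwartz"
  shows "integrable lborel (\<lambda>x. norm x ^ k * norm (\<phi> x))"
proof -
  obtain C where C: "\<And>x. (1 + norm x) ^ (2 * CARD('n) + k) * norm (partials [] \<phi> x) \<le> C"
    using schwartz_bound[OF assms] by blast
  note [measurable] = schwartz_measurable[OF assms]
  have "(1 + norm x) ^ (2 * CARD('n)) * (norm x ^ k * norm (\<phi> x)) \<le>
      (1 + norm x) ^ (2 * CARD('n)) * ((1 + norm x) ^ k * norm (\<phi> x))" for x
    by (intro mult_left_mono mult_right_mono power_mono) auto
  then have "(1 + norm x) ^ (2 * CARD('n)) * (norm x ^ k * norm (\<phi> x)) \<le> C" for x
    using C[of x] by (simp add: power_add mult.assoc) (meson order_trans)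
  then show ?thesis by (intro integrable_of_decay[of _ C]) auto
qed

text \<open>The second-order Taylor remainder of the exponential is at most (x . h)^2 / 2, and |x|^2
  |w(x)| is integrable for a Schwartz function \<open>w\<close>.\<close>

lemma inv_fourier_has_derivative:
  fixes w :: "real ^ 'n::finite \<Rightarrow> complex"
  assumes w: "w \<in> schwartz"
  shows "(inv_fourier w has_derivative
    (\<lambda>h. \<Sum>l\<in>UNIV. (h $ l) *\<^sub>R inv_fourier (\<lambda>x. (\<i> * complex_of_real (x $ l)) * w x) \<xi>)) (at \<xi>)"
    (is "(_ has_derivative ?L) _")
proof (rule has_derivative_quadratic_remainder)
  show "bounded_linear ?L"
    by (intro bounded_linear_sum bounded_linear_compose[OF bounded_linear_scaleR_left] bounded_linear_vec_nth)
  let ?k = "complex_of_real ((2 * pi) powr (- real CARD('n) / 2))"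
  let ?B = "norm ?k * (LBINT x. norm x ^ 2 * norm (w x))"
  fix h :: "real ^ 'n"
  have wl: "(\<lambda>x. \<i> * complex_of_real (x $ l) * w x) \<in> schwartz" for l
    using schwartz_cmult[OF schwartz_mult[OF slowly_increasing_coordinate w], of \<i>]
    by (simp add: mult.assoc)
  note [simp] = integrable_iexp_mult[OF schwartz_integrable[OF wl]]
    integrable_iexp_mult[OF schwartz_integrable[OF w]]
  have eq: "(\<lambda>x. \<Sum>l\<in>UNIV. (h $ l) *\<^sub>R (iexp (x \<bullet> \<xi>) * (\<i> * complex_of_real (x $ l) * w x))) =
      (\<lambda>x. iexp (x \<bullet> \<xi>) * (\<i> * complex_of_real (x \<bullet> h)) * w x)"
    by (auto simp: inner_vec_def scaleR_conv_of_real sum_distrib_left sum_distrib_right mult_ac)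
  have L: "?L h = ?k * (LBINT x. iexp (x \<bullet> \<xi>) * (\<i> * complex_of_real (x \<bullet> h)) * w x)"
    unfolding eq[symmetric] by (simp add: inv_fourier_def sum_distrib_left Bochner_Integration.integral_sum)
  have i: "integrable lborel (\<lambda>x. iexp (x \<bullet> \<xi>) * (\<i> * complex_of_real (x \<bullet> h)) * w x)"
    unfolding eq[symmetric] by simp
  have "inv_fourier w (\<xi> + h) - inv_fourier w \<xi> - ?L h =
     ?k * (LBINT x. iexp (x \<bullet> (\<xi> + h)) * w x - iexp (x \<bullet> \<xi>) * w x -
       iexp (x \<bullet> \<xi>) * (\<i> * complex_of_real (x \<bullet> h)) * w x)"
    unfolding L unfolding inv_fourier_def
    using i by (subst Bochner_Integration.integral_diff Bochner_Integration.integrable_diff, simp, simp)+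
      (simp add: right_diff_distrib)
  also have "(\<lambda>x. iexp (x \<bullet> (\<xi> + h)) * w x - iexp (x \<bullet> \<xi>) * w x -
       iexp (x \<bullet> \<xi>) * (\<i> * complex_of_real (x \<bullet> h)) * w x) =
      (\<lambda>x. iexp (x \<bullet> \<xi>) * (iexp (x \<bullet> h) - 1 - \<i> * complex_of_real (x \<bullet> h)) * w x)"
    by (simp add: inner_add_right ring_distribs exp_add mult_ac)
  finally have eq: "inv_fourier w (\<xi> + h) - inv_fourier w \<xi> - ?L h =
      ?k * (LBINT x. iexp (x \<bullet> \<xi>) * (iexp (x \<bullet> h) - 1 - \<i> * complex_of_real (x \<bullet> h)) * w x)" .
  have le: "norm (iexp (x \<bullet> \<xi>) * (iexp (x \<bullet> h) - 1 - \<i> * complex_of_real (x \<bullet> h)) * w x) \<le>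
      (norm x ^ 2 * norm (w x)) * (norm h)\<^sup>2" for x
  proof -
    have "\<bar>x \<bullet> h\<bar> ^ 2 \<le> (norm x * norm h) ^ 2"
      by (intro power_mono Cauchy_Schwarz_ineq2) simp
    then have "norm (iexp (x \<bullet> h) - 1 - \<i> * complex_of_real (x \<bullet> h)) \<le> (norm x * norm h) ^ 2"
      using norm_iexp_taylor[of "x \<bullet> h"] by simp (smt (verit) zero_le_power2)
    then have "norm (iexp (x \<bullet> h) - 1 - \<i> * complex_of_real (x \<bullet> h)) * norm (w x) \<le>
        (norm x * norm h) ^ 2 * norm (w x)"
      by (intro mult_right_mono) auto
    then show ?thesis by (simp add: norm_mult power_mult_distrib mult_ac)
  qed
  have "norm (LBINT x. iexp (x \<bullet> \<xi>) * (iexp (x \<bullet> h) - 1 - \<i> * complex_of_real (x \<bullet> h)) * w x)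
      \<le> (LBINT x. (norm x ^ 2 * norm (w x)) * (norm h)\<^sup>2)"
  proof (rule Bochner_Integration.integral_norm_bound_integral[OF _ _ le])
    show j: "integrable lborel (\<lambda>x. norm x ^ 2 * norm (w x) * (norm h)\<^sup>2)"
      by (intro integrable_mult_left schwartz_weighted_integrable w)
    note [measurable] = schwartz_measurable[OF w]
    show "integrable lborel (\<lambda>x. iexp (x \<bullet> \<xi>) * (iexp (x \<bullet> h) - 1 - \<i> * complex_of_real (x \<bullet> h)) * w x)"
      by (rule Bochner_Integration.integrable_bound[OF j]) (measurable, use le in auto)
  qed
  then show "norm (inv_fourier w (\<xi> + h) - inv_fourier w \<xi> - ?L h) \<le> ?B * (norm h)\<^sup>2"
    unfolding eq norm_mult integral_mult_left_zero mult.assoc[symmetric, of _ "integral\<^sup>L _ _"]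
    using mult_left_mono[OF _ norm_ge_zero] by (simp only: mult.assoc)
qed

lemma partial_inv_fourier:
  fixes w :: "real ^ 'n::finite \<Rightarrow> complex"
  assumes w: "w \<in> schwartz"
  shows "partials [l] (inv_fourier w) = inv_fourier (\<lambda>x. (\<i> * complex_of_real (x $ l)) * w x)"
  by (subst has_derivative_imp_partial[OF inv_fourier_has_derivative[OF w]])
    (simp add: axis_def if_distrib if_distribR sum.delta cong: if_cong)

text \<open>No formula for \<open>v\<close> is needed: whatever holds for inverse Fourier transforms
  of all Schwartz functions, such as decay, then passes to every partial derivative.\<close>

lemma partials_inv_fourier:
  assumes "w \<in> schwartz"
  shows "\<exists>v\<in>schwartz. partials ls (inv_fourier w) = inv_fourier v"
proof (induction ls)
  case (Cons l ls)
  then obtain v where v: "v \<in> schwartz" "partials ls (inv_fourier w) = inv_fourier v" by auto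
  have "(\<lambda>x. \<i> * complex_of_real (x $ l) * v x) \<in> schwartz"
    using schwartz_cmult[OF schwartz_mult[OF slowly_increasing_coordinate v(1)], of \<i>]
    by (simp add: mult.assoc)
  then show ?case using partial_inv_fourier[OF v(1), of l] v(2) by auto
qed (use assms in auto)

lemma smooth_inv_fourier:
  assumes "w \<in> schwartz" shows "smooth (inv_fourier w)"
  unfolding smooth_def
proof (intro allI)
  fix ls x
  obtain v where v: "v \<in> schwartz" "partials ls (inv_fourier w) = inv_fourier v"
    using partials_inv_fourier[OF assms] by blast
  show "partials ls (inv_fourier w) differentiable at x"
    unfolding v(2) differentiable_def using inv_fourier_has_derivative[OF v(1)] by blast
qed

section \<open>Integration by parts and decay of Fourier integrals\<close>

lemma iexp_inner_has_derivative:
  fixes x \<xi> :: "real ^ 'n::finite"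
  shows "((\<lambda>x. c * iexp (x \<bullet> \<xi>)) has_derivative
    (\<lambda>h. c * (\<i> * complex_of_real (h \<bullet> \<xi>) * iexp (x \<bullet> \<xi>)))) (at x)"
proof -
  have "((\<lambda>x. \<i> * complex_of_real (x \<bullet> \<xi>)) has_derivative (\<lambda>h. \<i> * complex_of_real (h \<bullet> \<xi>))) (at x)"
    by (intro has_derivative_mult_right bounded_linear.has_derivative[OF bounded_linear_of_real]
        has_derivative_inner_left has_derivative_ident)
  moreover have "(exp has_derivative (\<lambda>h. h * exp z)) (at z)" for z :: complex
    using DERIV_exp[of z] by (simp add: has_field_derivative_def mult_commute_abs)
  ultimately show ?thesis
    using has_derivative_compose by (intro has_derivative_mult_right) blast
qed

lemma partials_iexp_inner:
  fixes \<xi> :: "real ^ 'n::finite"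
  shows "partials ls (\<lambda>x. iexp (x \<bullet> \<xi>)) =
    (\<lambda>x. (\<Prod>l\<leftarrow>ls. \<i> * complex_of_real (\<xi> $ l)) * iexp (x \<bullet> \<xi>))"
proof (induction ls)
  case (Cons l ls)
  have "partials [l] (\<lambda>x. c * iexp (x \<bullet> \<xi>)) = (\<lambda>x. (\<i> * complex_of_real (\<xi> $ l) * c) * iexp (x \<bullet> \<xi>))" for c
    by (subst has_derivative_imp_partial[OF iexp_inner_has_derivative]) (simp add: inner_axis' mult_ac)
  then show ?case using Cons by simp
qed simp

lemma slowly_increasing_iexp: "slowly_increasing (\<lambda>x. iexp (x \<bullet> \<xi>))"
  unfolding slowly_increasing_def smooth_def partials_iexp_inner
proof (intro conjI allI)
  show "(\<lambda>x. (\<Prod>l\<leftarrow>ls. \<i> * complex_of_real (\<xi> $ l)) * iexp (x \<bullet> \<xi>)) differentiable (at x)" for ls x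
    using iexp_inner_has_derivative unfolding differentiable_def by blast
  show "\<exists>C k. \<forall>x. norm ((\<Prod>l\<leftarrow>ls. \<i> * complex_of_real (\<xi> $ l)) * iexp (x \<bullet> \<xi>)) \<le> C * (1 + norm x) ^ k" for ls
    by (intro exI[of _ "norm (\<Prod>l\<leftarrow>ls. \<i> * complex_of_real (\<xi> $ l))"] exI[of _ 0]) (simp add: norm_mult)
qed

text \<open>
  By the fundamental theorem of calculus and Fubini, the integral of \<open>\<partial>\<^sub>l v\<close> is that of
  \<open>v(x + e\<^sub>l) - v(x)\<close>, which vanishes by translation invariance.
\<close>

lemma integral_partial_eq_0:
  fixes v :: "real ^ 'n::finite \<Rightarrow> complex"
  assumes v: "v \<in> schwartz"
  shows "(LBINT x. partials [l] v x) = 0"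
proof -
  let ?e = "axis l 1 :: real ^ 'n"
  let ?d = "partials [l] v"
  have d: "?d \<in> schwartz" by (rule schwartz_partials[OF v])
  have [measurable]: "v \<in> borel_measurable borel" "?d \<in> borel_measurable borel"
    using v d by (auto intro: schwartz_measurable simp del: partials.simps)
  have i: "integrable lborel (\<lambda>x. u (x + t *\<^sub>R ?e))" if "u \<in> schwartz" for u :: "real ^ 'n \<Rightarrow> complex" and t
    using schwartz_integrable[OF schwartz_affine[OF that, of 1 "t *\<^sub>R ?e"]] by simp
  have tr: "(LBINT x. u (x + t *\<^sub>R ?e)) = integral\<^sup>L lborel u"
    if "u \<in> borel_measurable borel" for u :: "real ^ 'n \<Rightarrow> 'b::{banach, second_countable_topology}" and t
    using integral_lborel_affine[of 1 u "t *\<^sub>R ?e"] that by (simp add: add.commute)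
  let ?F = "\<lambda>(t, x). indicator {0..1 :: real} t *\<^sub>R ?d (x + t *\<^sub>R ?e)"
  have FTC: "(LBINT t. ?F (t, x)) = v (x + 1 *\<^sub>R ?e) - v (x + 0 *\<^sub>R ?e)" for x
    unfolding case_prod_conv
  proof (rule integral_FTC_Icc)
    fix t :: real
    have 1: "((\<lambda>t. x + t *\<^sub>R ?e) has_derivative (\<lambda>s. s *\<^sub>R ?e)) (at t within {0..1})"
      by (auto intro!: derivative_eq_intros)
    have "(\<Sum>l'\<in>UNIV. ((s *\<^sub>R ?e) $ l') *\<^sub>R partials [l'] v y) = s *\<^sub>R ?d y" for s y
      by (simp add: axis_def if_distrib if_distribR sum.delta cong: if_cong)
    then show "((\<lambda>t. v (x + t *\<^sub>R ?e)) has_vector_derivative ?d (x + t *\<^sub>R ?e)) (at t within {0..1})"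
      using has_derivative_compose[OF 1 smooth_has_derivative[OF schwartz_smooth[OF v]]]
      by (simp add: has_vector_derivative_def del: partials.simps)
    show "continuous_on {0..1} (\<lambda>t. ?d (x + t *\<^sub>R ?e))"
      by (rule continuous_on_compose2[OF smooth_continuous[OF schwartz_smooth[OF d]]]) (auto intro!: continuous_intros)
  qed simp
  have "integrable (lborel \<Otimes>\<^sub>M lborel) ?F"
  proof (rule lborel_pair.Fubini_integrable)
    show "?F \<in> borel_measurable (lborel \<Otimes>\<^sub>M lborel)" by measurable
    \<comment> \<open>The inner integral does not depend on \<open>t\<close> apart from the
      indicator, so integrability in \<open>t\<close> is that of a constant on a compact
      interval.\<close>
    have "(LBINT x. norm (?F (t, x))) = indicator {0..1} t *\<^sub>R (LBINT x. norm (?d x))" for t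
      using tr[of "\<lambda>x. norm (?d x)" t] by (simp del: partials.simps)
    then show "integrable lborel (\<lambda>t. LBINT x. norm (?F (t, x)))"
      by (simp only:) (intro borel_integrable_compact continuous_intros; simp)
    show "AE t in lborel. integrable lborel (\<lambda>x. ?F (t, x))"
      using i[OF d] by (simp del: partials.simps)
  qed
  from lborel_pair.Fubini_integral[OF this]
  have "(LBINT x. v (x + 1 *\<^sub>R ?e) - v (x + 0 *\<^sub>R ?e)) = (\<integral>t. indicator {0..1} t *\<^sub>R integral\<^sup>L lborel ?d \<partial>(lborel :: real measure))"
    by (simp only: FTC[unfolded case_prod_conv] case_prod_conv integral_scaleR_right tr[OF \<open>?d \<in> borel_measurable borel\<close>])
  moreover have "(LBINT x. v (x + 1 *\<^sub>R ?e) - v (x + 0 *\<^sub>R ?e)) = 0"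
    by (subst Bochner_Integration.integral_diff[OF i[OF v] i[OF v]], unfold tr[OF \<open>v \<in> borel_measurable borel\<close>]) simp
  ultimately show ?thesis by (simp del: partials.simps)
qed

lemma integral_iexp_partial:
  fixes w :: "real ^ 'n::finite \<Rightarrow> complex"
  assumes w: "w \<in> schwartz"
  shows "(LBINT x. iexp (x \<bullet> \<xi>) * partials [l] w x) =
    - (\<i> * complex_of_real (\<xi> $ l)) * (LBINT x. iexp (x \<bullet> \<xi>) * w x)"
proof -
  let ?c = "\<i> * complex_of_real (\<xi> $ l)"
  have "partials [l] (\<lambda>x. iexp (x \<bullet> \<xi>) * w x) = (\<lambda>x. ?c * (iexp (x \<bullet> \<xi>) * w x) + iexp (x \<bullet> \<xi>) * partials [l] w x)"
    using slowly_increasing_iexp[of \<xi>] schwartz_smooth[OF w] partials_iexp_inner[of "[l]" \<xi>]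
    by (subst partials_mult) (auto simp: slowly_increasing_def mult.assoc)
  moreover have "integrable lborel (\<lambda>x. iexp (x \<bullet> \<xi>) * u x)" if "u \<in> schwartz" for u
    by (intro integrable_iexp_mult schwartz_integrable that)
  ultimately have "?c * (LBINT x. iexp (x \<bullet> \<xi>) * w x) + (LBINT x. iexp (x \<bullet> \<xi>) * partials [l] w x) = 0"
    using integral_partial_eq_0[OF schwartz_mult[OF slowly_increasing_iexp w], of l \<xi>] w schwartz_partials[OF w, of "[l]"]
    by (simp del: partials.simps)
  then show ?thesis by (simp add: eq_neg_iff_add_eq_0 add.commute del: partials.simps)
qed

lemma integral_iexp_iterated_partial:
  fixes w :: "real ^ 'n::finite \<Rightarrow> complex"
  assumes w: "w \<in> schwartz"
  shows "(LBINT x. iexp (x \<bullet> \<xi>) * partials (replicate N l) w x) =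
    (- (\<i> * complex_of_real (\<xi> $ l))) ^ N * (LBINT x. iexp (x \<bullet> \<xi>) * w x)"
proof (induction N)
  case (Suc N)
  have "partials (replicate (Suc N) l) w = partials [l] (partials (replicate N l) w)" by simp
  then show ?case
    using integral_iexp_partial[OF schwartz_partials[OF w], of \<xi> l "replicate N l"] Suc
    by (simp only: power_Suc mult.assoc)
qed auto

text \<open>Integrating by parts repeatedly in one direction yields pure powers of a single
  coordinate; these already control the full weight.\<close>

lemma one_plus_norm_power_le:
  fixes \<xi> :: "real ^ 'n::finite"
  shows "(1 + norm \<xi>) ^ N \<le> real (CARD('n) + 1) ^ N * (1 + (\<Sum>l\<in>UNIV. \<bar>\<xi> $ l\<bar> ^ N))"
proof -
  \<comment> \<open>The entry 1 forces M >= 1, so that the summand 1 of 1 + norm \<xi> is absorbed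
    too.\<close>
  define M where "M = Max (insert 1 (range (\<lambda>l. \<bar>\<xi> $ l\<bar>)))"
  have M: "1 \<le> M" "\<bar>\<xi> $ l\<bar> \<le> M" for l unfolding M_def by (intro Max_ge; simp)+
  have "norm \<xi> \<le> (\<Sum>l\<in>UNIV. \<bar>\<xi> $ l\<bar>)" by (rule norm_le_l1_cart)
  also have "\<dots> \<le> (\<Sum>l\<in>(UNIV :: 'n set). M)" by (intro sum_mono M)
  finally have "1 + norm \<xi> \<le> real (CARD('n) + 1) * M" using M(1) by (simp add: distrib_right)
  then have "(1 + norm \<xi>) ^ N \<le> real (CARD('n) + 1) ^ N * M ^ N"
    by (metis add_nonneg_nonneg norm_ge_zero power_mono power_mult_distrib zero_le_one)
  moreover have "M ^ N \<le> 1 + (\<Sum>l\<in>UNIV. \<bar>\<xi> $ l\<bar> ^ N)"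
  proof -
    have "M \<in> insert 1 (range (\<lambda>l. \<bar>\<xi> $ l\<bar>))" unfolding M_def by (intro Max_in) auto
    then consider "M = 1" | l where "M = \<bar>\<xi> $ l\<bar>" by auto
    then show ?thesis
    proof cases
      case (2 l)
      have "\<bar>\<xi> $ l\<bar> ^ N \<le> (\<Sum>l\<in>UNIV. \<bar>\<xi> $ l\<bar> ^ N)" by (intro member_le_sum) auto
      then show ?thesis using 2 by simp
    qed (simp add: sum_nonneg)
  qed
  ultimately show ?thesis by (meson mult_left_mono of_nat_0_le_iff order_trans zero_le_power)
qed

text \<open>The bound is explicit in \<open>w\<close> because it is applied to a family of symbols
  depending on \<beta> and j, where a constant for each function separately would be
  useless.\<close>

lemma fourier_integral_decay:
  fixes w :: "real ^ 'n::finite \<Rightarrow> complex"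
  assumes w: "w \<in> schwartz"
  shows "(1 + norm \<xi>) ^ N * norm (LBINT x. iexp (x \<bullet> \<xi>) * w x) \<le>
    real (CARD('n) + 1) ^ N * ((LBINT x. norm (w x)) +
      (\<Sum>l\<in>UNIV. LBINT x. norm (partials (replicate N l) w x)))"
proof -
  let ?I = "LBINT x. iexp (x \<bullet> \<xi>) * w x"
  have le: "norm (LBINT x. iexp (x \<bullet> \<xi>) * v x) \<le> (LBINT x. norm (v x))" for v :: "real ^ 'n \<Rightarrow> complex"
    using integral_norm_bound[of lborel "\<lambda>x. iexp (x \<bullet> \<xi>) * v x"] by (simp add: norm_mult)
  have "\<bar>\<xi> $ l\<bar> ^ N * norm ?I \<le> (LBINT x. norm (partials (replicate N l) w x))" for l
    using le[of "partials (replicate N l) w"]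
    unfolding integral_iexp_iterated_partial[OF w] by (simp add: norm_mult norm_power)
  then have "(1 + (\<Sum>l\<in>UNIV. \<bar>\<xi> $ l\<bar> ^ N)) * norm ?I \<le>
      (LBINT x. norm (w x)) + (\<Sum>l\<in>UNIV. LBINT x. norm (partials (replicate N l) w x))"
    unfolding distrib_right sum_distrib_right mult_1 by (intro add_mono le sum_mono)
  then have "real (CARD('n) + 1) ^ N * ((1 + (\<Sum>l\<in>UNIV. \<bar>\<xi> $ l\<bar> ^ N)) * norm ?I) \<le>
      real (CARD('n) + 1) ^ N * ((LBINT x. norm (w x)) +
        (\<Sum>l\<in>UNIV. LBINT x. norm (partials (replicate N l) w x)))"
    by (rule mult_left_mono) simp
  moreover have "(1 + norm \<xi>) ^ N * norm ?I \<le>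
      (real (CARD('n) + 1) ^ N * (1 + (\<Sum>l\<in>UNIV. \<bar>\<xi> $ l\<bar> ^ N))) * norm ?I"
    by (intro mult_right_mono one_plus_norm_power_le) simp
  ultimately show ?thesis unfolding mult.assoc by (rule order_trans[rotated])
qed

lemma inv_fourier_decay:
  fixes w :: "real ^ 'n::finite \<Rightarrow> complex"
  assumes w: "w \<in> schwartz"
  shows "\<exists>C. \<forall>\<xi>. (1 + norm \<xi>) ^ N * norm (inv_fourier w \<xi>) \<le> C"
proof -
  let ?k = "norm (complex_of_real ((2 * pi) powr (- real CARD('n) / 2)))"
  have "(1 + norm \<xi>) ^ N * norm (inv_fourier w \<xi>) =
     ?k * ((1 + norm \<xi>) ^ N * norm (LBINT x. iexp (x \<bullet> \<xi>) * w x))" for \<xi>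
    unfolding inv_fourier_def norm_mult by (simp add: mult_ac)
  then show ?thesis
    by (intro exI allI) (simp only:, rule mult_left_mono[OF fourier_integral_decay[OF w] norm_ge_zero])
qed

lemma inv_fourier_schwartz:
  fixes w :: "real ^ 'n::finite \<Rightarrow> complex"
  assumes w: "w \<in> schwartz"
  shows "inv_fourier w \<in> schwartz"
  by (rule schwartzI[OF smooth_inv_fourier[OF w]]) (metis partials_inv_fourier[OF w] inv_fourier_decay)

lemma inv_fourier_reflect_schwartz: "w \<in> schwartz \<Longrightarrow> (\<lambda>\<xi>. inv_fourier w (- \<xi>)) \<in> schwartz"
  using schwartz_affine[OF inv_fourier_schwartz, of w "-1" 0] by simp

text \<open>The factor \<open>c\<close> covers both signs of the exponent: 1 for the multiplication
  formula and -1 for the inversion formula.\<close>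

lemma integral_iexp_Fubini:
  fixes a b :: "real ^ 'n::finite \<Rightarrow> complex"
  assumes a: "integrable lborel a" and b: "integrable lborel b"
  shows "(LBINT x. a x * (LBINT y. iexp (c * (x \<bullet> y)) * b y)) =
    (LBINT y. b y * (LBINT x. iexp (c * (x \<bullet> y)) * a x))"
proof -
  have [measurable]: "a \<in> borel_measurable borel" "b \<in> borel_measurable borel"
    using a b by (auto dest: borel_measurable_integrable)
  let ?f = "\<lambda>x y. a x * (iexp (c * (x \<bullet> y)) * b y)"
  have "integrable (lborel \<Otimes>\<^sub>M lborel) (case_prod ?f)"
  proof (rule lborel_pair.Fubini_integrable)
    show "case_prod ?f \<in> borel_measurable (lborel \<Otimes>\<^sub>M lborel)" by measurable
    have "integrable lborel (\<lambda>x. norm (a x) * (LBINT y. norm (b y)))"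
      using a by (intro integrable_mult_left integrable_norm)
    then show "integrable lborel (\<lambda>x. LBINT y. norm (case (x, y) of (x, y) \<Rightarrow> ?f x y))"
      by (simp add: norm_mult)
    have "integrable lborel (\<lambda>y. iexp (c * (x \<bullet> y)) * b y)" for x
      using integrable_iexp_mult[OF b, of "c *\<^sub>R x"] by (simp add: inner_commute)
    then show "AE x in lborel. integrable lborel (\<lambda>y. case (x, y) of (x, y) \<Rightarrow> ?f x y)"
      by simp
  qed
  from lborel_pair.Fubini_integral[OF this] show ?thesis by (simp add: mult_ac flip: integral_mult_right_zero)
qed

text \<open>Moves the pairing of \<open>g\<close> with an analysing function to the frequency side,
  where the latter is known explicitly.\<close>

lemma inv_fourier_multiplication:
  fixes a b :: "real ^ 'n::finite \<Rightarrow> complex"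
  assumes "integrable lborel a" "integrable lborel b"
  shows "(LBINT x. inv_fourier a x * b x) = (LBINT x. a x * inv_fourier b x)"
proof -
  let ?k = "complex_of_real ((2 * pi) powr (- real CARD('n) / 2))"
  have "(LBINT x. inv_fourier a x * b x) =
      ?k * (LBINT x. b x * (LBINT y. iexp (1 * (x \<bullet> y)) * a y))"
    unfolding inv_fourier_def by (subst integral_mult_right_zero[symmetric]) (simp add: inner_commute mult_ac)
  also have "\<dots> = ?k * (LBINT x. a x * (LBINT y. iexp (1 * (y \<bullet> x)) * b y))"
    by (subst integral_iexp_Fubini[OF assms(2,1)]) simp
  also have "\<dots> = (LBINT x. a x * inv_fourier b x)"
    unfolding inv_fourier_def by (subst integral_mult_right_zero[symmetric]) (simp add: mult_ac)
  finally show ?thesis .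
qed

section \<open>Gaussian integrals and Fourier inversion\<close>

definition gaussian :: "real ^ 'n::finite \<Rightarrow> real" where
  "gaussian z = exp (- (norm z)\<^sup>2 / 2)"

lemma gaussian_le_1: "gaussian z \<le> 1" and gaussian_nonneg: "0 \<le> gaussian z"
  by (simp_all add: gaussian_def)

lemma gaussian_measurable [measurable]: "gaussian \<in> borel_measurable borel"
  unfolding gaussian_def[abs_def] by measurable

lemma gaussian_prod: "gaussian z = (\<Prod>l\<in>UNIV. exp (- (z $ l)\<^sup>2 / 2))"
  by (simp add: gaussian_def exp_sum[symmetric] norm_vec_def L2_set_def sum_nonneg sum_negf sum_divide_distrib)

text \<open>Up to the factor sqrt (2 pi) this is the characteristic function of the standard normal
  distribution.\<close>

lemma
  shows integrable_iexp_gaussian_1: "integrable lborel (\<lambda>x. iexp (t * x) * complex_of_real (exp (- x\<^sup>2 / 2)))"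
    and integral_iexp_gaussian_1: "(LBINT x. iexp (t * x) * complex_of_real (exp (- x\<^sup>2 / 2))) =
      complex_of_real (sqrt (2 * pi) * exp (- t\<^sup>2 / 2))"
proof -
  interpret real_distribution std_normal_distribution by (rule real_dist_normal_dist)
  have eq: "(\<lambda>x. std_normal_density x *\<^sub>R iexp (t * x)) =
     (\<lambda>x. complex_of_real (1 / sqrt (2 * pi)) * (iexp (t * x) * complex_of_real (exp (- x\<^sup>2 / 2))))"
    by (simp add: std_normal_density_def scaleR_conv_of_real mult_ac)
  have "integrable std_normal_distribution (\<lambda>x. iexp (t * x))" by (rule integrable_iexp) simp_all
  then have "integrable lborel (\<lambda>x. std_normal_density x *\<^sub>R iexp (t * x))"
    by (subst (asm) integrable_density) auto
  then have "integrable lborel (\<lambda>x. complex_of_real (sqrt (2 * pi)) * (complex_of_real (1 / sqrt (2 * pi)) *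
      (iexp (t * x) * complex_of_real (exp (- x\<^sup>2 / 2)))))"
    unfolding eq by (rule integrable_mult_right)
  then show "integrable lborel (\<lambda>x. iexp (t * x) * complex_of_real (exp (- x\<^sup>2 / 2)))"
    by simp
  have "complex_of_real (exp (- t\<^sup>2 / 2)) = (\<integral>x. iexp (t * x) \<partial>std_normal_distribution)"
    using char_std_normal_distribution by (simp add: char_def fun_eq_iff)
  also have "\<dots> = (LBINT x. std_normal_density x *\<^sub>R iexp (t * x))"
    by (subst integral_density) auto
  also have "\<dots> = complex_of_real (1 / sqrt (2 * pi)) * (LBINT x. iexp (t * x) * complex_of_real (exp (- x\<^sup>2 / 2)))"
    unfolding eq by (rule integral_mult_right_zero)
  finally show "(LBINT x. iexp (t * x) * complex_of_real (exp (- x\<^sup>2 / 2))) =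
      complex_of_real (sqrt (2 * pi) * exp (- t\<^sup>2 / 2))"
    by (simp add: field_simps)
qed

lemma
  fixes t :: "real ^ 'n::finite"
  shows integrable_iexp_gaussian: "integrable lborel (\<lambda>z. iexp (z \<bullet> t) * complex_of_real (gaussian z))"
    and integral_iexp_gaussian: "(LBINT z. iexp (z \<bullet> t) * complex_of_real (gaussian z)) =
      complex_of_real (sqrt (2 * pi) ^ CARD('n) * gaussian t)"
proof -
  have eq: "iexp (z \<bullet> t) * complex_of_real (gaussian z) =
      (\<Prod>l\<in>UNIV. iexp ((t $ l) * (z $ l)) * complex_of_real (exp (- (z $ l)\<^sup>2 / 2)))" for z
    by (simp add: gaussian_prod prod.distrib inner_vec_def exp_sum sum_distrib_left mult_ac)
  show "integrable lborel (\<lambda>z. iexp (z \<bullet> t) * complex_of_real (gaussian z))"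
    unfolding eq by (intro integrable_lborel_prod integrable_iexp_gaussian_1)
  show "(LBINT z. iexp (z \<bullet> t) * complex_of_real (gaussian z)) =
      complex_of_real (sqrt (2 * pi) ^ CARD('n) * gaussian t)"
    unfolding eq
    by (subst integral_lborel_prod, rule integrable_iexp_gaussian_1)
      (simp only: integral_iexp_gaussian_1, simp add: gaussian_prod prod.distrib)
qed

lemma gaussian_integrable: "integrable lborel (\<lambda>z :: real ^ 'n::finite. complex_of_real (gaussian z))"
  using integrable_iexp_gaussian[of "0 :: real ^ 'n"] by simp

lemma powr_half_power: "(2 * pi) powr (- real n / 2) = 1 / sqrt (2 * pi) ^ n"
proof -
  have "sqrt (2 * pi) ^ n = ((2 * pi) powr (1 / 2)) powr real n"
    by (subst powr_realpow) (simp_all add: powr_half_sqrt)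
  also have "\<dots> = (2 * pi) powr (real n / 2)" by (simp add: powr_powr)
  finally have eq: "sqrt (2 * pi) ^ n = (2 * pi) powr (real n / 2)" .
  have "(2 * pi) powr (- real n / 2) = inverse ((2 * pi) powr (real n / 2))"
    by (subst powr_minus[symmetric]) simp
  then show ?thesis unfolding eq[symmetric] by (simp only: inverse_eq_divide)
qed

text \<open>\<open>inv_fourier g (- \<xi>)\<close> is the Fourier transform of \<open>g\<close>. The
  exponential alone is not integrable in \<xi>, so Fubini needs a Gaussian factor of argument h
  \<xi>. On the space side this factor averages \<open>g\<close> about \<open>x\<close> with a
  Gaussian of width h. Dominated convergence on both sides then lets h tend to 0.\<close>

theorem fourier_inversion:
  fixes g :: "real ^ 'n::finite \<Rightarrow> complex"
  assumes g: "g \<in> schwartz"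
  shows "inv_fourier (\<lambda>\<xi>. inv_fourier g (- \<xi>)) x = g x"
proof -
  define h where "h n = 1 / real (Suc n)" for n
  have h: "h n > 0" for n by (simp add: h_def)
  have h0: "h \<longlonglongrightarrow> 0" unfolding h_def by (rule LIMSEQ_inverse_real_of_nat[unfolded inverse_eq_divide])
  let ?k = "complex_of_real (1 / sqrt (2 * pi) ^ CARD('n))"
  let ?d = "sqrt (2 * pi) ^ CARD('n)"
  let ?G = "\<lambda>\<xi>. inv_fourier g (- \<xi>)"
  have gi: "integrable lborel g" by (rule schwartz_integrable[OF g])
  note [measurable] = schwartz_measurable[OF g]
  have G: "?G \<in> schwartz" by (rule inv_fourier_reflect_schwartz[OF g])
  have Gi: "integrable lborel ?G" by (rule schwartz_integrable[OF G])
  obtain B where B: "\<And>y. norm (g y) \<le> B"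
    using schwartz_bound[OF g, of 0 "[]"] by auto
  have isq: "integrable lborel (\<lambda>z. complex_of_real (gaussian z))" by (rule gaussian_integrable)
  have gsc: "integrable lborel (\<lambda>\<xi> :: real ^ 'n. iexp (\<xi> \<bullet> t) * complex_of_real (gaussian (h n *\<^sub>R \<xi>)))" for n t
    using integrable_lborel_affine_iff[of "h n" "\<lambda>z. complex_of_real (gaussian z)" 0] h[of n]
    by (intro integrable_iexp_mult) (simp add: gaussian_integrable)
  \<comment> \<open>The transform of the dilated Gaussian, by the substitution z = h \<xi>. With t =
    x - y it is an approximate identity of width h about \<open>x\<close>.\<close>
  have H: "(LBINT \<xi>. iexp (\<xi> \<bullet> t) * complex_of_real (gaussian (h n *\<^sub>R \<xi>))) =
      complex_of_real (?d * gaussian ((1 / h n) *\<^sub>R t) / h n ^ CARD('n))" for n and t :: "real ^ 'n"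
  proof -
    have "complex_of_real (?d * gaussian ((1 / h n) *\<^sub>R t)) =
        (LBINT z. iexp (z \<bullet> ((1 / h n) *\<^sub>R t)) * complex_of_real (gaussian z))"
      by (rule integral_iexp_gaussian[symmetric])
    also have "\<dots> = h n ^ CARD('n) *\<^sub>R (LBINT \<xi>. iexp (\<xi> \<bullet> t) * complex_of_real (gaussian (h n *\<^sub>R \<xi>)))"
      using h[of n] by (subst integral_lborel_affine[of "h n" _ 0]) auto
    finally show ?thesis using h[of n] by (simp add: scaleR_conv_of_real field_simps)
  qed
  have eq: "(LBINT \<xi>. ?G \<xi> * (iexp (\<xi> \<bullet> x) * complex_of_real (gaussian (h n *\<^sub>R \<xi>)))) =
      (LBINT z. g (x + h n *\<^sub>R z) * complex_of_real (gaussian z))" for n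
  proof -
    let ?a = "\<lambda>\<xi>. iexp (\<xi> \<bullet> x) * complex_of_real (gaussian (h n *\<^sub>R \<xi>))"
    have "(LBINT \<xi>. ?G \<xi> * ?a \<xi>) = ?k * (LBINT \<xi>. ?a \<xi> * (LBINT y. iexp ((-1) * (\<xi> \<bullet> y)) * g y))"
      unfolding inv_fourier_def powr_half_power
      by (simp add: inner_commute mult_ac flip: integral_mult_right_zero)
    also have "\<dots> = ?k * (LBINT y. g y * (LBINT \<xi>. iexp ((-1) * (\<xi> \<bullet> y)) * ?a \<xi>))"
      by (subst integral_iexp_Fubini[OF gsc gi]) simp
    also have "\<dots> = ?k * (LBINT y. g y * (LBINT \<xi>. iexp (\<xi> \<bullet> (x - y)) * complex_of_real (gaussian (h n *\<^sub>R \<xi>))))"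
      by (simp add: inner_diff_right exp_diff exp_minus ring_distribs field_simps)
    also have "\<dots> = (LBINT y. g y * complex_of_real (gaussian ((1 / h n) *\<^sub>R (x - y)) / h n ^ CARD('n)))"
      unfolding H integral_mult_right_zero[symmetric] by (rule Bochner_Integration.integral_cong) simp_all
    also have "\<dots> = h n ^ CARD('n) *\<^sub>R (LBINT z. g (x + h n *\<^sub>R z) *
        complex_of_real (gaussian ((1 / h n) *\<^sub>R (x - (x + h n *\<^sub>R z))) / h n ^ CARD('n)))"
      \<comment> \<open>Substitution y = x + h z; the Jacobian cancels the power of h in the
        kernel.\<close>
      using h[of n] by (subst integral_lborel_affine[of "h n" _ x]) auto
    also have "\<dots> = (LBINT z. g (x + h n *\<^sub>R z) * complex_of_real (gaussian z))"
    proof -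
      have "gaussian ((1 / h n) *\<^sub>R (x - (x + h n *\<^sub>R z))) = gaussian z" for z
        using h[of n] by (simp add: gaussian_def)
      then show ?thesis using h[of n]
        by (subst integral_scaleR_right[symmetric]) (simp add: scaleR_conv_of_real[of _ "_ :: complex"])
    qed
    finally show ?thesis .
  qed
  have gauss_lim: "(\<lambda>n. gaussian (h n *\<^sub>R \<xi>)) \<longlonglongrightarrow> 1" for \<xi> :: "real ^ 'n"
    unfolding gaussian_def by (rule tendsto_eq_intros h0 | simp)+
  have "(\<lambda>n. LBINT \<xi>. ?G \<xi> * (iexp (\<xi> \<bullet> x) * complex_of_real (gaussian (h n *\<^sub>R \<xi>)))) \<longlonglongrightarrow>
     (LBINT \<xi>. ?G \<xi> * (iexp (\<xi> \<bullet> x) * 1))"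
  proof (rule integral_dominated_convergence)
    have [measurable]: "?G \<in> borel_measurable borel" using Gi by (auto dest: borel_measurable_integrable)
    show "(\<lambda>\<xi>. ?G \<xi> * (iexp (\<xi> \<bullet> x) * 1)) \<in> borel_measurable lborel"
      "\<And>n. (\<lambda>\<xi>. ?G \<xi> * (iexp (\<xi> \<bullet> x) * complex_of_real (gaussian (h n *\<^sub>R \<xi>)))) \<in> borel_measurable lborel"
      by measurable
    show "integrable lborel (\<lambda>\<xi>. norm (?G \<xi>))" using Gi by simp
    show "AE \<xi> in lborel. (\<lambda>n. ?G \<xi> * (iexp (\<xi> \<bullet> x) * complex_of_real (gaussian (h n *\<^sub>R \<xi>)))) \<longlonglongrightarrow> ?G \<xi> * (iexp (\<xi> \<bullet> x) * 1)"
      using tendsto_of_real[OF gauss_lim] by (intro always_eventually allI tendsto_mult tendsto_const) simp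
    show "AE \<xi> in lborel. norm (?G \<xi> * (iexp (\<xi> \<bullet> x) * complex_of_real (gaussian (h n *\<^sub>R \<xi>)))) \<le> norm (?G \<xi>)" for n
      by (intro always_eventually allI) (simp add: norm_mult gaussian_le_1 gaussian_nonneg mult_left_le)
  qed
  moreover have "(\<lambda>n. LBINT z. g (x + h n *\<^sub>R z) * complex_of_real (gaussian z)) \<longlonglongrightarrow>
     (LBINT z. g x * complex_of_real (gaussian (z :: real ^ 'n)))"
  proof (rule integral_dominated_convergence)
    show "(\<lambda>z. g x * complex_of_real (gaussian (z :: real ^ 'n))) \<in> borel_measurable lborel"
      "\<And>n. (\<lambda>z. g (x + h n *\<^sub>R z) * complex_of_real (gaussian z)) \<in> borel_measurable lborel"
      by measurable
    show "integrable lborel (\<lambda>z :: real ^ 'n. B * norm (complex_of_real (gaussian z)))"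
      by (intro integrable_mult_right integrable_norm gaussian_integrable)
    have "isCont g x" using smooth_continuous[OF schwartz_smooth[OF g]]
      by (simp add: continuous_on_eq_continuous_at)
    moreover have "(\<lambda>n. x + h n *\<^sub>R z) \<longlonglongrightarrow> x" for z
      by (rule tendsto_eq_intros h0 | simp)+
    ultimately show "AE z in lborel. (\<lambda>n. g (x + h n *\<^sub>R z) * complex_of_real (gaussian z)) \<longlonglongrightarrow> g x * complex_of_real (gaussian z)"
      by (intro always_eventually allI tendsto_mult tendsto_const isCont_tendsto_compose[of x g])
    show "AE z in lborel. norm (g (x + h n *\<^sub>R z) * complex_of_real (gaussian z)) \<le> B * norm (complex_of_real (gaussian z))" for n
      using B by (intro always_eventually allI) (simp add: norm_mult mult_right_mono)
  qed
  ultimately have "(LBINT \<xi>. ?G \<xi> * (iexp (\<xi> \<bullet> x) * 1)) = (LBINT z. g x * complex_of_real (gaussian (z :: real ^ 'n)))"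
    unfolding eq by (rule LIMSEQ_unique)
  also have "\<dots> = g x * ?d"
    using integral_iexp_gaussian[of "0 :: real ^ 'n"] by (simp add: gaussian_def)
  finally show ?thesis
    unfolding inv_fourier_def[of "\<lambda>\<xi>. inv_fourier g (- \<xi>)"] powr_half_power by (simp add: mult_ac)
qed

section \<open>Sums over lattice points and multi-indices\<close>

lemma bij_vec_nth: "bij_betw vec_nth (UNIV :: ('a ^ 'n) set) (Pi\<^sub>E UNIV (\<lambda>_. UNIV))"
  unfolding PiE_UNIV_domain
  by (rule bij_betw_byWitness[where f' = vec_lambda]) (auto simp: vec_nth_inverse)

text \<open>Vectors are families over a finite index type, and absolute summability in every
  coordinate is what allows the sum of products to factorise.\<close>

lemma
  fixes f :: "'n::finite \<Rightarrow> 'a::countable \<Rightarrow> 'c::{real_normed_field, banach, second_countable_topology}"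
  assumes "\<And>l. (\<lambda>x. norm (f l x)) summable_on UNIV"
  shows abs_summable_on_vec_prod: "(\<lambda>v :: 'a ^ 'n. norm (\<Prod>l\<in>UNIV. f l (v $ l))) summable_on UNIV"
    and infsum_vec_prod: "(\<Sum>\<^sub>\<infinity>v :: 'a ^ 'n. \<Prod>l\<in>UNIV. f l (v $ l)) = (\<Prod>l\<in>UNIV. \<Sum>\<^sub>\<infinity>x. f l x)"
proof -
  have "Infinite_Set_Sum.abs_summable_on (\<lambda>g. \<Prod>l\<in>UNIV. f l (g l)) (Pi\<^sub>E UNIV (\<lambda>_. UNIV))"
    using assms by (intro abs_summable_on_prod_PiE) (auto simp: abs_summable_equivalent[symmetric])
  then have "(\<lambda>g. norm (\<Prod>l\<in>UNIV. f l (g l))) summable_on (Pi\<^sub>E UNIV (\<lambda>_. UNIV))"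
    by (simp add: abs_summable_equivalent[symmetric])
  then show "(\<lambda>v :: 'a ^ 'n. norm (\<Prod>l\<in>UNIV. f l (v $ l))) summable_on UNIV"
    by (subst summable_on_reindex_bij_betw[OF bij_vec_nth, of "\<lambda>g. norm (\<Prod>l\<in>UNIV. f l (g l))"])
  show "(\<Sum>\<^sub>\<infinity>v :: 'a ^ 'n. \<Prod>l\<in>UNIV. f l (v $ l)) = (\<Prod>l\<in>UNIV. \<Sum>\<^sub>\<infinity>x. f l x)"
    using infsum_prod_PiE_abs[of UNIV f "\<lambda>_. UNIV"] assms
    by (subst infsum_reindex_bij_betw[OF bij_vec_nth, of "\<lambda>g. \<Prod>l\<in>UNIV. f l (g l)"]) simp
qed

lemma summable_on_inverse_one_plus_square_int:
  "(\<lambda>z :: int. inverse (1 + (real_of_int z)\<^sup>2)) summable_on UNIV"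
proof -
  have "summable (\<lambda>n. 2 * inverse (real (Suc n) ^ 2))"
    using inverse_power_summable[of 2, where 'a = real]
    by (intro summable_mult) (subst summable_Suc_iff[of "\<lambda>n. inverse (real n ^ 2)"], simp)
  then have "summable (\<lambda>n. inverse (1 + (real n)\<^sup>2))"
  proof (rule summable_comparison_test'[of _ 0])
    fix n :: nat
    have "(real (Suc n))\<^sup>2 \<le> 2 * (1 + (real n)\<^sup>2)"
      using zero_le_power2[of "real n - 1"] by (simp add: power2_eq_square algebra_simps)
    then have "inverse (2 * (1 + (real n)\<^sup>2)) \<le> inverse ((real (Suc n))\<^sup>2)"
      by (intro le_imp_inverse_le) simp_all
    then show "norm (inverse (1 + (real n)\<^sup>2)) \<le> 2 * inverse ((real (Suc n))\<^sup>2)"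
      unfolding inverse_mult_distrib by simp
  qed
  then have n: "(\<lambda>n. inverse (1 + (real n)\<^sup>2)) summable_on UNIV"
    by (intro summable_nonneg_imp_summable_on) auto
  have 1: "(\<lambda>z :: int. inverse (1 + (real_of_int z)\<^sup>2)) summable_on range int"
    using n by (subst summable_on_reindex) (auto simp: o_def)
  have 2: "(\<lambda>z :: int. inverse (1 + (real_of_int z)\<^sup>2)) summable_on range (\<lambda>n. - int n)"
    using n by (subst summable_on_reindex) (auto simp: o_def inj_on_def)
  have "(UNIV :: int set) = range int \<union> range (\<lambda>n. - int n)"
    by (auto intro: int_cases2)
  then show ?thesis using summable_on_union[OF 1 2] by simp
qed

lemma lattice_point_nth [simp]: "lattice_point m $ l = real_of_int (m $ l)"
  by (simp add: lattice_point_def)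

lemma lattice_point_0 [simp]: "lattice_point 0 = 0"
  by (simp add: vec_eq_iff)

lemma lattice_point_add: "lattice_point (a + b) = lattice_point a + lattice_point b"
  and lattice_point_diff: "lattice_point (a - b) = lattice_point a - lattice_point b"
  by (simp_all add: vec_eq_iff)

lemma summable_on_lattice:
  "(\<lambda>m :: int ^ 'n::finite. 1 / (1 + norm (lattice_point m)) ^ (2 * CARD('n))) summable_on UNIV"
proof (rule summable_on_comparison_test)
  show "(\<lambda>m :: int ^ 'n. \<Prod>l\<in>UNIV. inverse (1 + (real_of_int (m $ l))\<^sup>2)) summable_on UNIV"
    using abs_summable_on_vec_prod[of "\<lambda>l z. inverse (1 + (real_of_int z)\<^sup>2)"]
      summable_on_inverse_one_plus_square_int by (simp add: prod_nonneg)
  fix m :: "int ^ 'n"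
  have "(\<Prod>l\<in>UNIV. 1 + (real_of_int (m $ l))\<^sup>2) > 0"
    by (intro prod_pos) (simp add: add_pos_nonneg)
  then have "1 / (1 + norm (lattice_point m)) ^ (2 * CARD('n)) \<le>
      1 / (\<Prod>l\<in>UNIV. 1 + (real_of_int (m $ l))\<^sup>2)"
    using one_plus_norm_power_ge[of "lattice_point m"] by (intro divide_left_mono) (auto simp: add_pos_nonneg)
  then show "1 / (1 + norm (lattice_point m)) ^ (2 * CARD('n)) \<le>
      (\<Prod>l\<in>UNIV. inverse (1 + (real_of_int (m $ l))\<^sup>2))"
    by (simp add: inverse_eq_divide prod_dividef)
qed auto

lemma summable_on_mi_abs:
  assumes "0 \<le> r" "r < (1::real)"
  shows "(\<lambda>\<beta> :: nat ^ 'n::finite. r ^ mi_abs \<beta>) summable_on UNIV"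
proof -
  have "(\<lambda>k. norm (r ^ k)) summable_on UNIV"
    using assms by (intro summable_nonneg_imp_summable_on) (auto simp: power_abs[symmetric] intro: summable_geometric)
  from abs_summable_on_vec_prod[of "\<lambda>_ k. r ^ k", OF this] show ?thesis
    using assms by (simp add: mi_abs_def power_sum prod_nonneg)
qed

lemma
  fixes a :: "'n::finite \<Rightarrow> complex"
  shows abs_summable_on_mi_exp: "(\<lambda>\<beta> :: nat ^ 'n. norm (\<Prod>l\<in>UNIV. a l ^ (\<beta> $ l) / fact (\<beta> $ l))) summable_on UNIV"
    and has_sum_mi_exp: "((\<lambda>\<beta> :: nat ^ 'n. \<Prod>l\<in>UNIV. a l ^ (\<beta> $ l) / fact (\<beta> $ l)) has_sum exp (\<Sum>l\<in>UNIV. a l)) UNIV"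
proof -
  have n: "(\<lambda>k. norm (a l ^ k / fact k)) summable_on UNIV" for l
    using summable_norm_exp[of "a l"] by (intro summable_nonneg_imp_summable_on) (auto simp: scaleR_conv_of_real field_simps)
  have e: "(\<Sum>\<^sub>\<infinity>k. a l ^ k / fact k) = exp (a l)" for l
  proof -
    have "((\<lambda>k. a l ^ k / fact k) has_sum exp (a l)) UNIV"
      using norm_summable_imp_has_sum[OF summable_on_imp_summable[OF n]] exp_converges[of "a l"]
      by (simp add: scaleR_conv_of_real field_simps)
    then show ?thesis by (rule infsumI)
  qed
  show s: "(\<lambda>\<beta> :: nat ^ 'n. norm (\<Prod>l\<in>UNIV. a l ^ (\<beta> $ l) / fact (\<beta> $ l))) summable_on UNIV"
    by (rule abs_summable_on_vec_prod[of "\<lambda>l k. a l ^ k / fact k", OF n])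
  have "(\<Sum>\<^sub>\<infinity>\<beta> :: nat ^ 'n. \<Prod>l\<in>UNIV. a l ^ (\<beta> $ l) / fact (\<beta> $ l)) = exp (\<Sum>l\<in>UNIV. a l)"
    using infsum_vec_prod[of "\<lambda>l k. a l ^ k / fact k", OF n] by (simp add: e exp_sum)
  then show "((\<lambda>\<beta> :: nat ^ 'n. \<Prod>l\<in>UNIV. a l ^ (\<beta> $ l) / fact (\<beta> $ l)) has_sum exp (\<Sum>l\<in>UNIV. a l)) UNIV"
    using has_sum_infsum[OF abs_summable_summable[OF s]] by simp
qed

section \<open>Pointwise convergence of Fourier series\<close>

lemma
  fixes c d :: int
  shows finite_int_box: "finite {a :: int ^ 'n::finite. \<forall>l. c \<le> a $ l \<and> a $ l < d}" (is "finite ?A")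
    and card_int_box: "card {a :: int ^ 'n::finite. \<forall>l. c \<le> a $ l \<and> a $ l < d} = nat (d - c) ^ CARD('n)"
proof -
  have bij: "bij_betw vec_nth ?A (Pi\<^sub>E UNIV (\<lambda>_ :: 'n. {c..<d}))"
    by (rule bij_betw_byWitness[where f' = vec_lambda]) (auto simp: vec_nth_inverse PiE_UNIV_domain)
  have "finite (Pi\<^sub>E UNIV (\<lambda>_ :: 'n. {c..<d}))" by (intro finite_PiE) auto
  then show "finite ?A" using bij_betw_finite[OF bij] by simp
  show "card ?A = nat (d - c) ^ CARD('n)"
    using bij_betw_same_card[OF bij] by (simp add: card_PiE)
qed

section \<open>Fejer means of families indexed by lattice points\<close>

definition grid :: "nat \<Rightarrow> (int ^ 'n::finite) set" where
  "grid N = {a. \<forall>l. 0 \<le> a $ l \<and> a $ l < int N}"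

lemma finite_grid: "finite (grid N)" and card_grid: "card (grid N :: (int ^ 'n::finite) set) = N ^ CARD('n)"
  unfolding grid_def by (rule finite_int_box) (simp add: card_int_box)

text \<open>A lattice point m equals a - b for as many pairs as the product of the numbers max 0 (N
  - |m_l|), so these are the Cesaro means with weights max 0 (1 - |m_l| / N). The double sum is kept
  because it matches a squared modulus of an exponential sum.\<close>

definition fejer_mean :: "nat \<Rightarrow> (int ^ 'n::finite \<Rightarrow> complex) \<Rightarrow> complex" where
  "fejer_mean N F = (\<Sum>a\<in>grid N. \<Sum>b\<in>grid N. F (a - b)) / of_nat (N ^ CARD('n))"

text \<open>For fixed b the inner sum runs over a translate of the grid. If b keeps a fixed distance
  from the faces, the translate contains a prescribed finite set and its sum is close to
  \<open>S\<close>. The share of the remaining b tends to 0, and each of them contributes at most 2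
  B.\<close>

lemma fejer_mean_tendsto:
  fixes F :: "int ^ 'n::finite \<Rightarrow> complex"
  assumes abs: "(\<lambda>m. norm (F m)) summable_on UNIV" and S: "(F has_sum S) UNIV"
  shows "(\<lambda>N. fejer_mean N F) \<longlonglongrightarrow> S"
proof -
  define B where "B = (\<Sum>\<^sub>\<infinity>m. norm (F m))"
  have B: "norm (sum F X) \<le> B" if "finite X" for X
  proof -
    have "norm (sum F X) \<le> (\<Sum>m\<in>X. norm (F m))" by (rule norm_sum)
    also have "\<dots> \<le> B" unfolding B_def by (rule finite_sum_le_infsum[OF abs that]) auto
    finally show ?thesis .
  qed
  have SB: "norm S \<le> B" unfolding B_def using norm_has_sum_bound[OF has_sum_infsum[OF abs] S] .
  show ?thesis
  proof (rule LIMSEQ_I)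
    fix r :: real assume r: "r > 0"
    have "\<forall>\<^sub>F X in finite_subsets_at_top UNIV. dist (sum F X) S < r / 2"
      using S r unfolding has_sum_def by (intro tendstoD) auto
    then obtain T where T: "finite T" "\<And>X. finite X \<Longrightarrow> T \<subseteq> X \<Longrightarrow> dist (sum F X) S < r / 2"
      unfolding eventually_finite_subsets_at_top by auto
    \<comment> \<open>\<open>M\<close> is the distance from the faces that keeps b + m in the grid
      for every m in \<open>T\<close>.\<close>
    obtain M where M: "\<And>m l. m \<in> T \<Longrightarrow> \<bar>m $ l\<bar> \<le> int M"
    proof -
      define K where "K = Max (insert 0 ((\<lambda>(m, l). \<bar>m $ l\<bar>) ` (T \<times> UNIV)))"
      have fin: "finite (insert 0 ((\<lambda>(m, l). \<bar>m $ l\<bar>) ` (T \<times> (UNIV :: 'n set))))" using T(1) by auto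
      have "\<bar>m $ l\<bar> \<le> K" if "m \<in> T" for m l
        unfolding K_def by (rule Max_ge[OF fin]) (use that in force)
      then show ?thesis using that[of "nat K"] by force
    qed
    \<comment> \<open>Twice \<open>B\<close> times the share of those b in the grid that are too
      close to a face.\<close>
    define q where "q N = 2 * B * (1 - (1 - 2 * real M / real N) ^ CARD('n))" for N
    have "q \<longlonglongrightarrow> 2 * B * (1 - (1 - 0) ^ CARD('n))"
      unfolding q_def
      by (intro tendsto_intros tendsto_divide_0[OF tendsto_const]
          filterlim_at_top_imp_at_infinity filterlim_real_sequentially)
    then have "\<forall>\<^sub>F N in sequentially. q N < r / 2"
      using r by (intro order_tendstoD(2)) auto
    then have ev: "\<forall>\<^sub>F N in sequentially. q N < r / 2 \<and> N > 2 * M"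
      by (intro eventually_conj eventually_gt_at_top)
    have main: "norm (fejer_mean N F - S) < r" if N: "q N < r / 2" "N > 2 * M" for N
    proof -
      let ?A = "grid N :: (int ^ 'n) set" and ?n = "real (N ^ CARD('n))"
      let ?G = "{b :: int ^ 'n. \<forall>l. int M \<le> b $ l \<and> b $ l < int N - int M}"
      have GA: "?G \<subseteq> ?A" unfolding grid_def
        by (intro Collect_mono impI) (smt (verit) of_nat_0_le_iff)
      have cG: "real (card ?G) = (real N - 2 * real M) ^ CARD('n)"
        using N(2) by (simp add: card_int_box of_nat_diff nat_diff_distrib')
      have n: "?n > 0" using N(2) by simp
      let ?T = "\<lambda>b. \<Sum>a\<in>?A. F (a - b)"
      have eqT: "?T b = sum F ((\<lambda>a. a - b) ` ?A)" for b
        by (subst sum.reindex) (auto simp: inj_on_def)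
      have good: "norm (?T b - S) \<le> r / 2" if "b \<in> ?G" for b
      proof -
        have "T \<subseteq> (\<lambda>a. a - b) ` ?A"
        proof
          fix m assume m: "m \<in> T"
          have "0 \<le> (m + b) $ l \<and> (m + b) $ l < int N" for l
          proof -
            have "int M \<le> b $ l \<and> b $ l < int N - int M" using that by blast
            then show ?thesis using M[OF m, of l] unfolding vector_add_component by linarith
          qed
          then have "m + b \<in> ?A" by (simp add: grid_def)
          then show "m \<in> (\<lambda>a. a - b) ` ?A" by (rule rev_image_eqI) simp
        qed
        then show ?thesis using T(2)[OF finite_imageI[OF finite_grid], of "\<lambda>a. a - b" N]
          unfolding eqT dist_norm by (intro less_imp_le) simp
      qed
      have bad: "norm (?T b - S) \<le> 2 * B" for b
        using norm_triangle_ineq4[of "?T b" S] SB B[OF finite_imageI[OF finite_grid], of "\<lambda>a. a - b" N]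
        unfolding eqT by linarith
      have "S = (\<Sum>b\<in>?A. S) / of_nat (N ^ CARD('n))"
        unfolding sum_constant card_grid using n by simp
      moreover have "fejer_mean N F = (\<Sum>b\<in>?A. ?T b) / of_nat (N ^ CARD('n))"
        unfolding fejer_mean_def by (rule arg_cong2[OF sum.swap refl])
      ultimately have "fejer_mean N F - S = (\<Sum>b\<in>?A. ?T b - S) / of_nat (N ^ CARD('n))"
        unfolding sum_subtractf diff_divide_distrib by simp
      then have "norm (fejer_mean N F - S) = norm (\<Sum>b\<in>?A. ?T b - S) / ?n"
        by (simp add: norm_divide norm_power)
      also have "\<dots> \<le> (\<Sum>b\<in>?A. norm (?T b - S)) / ?n"
        by (intro divide_right_mono norm_sum) simp
      also have "(\<Sum>b\<in>?A. norm (?T b - S)) = (\<Sum>b\<in>?G. norm (?T b - S)) + (\<Sum>b\<in>?A - ?G. norm (?T b - S))"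
        using sum.subset_diff[OF GA finite_grid] by (simp add: add.commute)
      also have "\<dots> \<le> real (card ?G) * (r / 2) + real (card (?A - ?G)) * (2 * B)"
        by (intro add_mono sum_bounded_above good bad)
      also have "real (card (?A - ?G)) = ?n - real (card ?G)"
        by (simp add: card_Diff_subset[OF finite_subset[OF GA finite_grid] GA] card_grid
            card_mono[OF finite_grid GA, unfolded card_grid] of_nat_diff)
      also have "real (card ?G) * (r / 2) \<le> ?n * (r / 2)"
        using card_mono[OF finite_grid GA] r by (intro mult_right_mono) (simp_all add: card_grid)
      finally have "norm (fejer_mean N F - S) \<le> (?n * (r / 2) + (?n - real (card ?G)) * (2 * B)) / ?n"
        using n by (simp add: divide_right_mono)
      also have "\<dots> = r / 2 + q N"
      proof -
        have "1 - 2 * real M / real N = (real N - 2 * real M) / real N"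
          using N(2) by (simp add: field_simps)
        then have "q N = 2 * B * (1 - real (card ?G) / ?n)"
          unfolding q_def cG by (simp add: power_divide)
        moreover have "(?n * (r / 2) + (?n - g) * (2 * B)) / ?n = r / 2 + 2 * B * (1 - g / ?n)" for g
          using n by (simp add: field_simps)
        ultimately show ?thesis by presburger
      qed
      also have "\<dots> < r" using N(1) by simp
      finally show ?thesis .
    qed
    show "\<exists>no. \<forall>N\<ge>no. norm (fejer_mean N F - S) < r"
      using ev main unfolding eventually_sequentially by blast
  qed
qed

section \<open>Integration over a period and the Fejer kernel\<close>

abbreviation cube :: "(real ^ 'n::finite) set" where
  "cube \<equiv> cbox (\<chi> l. - pi) (\<chi> l. pi)"

definition cube_integral :: "(real ^ 'n::finite \<Rightarrow> complex) \<Rightarrow> complex" where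
  "cube_integral h = (LBINT y. indicator cube y *\<^sub>R h y)"

lemma cube_integrable:
  fixes h :: "real ^ 'n::finite \<Rightarrow> 'b::{banach, second_countable_topology}"
  assumes "continuous_on UNIV h"
  shows "integrable lborel (\<lambda>y. indicator cube y *\<^sub>R h y)"
  using assms by (intro borel_integrable_compact compact_cbox continuous_on_subset[OF assms]) auto

lemma cube_integral_add:
  assumes "continuous_on UNIV h" "continuous_on UNIV g"
  shows "cube_integral (\<lambda>y. h y + g y) = cube_integral h + cube_integral g"
  unfolding cube_integral_def scaleR_add_right
  by (intro Bochner_Integration.integral_add cube_integrable assms)

lemma cube_integral_diff:
  assumes "continuous_on UNIV h" "continuous_on UNIV g"
  shows "cube_integral (\<lambda>y. h y - g y) = cube_integral h - cube_integral g"
  unfolding cube_integral_def scaleR_diff_right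
  by (intro Bochner_Integration.integral_diff cube_integrable assms)

lemma cube_integral_cmult: "cube_integral (\<lambda>y. c * h y) = c * cube_integral h"
  unfolding cube_integral_def by (simp flip: integral_mult_right_zero)

lemma cube_integral_sum:
  assumes "\<And>i. i \<in> I \<Longrightarrow> continuous_on UNIV (h i)"
  shows "cube_integral (\<lambda>y. \<Sum>i\<in>I. h i y) = (\<Sum>i\<in>I. cube_integral (h i))"
  unfolding cube_integral_def scaleR_sum_right
  by (intro Bochner_Integration.integral_sum cube_integrable assms)

lemma integral_iexp_period:
  fixes k :: int
  shows "(LBINT t. indicator {- pi..pi} t *\<^sub>R iexp (real_of_int k * t)) =
    (if k = 0 then complex_of_real (2 * pi) else 0)"
proof (cases "k = 0")
  case True
  have "(LBINT t. indicator {- pi..pi} t *\<^sub>R (1 :: complex)) = complex_of_real pi - complex_of_real (- pi)"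
    by (rule integral_FTC_Icc) (auto intro!: derivative_eq_intros)
  then show ?thesis using True by simp
next
  case False
  let ?F = "\<lambda>t. iexp (real_of_int k * t) / (\<i> * of_int k)"
  have "(LBINT t. indicator {- pi..pi} t *\<^sub>R iexp (real_of_int k * t)) = ?F pi - ?F (- pi)"
  proof (rule integral_FTC_Icc)
    fix t :: real
    have "((\<lambda>z. exp (\<i> * (of_int k * z)) / (\<i> * of_int k)) has_field_derivative exp (\<i> * (of_int k * of_real t)))
        (at (of_real t))"
      using False by (auto intro!: derivative_eq_intros simp: field_simps)
    moreover have "(complex_of_real has_vector_derivative 1) (at t)"
      unfolding has_vector_derivative_def
      using bounded_linear_imp_has_derivative[OF bounded_linear_of_real] by (simp add: scaleR_conv_of_real)
    ultimately have "((\<lambda>z. exp (\<i> * (of_int k * z)) / (\<i> * of_int k)) \<circ> complex_of_real has_vector_derivative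
        1 * exp (\<i> * (of_int k * of_real t))) (at t)"
      by (intro field_vector_diff_chain_at)
    then
    have "((\<lambda>t. exp (\<i> * (of_int k * of_real t)) / (\<i> * of_int k)) has_vector_derivative exp (\<i> * (of_int k * of_real t))) (at t)"
      by (simp add: o_def)
    then show "(?F has_vector_derivative iexp (real_of_int k * t)) (at t within {- pi..pi})"
      by (auto intro: has_vector_derivative_at_within)
  qed (auto intro!: continuous_intros)
  also have "iexp (real_of_int k * pi) = iexp (real_of_int k * - pi)"
    unfolding exp_eq by (rule exI[of _ k]) (simp add: algebra_simps)
  finally show ?thesis using False by simp
qed

lemma indicator_cube: "indicator cube y = (\<Prod>l\<in>UNIV. indicator {- pi..pi} (y $ l) :: real)"
proof (cases "y \<in> cube")
  case False
  then obtain l where "y $ l \<notin> {- pi..pi}" by (auto simp: mem_box_cart)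
  then have "(\<Prod>l\<in>UNIV. indicator {- pi..pi} (y $ l) :: real) = 0" by (intro prod_zero bexI[of _ l]) (auto simp: indicator_def)
  then show ?thesis using False by simp
qed (auto simp: mem_box_cart)

lemma cube_integral_iexp:
  fixes m :: "int ^ 'n::finite"
  shows "cube_integral (\<lambda>y. iexp (lattice_point m \<bullet> y)) = (if m = 0 then complex_of_real (2 * pi) ^ CARD('n) else 0)"
proof -
  have eq: "indicator cube y *\<^sub>R iexp (lattice_point m \<bullet> y) =
      (\<Prod>l\<in>UNIV. indicator {- pi..pi} (y $ l) *\<^sub>R iexp (real_of_int (m $ l) * y $ l))" for y
    by (simp add: indicator_cube scaleR_conv_of_real prod.distrib inner_vec_def exp_sum sum_distrib_left)
  have i: "integrable lborel (\<lambda>t. indicator {- pi..pi} t *\<^sub>R iexp (real_of_int (m $ l) * t))" for l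
    by (intro borel_integrable_compact) (auto intro!: continuous_intros)
  have "cube_integral (\<lambda>y. iexp (lattice_point m \<bullet> y)) =
      (\<Prod>l\<in>UNIV. if m $ l = 0 then complex_of_real (2 * pi) else 0)"
    unfolding cube_integral_def eq by (subst integral_lborel_prod[OF i]) (simp only: integral_iexp_period)
  also have "\<dots> = (if m = 0 then complex_of_real (2 * pi) ^ CARD('n) else 0)"
    by (auto simp: vec_eq_iff prod_zero_iff)
  finally show ?thesis .
qed

text \<open>The product of the one-dimensional Fejer kernels. The squared modulus makes
  nonnegativity evident, which is the property that Korovkin's argument relies on.\<close>

definition fejer_kernel :: "nat \<Rightarrow> real ^ 'n::finite \<Rightarrow> real" where
  "fejer_kernel N t = (norm (\<Sum>a\<in>grid N. iexp (lattice_point a \<bullet> t)))\<^sup>2 / real (N ^ CARD('n))"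

lemma fejer_kernel_nonneg: "0 \<le> fejer_kernel N t"
  by (simp add: fejer_kernel_def)

lemma continuous_fejer_kernel: "continuous_on UNIV (\<lambda>y. fejer_kernel N (y - x))"
  unfolding fejer_kernel_def divide_inverse by (intro continuous_intros)

lemma complex_fejer_kernel:
  fixes t :: "real ^ 'n::finite"
  shows "complex_of_real (fejer_kernel N t) =
    (\<Sum>a\<in>grid N. \<Sum>b\<in>grid N. iexp (lattice_point (a - b) \<bullet> t)) / of_nat (N ^ CARD('n))"
proof -
  have "complex_of_real ((norm (\<Sum>a\<in>grid N. iexp (lattice_point a \<bullet> t)))\<^sup>2) =
      (\<Sum>a\<in>grid N. iexp (lattice_point a \<bullet> t)) * cnj (\<Sum>a\<in>grid N. iexp (lattice_point a \<bullet> t))"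
    by (rule complex_norm_square)
  also have "\<dots> = (\<Sum>a\<in>grid N. \<Sum>b\<in>grid N. iexp (lattice_point a \<bullet> t) * iexp (- (lattice_point b \<bullet> t)))"
    by (simp add: sum_product exp_cnj)
  also have "\<dots> = (\<Sum>a\<in>grid N. \<Sum>b\<in>grid N. iexp (lattice_point (a - b) \<bullet> t))"
    by (simp add: lattice_point_diff inner_diff_left exp_add[symmetric] algebra_simps)
  finally show ?thesis unfolding fejer_kernel_def by simp
qed

text \<open>
  Not normalised, and multiplied by \<open>e^{-i m x}\<close>: the Fourier series of \<open>h\<close> at \<open>x\<close> is, up to the factor
  \<open>(2 \<pi>)^n\<close>, the plain sum of these numbers over all \<open>m\<close>.
\<close>

definition fourier_coefficient :: "real ^ 'n::finite \<Rightarrow> (real ^ 'n \<Rightarrow> complex) \<Rightarrow> int ^ 'n \<Rightarrow> complex" where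
  "fourier_coefficient x h m = cube_integral (\<lambda>y. h y * iexp (lattice_point m \<bullet> (y - x)))"

lemma fejer_mean_fourier_coefficient:
  fixes h :: "real ^ 'n::finite \<Rightarrow> complex"
  assumes h: "continuous_on UNIV h"
  shows "fejer_mean N (fourier_coefficient x h) =
    cube_integral (\<lambda>y. h y * complex_of_real (fejer_kernel N (y - x)))"
proof -
  have c: "continuous_on UNIV (\<lambda>y. h y * iexp (lattice_point m \<bullet> (y - x)))" for m
    by (intro continuous_intros h)
  have "cube_integral (\<lambda>y. h y * complex_of_real (fejer_kernel N (y - x))) =
      cube_integral (\<lambda>y. (1 / of_nat (N ^ CARD('n))) *
        (\<Sum>a\<in>grid N. \<Sum>b\<in>grid N. h y * iexp (lattice_point (a - b) \<bullet> (y - x))))"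
    unfolding complex_fejer_kernel by (simp only: sum_distrib_left times_divide_eq_right mult_1_left
        divide_inverse mult_1_right mult.left_commute mult.commute[of _ "inverse _"])
  also have "\<dots> = fejer_mean N (fourier_coefficient x h)"
    unfolding cube_integral_cmult fejer_mean_def fourier_coefficient_def
    by (subst cube_integral_sum, intro continuous_intros h, subst cube_integral_sum, rule c) simp
  finally show ?thesis by simp
qed

lemma fourier_coefficient_1:
  "fourier_coefficient x (\<lambda>y. 1) m = (if m = 0 then complex_of_real (2 * pi) ^ CARD('n) else 0)"
  for m :: "int ^ 'n::finite"
proof -
  have "fourier_coefficient x (\<lambda>y. 1) m =
      cube_integral (\<lambda>y. iexp (- (lattice_point m \<bullet> x)) * iexp (lattice_point m \<bullet> y))"
    unfolding fourier_coefficient_def by (simp add: inner_diff_right exp_add[symmetric] algebra_simps)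
  then show ?thesis unfolding cube_integral_cmult cube_integral_iexp by auto
qed

text \<open>The sum on the right replaces |y - x|^2 by a trigonometric polynomial. Since
  \<open>x\<close> is interior to the cube, coordinate differences stay below 2 pi, so on the closed
  cube this polynomial vanishes at \<open>x\<close> alone. By compactness it has a positive minimum
  away from a ball about \<open>x\<close>; inside the ball continuity of \<open>\<psi>\<close>
  suffices.\<close>

lemma korovkin_bound:
  fixes \<psi> :: "real ^ 'n::finite \<Rightarrow> complex"
  assumes \<psi>: "continuous_on UNIV \<psi>" and x: "\<And>l. - pi < x $ l \<and> x $ l < pi" and e: "e > 0"
  shows "\<exists>C\<ge>0. \<forall>y\<in>cube. norm (\<psi> y - \<psi> x) \<le> e + C * (\<Sum>l\<in>UNIV. (norm (iexp ((y - x) $ l) - 1))\<^sup>2)"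
proof -
  let ?q = "\<lambda>y. \<Sum>l\<in>UNIV. (norm (iexp ((y - x) $ l) - 1))\<^sup>2"
  have q0: "?q y \<ge> 0" for y by (intro sum_nonneg) simp
  obtain d where d: "d > 0" "\<And>y. dist y x < d \<Longrightarrow> dist (\<psi> y) (\<psi> x) < e"
    using \<psi> e by (metis UNIV_I continuous_on_iff)
  let ?S = "cube - ball x d"
  have S: "compact ?S" by (intro compact_diff compact_cbox open_ball)
  show ?thesis
  proof (cases "?S = {}")
    case True
    then have "norm (\<psi> y - \<psi> x) \<le> e + 0 * ?q y" if "y \<in> cube" for y
    proof -
      have "y \<in> ball x d" using True that by blast
      then show ?thesis using d(2)[of y] by (simp add: dist_norm norm_minus_commute)
    qed
    then show ?thesis by blast
  next
    case False
    have "continuous_on ?S ?q" by (intro continuous_intros)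
    from continuous_attains_inf[OF S False this] obtain z where z: "z \<in> ?S" "\<And>y. y \<in> ?S \<Longrightarrow> ?q z \<le> ?q y"
      by blast
    have qz: "?q z > 0"
    proof (rule ccontr)
      assume "\<not> ?q z > 0"
      then have "?q z = 0" using q0[of z] by simp
      then have "iexp ((z - x) $ l) = 1" for l
        by (subst (asm) sum_nonneg_eq_0_iff) auto
      then have "\<exists>k :: int. (z - x) $ l = of_int (2 * k) * pi" for l
        unfolding exp_eq_1 by simp
      moreover have "\<bar>(z - x) $ l\<bar> < 2 * pi" for l
        using z(1) x[of l] by (auto simp: mem_box_cart) (smt (verit))
      ultimately have "(z - x) $ l = 0" for l
      proof -
        obtain k :: int where k: "(z - x) $ l = of_int (2 * k) * pi"
          using \<open>\<And>l. \<exists>k :: int. (z - x) $ l = of_int (2 * k) * pi\<close> by blast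
        have "\<bar>real_of_int k\<bar> * (2 * pi) < 1 * (2 * pi)"
          using \<open>\<And>l. \<bar>(z - x) $ l\<bar> < 2 * pi\<close>[of l] unfolding k by (simp add: abs_mult)
        then have "\<bar>real_of_int k\<bar> < 1" by (rule mult_right_less_imp_less) simp
        then show ?thesis unfolding k by simp
      qed
      then have "z = x" by (simp add: vec_eq_iff)
      then show False using z(1) d(1) by simp
    qed
    have "bounded ((\<lambda>y. \<psi> y - \<psi> x) ` cube)"
      by (intro compact_imp_bounded compact_continuous_image compact_cbox continuous_intros
          continuous_on_subset[OF \<psi>]) auto
    then obtain B where B: "\<And>y. y \<in> cube \<Longrightarrow> norm (\<psi> y - \<psi> x) \<le> B"
      unfolding bounded_iff by blast
    have B0: "B \<ge> 0" using z(1) by (intro order_trans[OF norm_ge_zero B]) blast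
    \<comment> \<open>Off the ball \<open>?q z\<close> is the minimum of \<open>?q\<close>, so the
      bound \<open>B\<close> on the difference is at most \<open>B / ?q z\<close> times
      \<open>?q y\<close>.\<close>
    have "norm (\<psi> y - \<psi> x) \<le> e + B / ?q z * ?q y" if "y \<in> cube" for y
    proof (cases "y \<in> ball x d")
      case True
      then have "norm (\<psi> y - \<psi> x) < e" using d(2)[of y] by (simp add: dist_norm norm_minus_commute)
      moreover have "0 \<le> B / ?q z * ?q y" using B0 q0 by (intro mult_nonneg_nonneg divide_nonneg_nonneg)
      ultimately show ?thesis by linarith
    next
      case False
      then have "B / ?q z * ?q z \<le> B / ?q z * ?q y"
        using that B0 q0 z(2)[of y] by (intro mult_left_mono divide_nonneg_nonneg) auto
      then show ?thesis using B[OF that] qz e by simp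
    qed
    then show ?thesis using B0 q0 by (intro exI[of _ "B / ?q z"]) (auto intro!: divide_nonneg_nonneg)
  qed
qed

lemma has_sum_single: "((\<lambda>m. if m = a then c else 0) has_sum c) UNIV"
  by (rule has_sum_finite_neutralI[of "{a}"]) auto

lemma has_sum_finite_sum:
  fixes f :: "'i \<Rightarrow> 'a \<Rightarrow> 'b::topological_comm_monoid_add"
  assumes "finite I" "\<And>i. i \<in> I \<Longrightarrow> (f i has_sum s i) A"
  shows "((\<lambda>x. \<Sum>i\<in>I. f i x) has_sum (\<Sum>i\<in>I. s i)) A"
  using assms by (induction I rule: finite_induct) (auto intro: has_sum_add)

lemma has_sum_diff:
  fixes f g :: "'a \<Rightarrow> 'b::real_normed_vector"
  assumes "(f has_sum s) A" "(g has_sum t) A"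
  shows "((\<lambda>x. f x - g x) has_sum (s - t)) A"
  using has_sum_add[OF assms(1), of "\<lambda>x. - g x" "- t"] assms(2) by (simp add: has_sum_uminus)

text \<open>
  Korovkin's argument: the Fejer means at \<open>x\<close> are given by a nonnegative kernel, so they converge
  for every continuous function once they converge for \<open>1\<close> and for \<open>|e^{i(y_l - x_l)} - 1|^2\<close>,
  which are trigonometric polynomials.
\<close>

theorem fourier_series_pointwise:
  fixes \<psi> :: "real ^ 'n::finite \<Rightarrow> complex"
  assumes \<psi>: "continuous_on UNIV \<psi>" and x: "\<And>l. - pi < x $ l \<and> x $ l < pi"
    and abs: "(\<lambda>m. norm (fourier_coefficient x \<psi> m)) summable_on UNIV"
  shows "(fourier_coefficient x \<psi> has_sum complex_of_real (2 * pi) ^ CARD('n) * \<psi> x) UNIV"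
proof -
  let ?P = "(2 * pi) ^ CARD('n)"
  let ?V = "fourier_coefficient x (\<lambda>y. 1)"
  define q where "q y = (\<Sum>l\<in>UNIV. (norm (iexp ((y - x) $ l) - 1))\<^sup>2)" for y
  let ?W = "fourier_coefficient x (\<lambda>y. complex_of_real (q y))"
  let ?K = "\<lambda>N y. fejer_kernel N (y - x)"
  obtain S where S: "(fourier_coefficient x \<psi> has_sum S) UNIV"
    using abs_summable_summable[OF abs] by (auto simp: summable_on_def)
  have cq: "continuous_on UNIV q" unfolding q_def by (intro continuous_intros)
  have V: "?V = (\<lambda>m. if m = 0 then complex_of_real ?P else 0)"
    by (simp add: fourier_coefficient_1 fun_eq_iff)
  have absV: "(\<lambda>m. norm (?V m)) summable_on UNIV"
    unfolding V by (rule finite_nonzero_values_imp_summable_on) (auto intro: finite_subset[of _ "{0}"])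
  have limV: "(\<lambda>N. fejer_mean N ?V) \<longlonglongrightarrow> complex_of_real ?P"
    by (rule fejer_mean_tendsto[OF absV]) (use has_sum_single in \<open>simp only: V\<close>)
  have q_eq: "complex_of_real (q y) = (\<Sum>l\<in>UNIV. 2 - iexp ((y - x) $ l) - iexp (- ((y - x) $ l)))" for y
  proof -
    have "complex_of_real ((norm (iexp t - 1))\<^sup>2) = 2 - iexp t - iexp (- t)" for t
      unfolding complex_norm_square by (simp add: exp_cnj algebra_simps exp_add[symmetric])
    then show ?thesis unfolding q_def of_real_sum by (simp only:)
  qed
  \<comment> \<open>Multiplication by an exponential shifts the coefficients, so those of
    \<open>q\<close> are negated second differences of those of 1, and all but finitely many
    vanish.\<close>
  have W: "?W m = (\<Sum>l\<in>UNIV. 2 * ?V m - ?V (m + axis l 1) - ?V (m - axis l 1))" for m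
  proof -
    have ax: "lattice_point (axis l 1 :: int ^ 'n) \<bullet> t = t $ l" for l and t :: "real ^ 'n"
      by (simp add: inner_vec_def axis_def if_distrib if_distribR sum.delta cong: if_cong)
    have e: "(2 - iexp t - iexp (- t)) * iexp s = 2 * iexp s - iexp (s + t) - iexp (s - t)" for s t
      by (simp add: left_diff_distrib exp_add[symmetric] algebra_simps)
    have "?W m = cube_integral (\<lambda>y. \<Sum>l\<in>UNIV. 2 * iexp (lattice_point m \<bullet> (y - x)) -
       iexp (lattice_point (m + axis l 1) \<bullet> (y - x)) - iexp (lattice_point (m - axis l 1) \<bullet> (y - x)))"
      unfolding fourier_coefficient_def q_eq lattice_point_add lattice_point_diff inner_add_left inner_diff_left ax
        sum_distrib_right e ..
    also have "\<dots> = (\<Sum>l\<in>UNIV. 2 * ?V m - ?V (m + axis l 1) - ?V (m - axis l 1))"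
      unfolding fourier_coefficient_def mult_1
      by (subst cube_integral_sum, intro continuous_intros, subst cube_integral_diff, intro continuous_intros,
          intro continuous_intros, subst cube_integral_diff, intro continuous_intros, intro continuous_intros,
          subst cube_integral_cmult) (rule refl)
    finally show ?thesis .
  qed
  have absW: "(\<lambda>m. norm (?W m)) summable_on UNIV"
  proof (rule finite_nonzero_values_imp_summable_on)
    have "?W m = 0" if "m \<notin> insert 0 (range (\<lambda>l. axis l 1) \<union> range (\<lambda>l. - axis l 1))" for m
    proof -
      have "m + axis l 1 \<noteq> 0" "m - axis l 1 \<noteq> 0" for l
        using that by (auto simp: eq_neg_iff_add_eq_0[symmetric])
      then show ?thesis unfolding W V using that by simp
    qed
    then have "{m \<in> UNIV. norm (?W m) \<noteq> 0} \<subseteq> insert 0 (range (\<lambda>l. axis l 1) \<union> range (\<lambda>l. - axis l 1))"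
      by fastforce
    then show "finite {m \<in> UNIV. norm (?W m) \<noteq> 0}" by (rule finite_subset) simp
  qed
  \<comment> \<open>The limit is the total sum of the coefficients. Shifts do not change the sum of
    \<open>?V\<close>, so each coordinate contributes 2 P - P - P = 0, in accordance with q x =
    0.\<close>
  have limW: "(\<lambda>N. fejer_mean N ?W) \<longlonglongrightarrow> 0"
  proof (rule fejer_mean_tendsto[OF absW])
    have V0: "(?V has_sum complex_of_real ?P) UNIV" unfolding V by (rule has_sum_single)
    have V1: "((\<lambda>m. ?V (m + v)) has_sum complex_of_real ?P) UNIV" for v
      using V0 by (subst has_sum_reindex_bij_betw[of "\<lambda>m. m + v" UNIV UNIV])
        (auto intro: bij_betw_byWitness[where f' = "\<lambda>m. m - v"])
    have "((\<lambda>m. \<Sum>l\<in>(UNIV :: 'n set). 2 * ?V m - ?V (m + axis l 1) - ?V (m + - axis l 1)) has_sum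
        (\<Sum>l\<in>(UNIV :: 'n set). 2 * complex_of_real ?P - complex_of_real ?P - complex_of_real ?P)) UNIV"
      by (rule has_sum_finite_sum[OF finite]) (intro has_sum_diff has_sum_cmult_right V0 V1)
    then show "(?W has_sum 0) UNIV" unfolding W[abs_def] by simp
  qed
  have le: "norm (S - complex_of_real ?P * \<psi> x) \<le> e * ?P" if e: "e > 0" for e
  proof -
    obtain C where C: "C \<ge> 0" "\<And>y. y \<in> cube \<Longrightarrow> norm (\<psi> y - \<psi> x) \<le> e + C * q y"
      using korovkin_bound[OF \<psi> x e] unfolding q_def by blast
    have cK: "continuous_on UNIV (?K N)" for N by (rule continuous_fejer_kernel)
    \<comment> \<open>Nonnegativity of the kernel lets the pointwise estimate be integrated with the
      same constants for every \<open>N\<close>. The real part only converts the type, the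
      right-hand side being a real integral.\<close>
    have bound: "norm (fejer_mean N (fourier_coefficient x \<psi>) - \<psi> x * fejer_mean N ?V) \<le>
        Re (complex_of_real e * fejer_mean N ?V + complex_of_real C * fejer_mean N ?W)" for N
    proof -
      have 1: "fejer_mean N (fourier_coefficient x \<psi>) - \<psi> x * fejer_mean N ?V =
          cube_integral (\<lambda>y. (\<psi> y - \<psi> x) * complex_of_real (?K N y))"
        unfolding fejer_mean_fourier_coefficient[OF \<psi>] fejer_mean_fourier_coefficient[OF continuous_on_const]
          cube_integral_cmult[symmetric] mult_1 left_diff_distrib
        by (intro cube_integral_diff[symmetric] continuous_intros \<psi> cK)
      have "complex_of_real e * fejer_mean N ?V + complex_of_real C * fejer_mean N ?W =
          cube_integral (\<lambda>y. complex_of_real e * complex_of_real (?K N y) +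
            complex_of_real C * (complex_of_real (q y) * complex_of_real (?K N y)))"
        unfolding fejer_mean_fourier_coefficient[OF continuous_on_of_real[OF cq]]
          fejer_mean_fourier_coefficient[OF continuous_on_const] cube_integral_cmult[symmetric] mult_1
        by (intro cube_integral_add[symmetric] continuous_intros cq cK)
      also have "\<dots> = complex_of_real (LBINT y. indicator cube y *\<^sub>R ((e + C * q y) * ?K N y))"
        unfolding cube_integral_def integral_complex_of_real[symmetric]
        by (simp add: scaleR_conv_of_real algebra_simps)
      finally have 2: "Re (complex_of_real e * fejer_mean N ?V + complex_of_real C * fejer_mean N ?W) =
          (LBINT y. indicator cube y *\<^sub>R ((e + C * q y) * ?K N y))" by simp
      show ?thesis unfolding 1 2 unfolding cube_integral_def
      proof (rule Bochner_Integration.integral_norm_bound_integral)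
        show "integrable lborel (\<lambda>y. indicator cube y *\<^sub>R ((\<psi> y - \<psi> x) * complex_of_real (?K N y)))"
          by (intro cube_integrable continuous_intros \<psi> cK)
        show "integrable lborel (\<lambda>y. indicator cube y *\<^sub>R ((e + C * q y) * ?K N y))"
          by (intro cube_integrable continuous_intros cq cK)
        show "norm (indicator cube y *\<^sub>R ((\<psi> y - \<psi> x) * complex_of_real (?K N y))) \<le>
            indicator cube y *\<^sub>R ((e + C * q y) * ?K N y)" for y
          using C(2)[of y] fejer_kernel_nonneg[of N "y - x"]
          by (auto simp: indicator_def norm_mult intro!: mult_right_mono)
      qed
    qed
    have "(\<lambda>N. norm (fejer_mean N (fourier_coefficient x \<psi>) - \<psi> x * fejer_mean N ?V)) \<longlonglongrightarrow>
        norm (S - \<psi> x * complex_of_real ?P)"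
      by (intro tendsto_intros fejer_mean_tendsto[OF abs S] limV)
    moreover have "(\<lambda>N. Re (complex_of_real e * fejer_mean N ?V + complex_of_real C * fejer_mean N ?W)) \<longlonglongrightarrow>
        Re (complex_of_real e * complex_of_real ?P + complex_of_real C * 0)"
      by (intro tendsto_intros limV limW)
    ultimately have "norm (S - \<psi> x * complex_of_real ?P) \<le>
        Re (complex_of_real e * complex_of_real ?P + complex_of_real C * 0)"
      using bound by (intro LIMSEQ_le) auto
    then show ?thesis by (simp add: mult.commute flip: of_real_mult of_real_power)
  qed
  have "norm (S - complex_of_real ?P * \<psi> x) \<le> 0 + e" if "e > 0" for e
    using le[of "e / ?P"] that by simp
  then have "norm (S - complex_of_real ?P * \<psi> x) \<le> 0" by (rule field_le_epsilon)
  then show ?thesis using S by simp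
qed

lemma zero_outside_supp: "x \<notin> supp f \<Longrightarrow> f x = 0"
  using partials_outside_supp[of x f "[]"] by simp

text \<open>As the support lies in the open cube, integrating over the cube or over the whole space
  is the same, so the Fourier coefficients are values of the inverse transform at lattice points.
  Dividing the (2 pi)^n of the series by the normalisation (2 pi)^(n/2) of the transform gives the
  constant; Schwartz decay gives absolute convergence.\<close>

lemma fourier_series_of_inv_fourier:
  fixes \<psi> :: "real ^ 'n::finite \<Rightarrow> complex"
  assumes \<psi>: "\<psi> \<in> schwartz" and sub: "supp \<psi> \<subseteq> {y. \<forall>l. - pi < y $ l \<and> y $ l < pi}"
    and x: "\<And>l. - pi < x $ l \<and> x $ l < pi"
  shows "(\<Sum>\<^sub>\<infinity>m\<in>UNIV. inv_fourier \<psi> (lattice_point m) * exp (- \<i> * complex_of_real (lattice_point m \<bullet> x))) =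
    complex_of_real (sqrt (2 * pi) ^ CARD('n)) * \<psi> x"
proof -
  let ?c = "complex_of_real (sqrt (2 * pi) ^ CARD('n))"
  let ?u = "\<lambda>m. inv_fourier \<psi> (lattice_point m) * exp (- \<i> * complex_of_real (lattice_point m \<bullet> x))"
  have c0: "?c \<noteq> 0" by simp
  have cc: "?c * ?c = complex_of_real (2 * pi) ^ CARD('n)"
  proof -
    have "sqrt (2 * pi) ^ CARD('n) * sqrt (2 * pi) ^ CARD('n) = (2 * pi) ^ CARD('n)"
      by (subst power_mult_distrib[symmetric]) simp
    then show ?thesis by (simp only: of_real_mult[symmetric] of_real_power[symmetric])
  qed
  have coef: "fourier_coefficient x \<psi> m = ?c * ?u m" for m
  proof -
    have "indicator cube y *\<^sub>R (\<psi> y * iexp (lattice_point m \<bullet> (y - x))) =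
        exp (- \<i> * complex_of_real (lattice_point m \<bullet> x)) * (iexp (y \<bullet> lattice_point m) * \<psi> y)" for y
    proof (cases "y \<in> cube")
      case True
      then show ?thesis
        by (simp add: inner_diff_right inner_commute exp_diff exp_minus field_simps)
    next
      case False
      then have "\<psi> y = 0" using sub by (intro zero_outside_supp) (auto simp: mem_box_cart less_imp_le)
      then show ?thesis by simp
    qed
    then have "fourier_coefficient x \<psi> m = exp (- \<i> * complex_of_real (lattice_point m \<bullet> x)) *
        (LBINT y. iexp (y \<bullet> lattice_point m) * \<psi> y)"
      unfolding fourier_coefficient_def cube_integral_def by (simp only: integral_mult_right_zero)
    then show ?thesis
      unfolding inv_fourier_def powr_half_power by simp
  qed
  obtain C where C: "\<And>\<xi>. (1 + norm \<xi>) ^ (2 * CARD('n)) * norm (inv_fourier \<psi> \<xi>) \<le> C"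
    using inv_fourier_decay[OF \<psi>] by blast
  have "(\<lambda>m. norm (fourier_coefficient x \<psi> m)) summable_on UNIV"
  proof (rule summable_on_comparison_test)
    show "(\<lambda>m :: int ^ 'n. sqrt (2 * pi) ^ CARD('n) * C * (1 / (1 + norm (lattice_point m)) ^ (2 * CARD('n)))) summable_on UNIV"
      by (intro summable_on_cmult_right summable_on_lattice)
    fix m :: "int ^ 'n"
    have "norm (inv_fourier \<psi> (lattice_point m)) \<le> C * (1 / (1 + norm (lattice_point m)) ^ (2 * CARD('n)))"
      using C[of "lattice_point m"] by (simp add: pos_le_divide_eq add_pos_nonneg mult.commute)
    then have "sqrt (2 * pi) ^ CARD('n) * norm (inv_fourier \<psi> (lattice_point m)) \<le>
        sqrt (2 * pi) ^ CARD('n) * (C * (1 / (1 + norm (lattice_point m)) ^ (2 * CARD('n))))"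
      by (intro mult_left_mono) auto
    then show "norm (fourier_coefficient x \<psi> m) \<le>
        sqrt (2 * pi) ^ CARD('n) * C * (1 / (1 + norm (lattice_point m)) ^ (2 * CARD('n)))"
      unfolding coef by (simp add: norm_mult norm_power)
  qed auto
  from fourier_series_pointwise[OF smooth_continuous[OF schwartz_smooth[OF \<psi>]] x this]
  have "((\<lambda>m. ?c * ?u m) has_sum (?c * (?c * \<psi> x))) UNIV"
    unfolding coef[abs_def] mult.assoc[symmetric] cc .
  then have "(?u has_sum (?c * \<psi> x)) UNIV" using c0 by (simp add: has_sum_cmult_right_iff)
  then show ?thesis by (rule infsumI)
qed

section \<open>Derivatives of monomials times cut-off functions\<close>

lemma supp_mult_subset:
  fixes f h :: "real ^ 'n::finite \<Rightarrow> 'b::real_normed_algebra"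
  shows "supp (\<lambda>x. f x * h x) \<subseteq> supp h"
  unfolding supp_def by (intro closure_mono) auto

text \<open>The constant does not depend on \<beta>. Derivatives that fall on the cut-off cost a
  constant, those on the monomial a factor |\<beta>| / R each, and the radius R of the support sets
  the geometric rate.\<close>

lemma partials_monomial_mult_bound:
  fixes h :: "real ^ 'n::finite \<Rightarrow> complex"
  assumes h: "h \<in> schwartz" and R: "R > 0" and supp: "\<And>x. x \<in> supp h \<Longrightarrow> norm x \<le> R"
  shows "\<exists>C\<ge>0. \<forall>\<beta> ls x. length ls \<le> N \<longrightarrow>
    norm (partials ls (\<lambda>x. monomial \<beta> x * h x) x) \<le> C * (1 + real (mi_abs \<beta>)) ^ N * R ^ mi_abs \<beta>"
proof -
  obtain D where D: "D \<ge> 0" "\<And>ls x. length ls \<le> N \<Longrightarrow> norm (partials ls h x) \<le> D"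
    using schwartz_bound_uniform[OF h, of N 0] by auto
  \<comment> \<open>Covers R < 1, where each derivative of the monomial enlarges the bound by 1 /
    R.\<close>
  define r where "r = max 1 (1 / R)"
  have r: "r \<ge> 1" "1 / R \<le> r" by (auto simp: r_def)
  have "norm (partials ls (\<lambda>x. monomial \<beta> x * h x) x) \<le>
      (2 ^ N * r ^ N * D) * (1 + real (mi_abs \<beta>)) ^ N * R ^ mi_abs \<beta>" if ls: "length ls \<le> N" for \<beta> ls x
  proof (cases "x \<in> supp h")
    case False
    then have "x \<notin> supp (\<lambda>x. monomial \<beta> x * h x)" using supp_mult_subset by blast
    then show ?thesis using partials_outside_supp[of x "\<lambda>x. monomial \<beta> x * h x"] R D(1) r by simp
  next
    case True
    let ?B = "(r * (1 + real (mi_abs \<beta>))) ^ N * R ^ mi_abs \<beta>"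
    have B: "norm (partials a (monomial \<beta>) x) \<le> ?B" if "length a \<le> length ls" for a
    proof -
      have "real (mi_abs \<beta>) / R = (1 / R) * real (mi_abs \<beta>)" by simp
      also have "\<dots> \<le> r * (1 + real (mi_abs \<beta>))" using r R by (intro mult_mono) auto
      finally have "(real (mi_abs \<beta>) / R) ^ length a \<le> (r * (1 + real (mi_abs \<beta>))) ^ length a"
        using R by (intro power_mono) auto
      also have "\<dots> \<le> (r * (1 + real (mi_abs \<beta>))) ^ N"
        using that ls r mult_mono[of 1 r 1 "1 + real (mi_abs \<beta>)"] by (intro power_increasing) auto
      finally have "(real (mi_abs \<beta>) / R) ^ length a * R ^ mi_abs \<beta> \<le> ?B"
        using R by (intro mult_right_mono) auto
      then show ?thesis using norm_partials_monomial_le[OF R supp[OF True], of a \<beta>] by linarith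
    qed
    have "norm (partials ls (\<lambda>x. monomial \<beta> x * h x) x) \<le> 2 ^ length ls * (?B * D)"
      by (rule norm_partials_mult_le[OF smooth_monomial schwartz_smooth[OF h] B D(2)]) (use ls in auto)
    also have "\<dots> \<le> 2 ^ N * (?B * D)"
      using ls D(1) R r by (intro mult_right_mono power_increasing) auto
    finally show ?thesis by (simp add: power_mult_distrib mult_ac)
  qed
  then show ?thesis using D(1) r by (intro exI[of _ "2 ^ N * r ^ N * D"]) auto
qed

lemma power_le_fact_exp:
  fixes y :: real assumes "y \<ge> 0" shows "y ^ N \<le> fact N * exp y"
proof -
  have "y ^ N / fact N \<le> exp y"
    using sum_le_suminf[of "\<lambda>n. y ^ n / fact n" "{N}"] summable_exp[of y] exp_converges[of y] assms
    by (simp add: sums_iff divide_inverse mult.commute)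
  then show ?thesis by (simp add: field_simps)
qed

text \<open>With r = e^(-a), the exponential series bounds (1 + b)^N by a constant times e^(a (1 +
  b)). It absorbs the polynomial factors produced by derivatives of monomials.\<close>

lemma power_times_geometric_bound:
  assumes "0 < r" "r < (1::real)"
  shows "\<exists>C\<ge>0. \<forall>b. (1 + real b) ^ N * r ^ b \<le> C"
proof -
  define a where "a = - ln r"
  have a: "a > 0" using assms by (simp add: a_def)
  have "(1 + real b) ^ N * r ^ b \<le> fact N / a ^ N * exp a" for b
  proof -
    have "(a * (1 + real b)) ^ N \<le> fact N * exp (a * (1 + real b))"
      using a by (intro power_le_fact_exp) simp
    then have "(1 + real b) ^ N \<le> fact N / a ^ N * exp (a * (1 + real b))"
      using a unfolding power_mult_distrib by (simp add: pos_le_divide_eq mult.commute)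
    also have "exp (a * (1 + real b)) = exp a * (1 / r) ^ b"
    proof -
      have "exp a = 1 / r" using assms by (simp add: a_def exp_minus inverse_eq_divide)
      moreover have "exp (a * real b) = exp a ^ b" using exp_of_nat_mult[of b a] by (simp add: mult.commute)
      ultimately show ?thesis by (simp add: distrib_left exp_add)
    qed
    finally have "(1 + real b) ^ N * r ^ b \<le> fact N / a ^ N * (exp a * (1 / r) ^ b) * r ^ b"
      using assms by (intro mult_right_mono) auto
    then show ?thesis using assms by (simp add: power_divide field_simps)
  qed
  then show ?thesis using a by (intro exI[of _ "fact N / a ^ N * exp a"]) auto
qed

section \<open>The sequence space\<close>

lemma c_space_bound:
  assumes "\<mu> \<in> c_space s \<delta>"
  shows "\<exists>C\<ge>0. \<forall>\<beta> j m. 2 powr (real j * s) * (1 + norm (lattice_point m) / 2 ^ j) powr \<delta> * norm (\<mu> \<beta> j m) \<le> C"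
proof -
  have fin: "c_norm s \<delta> \<mu> < \<infinity>" using assms by (simp add: c_space_def)
  have "2 powr (real j * s) * (1 + norm (lattice_point m) / 2 ^ j) powr \<delta> * norm (\<mu> \<beta> j m) \<le> enn2real (c_norm s \<delta> \<mu>)" for \<beta> j m
  proof -
    have "ennreal (2 powr (real j * s) * (1 + norm (lattice_point m) / 2 ^ j) powr \<delta> * norm (\<mu> \<beta> j m)) \<le> c_norm s \<delta> \<mu>"
      unfolding c_norm_def by (rule SUP_upper2[of "(\<beta>, j, m)"]) auto
    then show ?thesis using fin by (metis ennreal_enn2real_if ennreal_le_iff enn2real_nonneg infinity_ennreal_def less_irrefl)
  qed
  then show ?thesis by (intro exI[of _ "enn2real (c_norm s \<delta> \<mu>)"]) auto
qed

lemma c_spaceI: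
  assumes "\<And>\<beta> j m. 2 powr (real j * s) * (1 + norm (lattice_point m) / 2 ^ j) powr \<delta> * norm (\<mu> \<beta> j m) \<le> C"
  shows "\<mu> \<in> c_space s \<delta>"
proof -
  have "c_norm s \<delta> \<mu> \<le> ennreal C"
    unfolding c_norm_def using assms by (intro SUP_least) (auto intro: ennreal_leI)
  then show ?thesis by (auto simp: c_space_def intro: le_less_trans)
qed

text \<open>All the sequence space conditions at once, with natural exponents, so that only ordinary
  powers occur in the estimates.\<close>

definition rapidly_decreasing :: "(nat ^ 'n::finite \<Rightarrow> nat \<Rightarrow> int ^ 'n \<Rightarrow> complex) \<Rightarrow> bool" where
  "rapidly_decreasing \<mu> \<longleftrightarrow>
    (\<forall>K N. \<exists>C\<ge>0. \<forall>\<beta> j m. 2 ^ (j * K) * (1 + norm (lattice_point m) / 2 ^ j) ^ N * norm (\<mu> \<beta> j m) \<le> C)"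

text \<open>Both bases are at least 1, hence the weights grow with the exponents, and every real
  exponent lies below a natural one.\<close>

lemma rapidly_decreasing_iff_c_space:
  fixes \<mu> :: "nat ^ 'n::finite \<Rightarrow> nat \<Rightarrow> int ^ 'n \<Rightarrow> complex"
  shows "rapidly_decreasing \<mu> \<longleftrightarrow> (\<forall>s>0. \<forall>\<delta>>0. \<mu> \<in> c_space s \<delta>)" (is "?R \<longleftrightarrow> ?L")
proof
  assume L: ?L
  show ?R
    unfolding rapidly_decreasing_def
  proof (intro allI)
    fix K N :: nat
    \<comment> \<open>The successors keep \<open>s\<close> and \<open>\<delta>\<close> positive when
      \<open>K\<close> or \<open>N\<close> is 0.\<close>
    obtain C where C: "C \<ge> 0" "\<And>\<beta> j m. 2 powr (real j * real (Suc K)) * (1 + norm (lattice_point m) / 2 ^ j) powr real (Suc N) * norm (\<mu> \<beta> j m) \<le> C"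
      using c_space_bound L by (metis of_nat_0_less_iff zero_less_Suc)
    have "2 ^ (j * K) * (1 + norm (lattice_point m) / 2 ^ j) ^ N * norm (\<mu> \<beta> j m) \<le> C" for \<beta> j m
    proof -
      have 1: "2 ^ (j * K) \<le> 2 powr (real j * real (Suc K))"
        by (subst powr_realpow[symmetric]) (auto intro!: powr_mono simp: mult_left_mono)
      have 2: "(1 + norm (lattice_point m) / 2 ^ j) ^ N \<le> (1 + norm (lattice_point m) / 2 ^ j) powr real (Suc N)"
        by (subst powr_realpow[symmetric]) (auto intro!: powr_mono add_pos_nonneg)
      have "2 ^ (j * K) * (1 + norm (lattice_point m) / 2 ^ j) ^ N * norm (\<mu> \<beta> j m) \<le>
        2 powr (real j * real (Suc K)) * (1 + norm (lattice_point m) / 2 ^ j) powr real (Suc N) * norm (\<mu> \<beta> j m)"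
        by (intro mult_right_mono mult_mono 1 2) auto
      then show ?thesis using C(2)[where \<beta> = \<beta> and j = j and m = m] by linarith
    qed
    then show "\<exists>C\<ge>0. \<forall>\<beta> j m. 2 ^ (j * K) * (1 + norm (lattice_point m) / 2 ^ j) ^ N * norm (\<mu> \<beta> j m) \<le> C"
      using C(1) by blast
  qed
next
  assume R: ?R
  show ?L
  proof (intro allI impI)
    fix s \<delta> :: real assume pos: "s > 0" "\<delta> > 0"
    obtain C where C: "\<And>\<beta> j m. 2 ^ (j * nat \<lceil>s\<rceil>) * (1 + norm (lattice_point m) / 2 ^ j) ^ nat \<lceil>\<delta>\<rceil> * norm (\<mu> \<beta> j m) \<le> C"
      using R unfolding rapidly_decreasing_def by blast
    show "\<mu> \<in> c_space s \<delta>"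
    proof (rule c_spaceI)
      fix \<beta> :: "nat ^ 'n" and j and m :: "int ^ 'n"
      have 1: "2 powr (real j * s) \<le> 2 ^ (j * nat \<lceil>s\<rceil>)"
        using pos by (subst powr_realpow[symmetric]) (auto intro!: powr_mono mult_left_mono)
      have 2: "(1 + norm (lattice_point m) / 2 ^ j) powr \<delta> \<le> (1 + norm (lattice_point m) / 2 ^ j) ^ nat \<lceil>\<delta>\<rceil>"
        using pos by (subst powr_realpow[symmetric]) (auto intro!: powr_mono add_pos_nonneg)
      have "2 powr (real j * s) * (1 + norm (lattice_point m) / 2 ^ j) powr \<delta> * norm (\<mu> \<beta> j m) \<le>
          2 ^ (j * nat \<lceil>s\<rceil>) * (1 + norm (lattice_point m) / 2 ^ j) ^ nat \<lceil>\<delta>\<rceil> * norm (\<mu> \<beta> j m)"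
        by (intro mult_right_mono mult_mono 1 2) auto
      then show "2 powr (real j * s) * (1 + norm (lattice_point m) / 2 ^ j) powr \<delta> * norm (\<mu> \<beta> j m) \<le> C"
        using C[where \<beta> = \<beta> and j = j and m = m] by linarith
    qed
  qed
qed

section \<open>Series of smooth functions\<close>

lemma norm_directional_le:
  fixes h :: "real ^ 'n::finite" and a :: "'n \<Rightarrow> 'b::real_normed_vector"
  assumes "\<And>l. norm (a l) \<le> M"
  shows "norm (\<Sum>l\<in>UNIV. (h $ l) *\<^sub>R a l) \<le> real CARD('n) * M * norm h"
proof -
  have "norm (\<Sum>l\<in>UNIV. (h $ l) *\<^sub>R a l) \<le> (\<Sum>l\<in>(UNIV :: 'n set). norm h * M)"
  proof (rule sum_norm_le)
    show "norm ((h $ l) *\<^sub>R a l) \<le> norm h * M" for l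
      unfolding norm_scaleR real_norm_def
      by (intro mult_mono assms component_le_norm_cart) auto
  qed
  then show ?thesis by (simp add: mult_ac)
qed

lemma smooth_lipschitz:
  fixes f :: "real ^ 'n::finite \<Rightarrow> 'b::real_normed_vector"
  assumes f: "smooth f" and M: "\<And>l y. norm (partials [l] f y) \<le> M"
  shows "norm (f y - f x) \<le> real CARD('n) * M * norm (y - x)"
  by (rule differentiable_bound[of UNIV, OF _ has_derivative_at_withinI[OF smooth_has_derivative[OF f]]])
    (auto intro!: onorm_le norm_directional_le M simp del: partials.simps)

text \<open>The mean value inequality applied twice: to the first partials, and then to
  \<open>f\<close> minus its linear part at \<open>x\<close>. Each application contributes one
  factor n.\<close>

lemma smooth_quadratic_remainder:
  fixes f :: "real ^ 'n::finite \<Rightarrow> 'b::real_normed_vector"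
  assumes f: "smooth f" and M: "\<And>l l' y. norm (partials [l', l] f y) \<le> M"
  shows "norm (f (x + h) - f x - (\<Sum>l\<in>UNIV. (h $ l) *\<^sub>R partials [l] f x)) \<le> (real CARD('n))\<^sup>2 * M * (norm h)\<^sup>2"
proof -
  define F where "F y = f y - (\<Sum>l\<in>UNIV. (y $ l) *\<^sub>R partials [l] f x)" for y
  have M0: "M \<ge> 0" using order_trans[OF norm_ge_zero M] .
  have dF: "(F has_derivative (\<lambda>k. \<Sum>l\<in>UNIV. (k $ l) *\<^sub>R (partials [l] f y - partials [l] f x))) (at y within S)" for y S
  proof -
    have "(F has_derivative (\<lambda>k. (\<Sum>l\<in>UNIV. (k $ l) *\<^sub>R partials [l] f y) - (\<Sum>l\<in>UNIV. (k $ l) *\<^sub>R partials [l] f x))) (at y within S)"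
      unfolding F_def
      by (intro has_derivative_diff has_derivative_at_withinI[OF smooth_has_derivative[OF f]]
          bounded_linear_imp_has_derivative bounded_linear_sum
          bounded_linear_compose[OF bounded_linear_scaleR_left] bounded_linear_vec_nth)
    then show ?thesis by (simp only: scaleR_diff_right sum_subtractf)
  qed
  have on: "onorm (\<lambda>k. \<Sum>l\<in>UNIV. (k $ l) *\<^sub>R (partials [l] f y - partials [l] f x)) \<le> (real CARD('n))\<^sup>2 * M * norm h"
    if "y \<in> cball x (norm h)" for y
  proof (rule onorm_le)
    fix k :: "real ^ 'n"
    have "norm (partials [l] f y - partials [l] f x) \<le> real CARD('n) * M * norm (y - x)" for l
      using M by (intro smooth_lipschitz smooth_partials f) simp
    then have "norm (\<Sum>l\<in>UNIV. (k $ l) *\<^sub>R (partials [l] f y - partials [l] f x)) \<le>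
        real CARD('n) * (real CARD('n) * M * norm (y - x)) * norm k"
      by (rule norm_directional_le)
    also have "\<dots> \<le> real CARD('n) * (real CARD('n) * M * norm h) * norm k"
      using that M0 by (intro mult_right_mono mult_left_mono) (auto simp: dist_norm norm_minus_commute)
    finally show "norm (\<Sum>l\<in>UNIV. (k $ l) *\<^sub>R (partials [l] f y - partials [l] f x)) \<le>
        (real CARD('n))\<^sup>2 * M * norm h * norm k"
      by (simp add: power2_eq_square mult_ac)
  qed
  have "norm (F (x + h) - F x) \<le> (real CARD('n))\<^sup>2 * M * norm h * norm (x + h - x)"
    by (rule differentiable_bound[OF convex_cball[of x "norm h"] dF on]) (auto simp: dist_norm)
  moreover have "F (x + h) - F x = f (x + h) - f x - (\<Sum>l\<in>UNIV. (h $ l) *\<^sub>R partials [l] f x)"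
    unfolding F_def by (simp add: scaleR_add_left sum.distrib del: partials.simps)
  ultimately show ?thesis by (simp add: power2_eq_square mult_ac del: partials.simps)
qed

lemma summable_on_finite_sum:
  fixes f :: "'i \<Rightarrow> 'a \<Rightarrow> 'b::topological_comm_monoid_add"
  assumes "finite I" "\<And>i. i \<in> I \<Longrightarrow> f i summable_on A"
  shows "(\<lambda>x. \<Sum>i\<in>I. f i x) summable_on A"
  using assms by (induction I rule: finite_induct) (auto intro: summable_on_add)

lemma norm_summable_dominated:
  fixes f :: "'i \<Rightarrow> 'b::banach"
  assumes "M summable_on UNIV" "\<And>i. norm (f i) \<le> M i"
  shows "(f has_sum (\<Sum>\<^sub>\<infinity>i. f i)) UNIV" and "norm (\<Sum>\<^sub>\<infinity>i. f i) \<le> (\<Sum>\<^sub>\<infinity>i. M i)"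
proof -
  have "(\<lambda>i. norm (f i)) summable_on UNIV"
    using assms by (intro summable_on_comparison_test[OF assms(1)]) auto
  then show s: "(f has_sum (\<Sum>\<^sub>\<infinity>i. f i)) UNIV" using abs_summable_summable has_sum_infsum by blast
  show "norm (\<Sum>\<^sub>\<infinity>i. f i) \<le> (\<Sum>\<^sub>\<infinity>i. M i)"
    by (rule norm_infsum_le[OF s has_sum_infsum[OF assms(1)]]) (use assms in auto)
qed

text \<open>Every term has a quadratic remainder with a summable constant, so the sum has one as
  well.\<close>

lemma infsum_has_derivative:
  fixes v :: "'i \<Rightarrow> real ^ 'n::finite \<Rightarrow> complex"
  assumes smooth: "\<And>i. smooth (v i)"
    and M: "\<And>ls. M ls summable_on UNIV" "\<And>ls i x. norm (partials ls (v i) x) \<le> M ls i"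
  shows "((\<lambda>x. \<Sum>\<^sub>\<infinity>i. partials ls (v i) x) has_derivative
    (\<lambda>h. \<Sum>l\<in>UNIV. (h $ l) *\<^sub>R (\<Sum>\<^sub>\<infinity>i. partials (l # ls) (v i) x))) (at x)"
    (is "(?V has_derivative ?L) _")
proof (rule has_derivative_quadratic_remainder)
  show "bounded_linear ?L"
    by (intro bounded_linear_sum bounded_linear_compose[OF bounded_linear_scaleR_left] bounded_linear_vec_nth)
  \<comment> \<open>The remainder needs majorants two derivatives higher, in every pair of
    directions.\<close>
  define B where "B i = (\<Sum>l\<in>UNIV. \<Sum>l'\<in>UNIV. M (l' # l # ls) i)" for i
  have B: "B summable_on UNIV"
    unfolding B_def by (intro summable_on_finite_sum M(1)) auto
  have M0: "M as i \<ge> 0" for as i using order_trans[OF norm_ge_zero M(2)] .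
  have MB: "M (l' # l # ls) i \<le> B i" for l l' i
  proof -
    have "M (l' # l # ls) i \<le> (\<Sum>l'\<in>UNIV. M (l' # l # ls) i)" by (rule member_le_sum) (auto simp: M0)
    also have "\<dots> \<le> B i" unfolding B_def by (rule member_le_sum) (auto simp: M0 sum_nonneg)
    finally show ?thesis .
  qed
  note hs = norm_summable_dominated(1)[OF M]
  fix h
  let ?c = "(real CARD('n))\<^sup>2"
  let ?R = "\<lambda>i. partials ls (v i) (x + h) - partials ls (v i) x - (\<Sum>l\<in>UNIV. (h $ l) *\<^sub>R partials (l # ls) (v i) x)"
  have "(?R has_sum (?V (x + h) - ?V x - ?L h)) UNIV"
    by (intro has_sum_diff hs has_sum_finite_sum finite has_sum_bounded_linear[OF bounded_linear_scaleR_right] hs)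
  moreover have "((\<lambda>i. ?c * B i * (norm h)\<^sup>2) has_sum (?c * (\<Sum>\<^sub>\<infinity>i. B i) * (norm h)\<^sup>2)) UNIV"
    by (intro has_sum_cmult_left has_sum_cmult_right has_sum_infsum B)
  moreover have "norm (?R i) \<le> ?c * B i * (norm h)\<^sup>2" for i
    using smooth_quadratic_remainder[OF smooth_partials[OF smooth], of ls i "B i" x h]
      order_trans[OF M(2) MB] by simp
  ultimately show "norm (?V (x + h) - ?V x - ?L h) \<le> ?c * (\<Sum>\<^sub>\<infinity>i. B i) * (norm h)\<^sup>2"
    by (rule norm_infsum_le)
qed

text \<open>Majorants with weight exponent 0 justify termwise differentiation; those with positive
  exponents give the decay.\<close>

theorem schwartz_infsum:
  fixes v :: "'i \<Rightarrow> real ^ 'n::finite \<Rightarrow> complex"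
  assumes smooth: "\<And>i. smooth (v i)"
    and M: "\<And>k ls. M k ls summable_on UNIV"
      "\<And>k ls i x. (1 + norm x) ^ k * norm (partials ls (v i) x) \<le> M k ls i"
  shows "(\<lambda>x. \<Sum>\<^sub>\<infinity>i. v i x) \<in> schwartz"
proof -
  have M0: "norm (partials ls (v i) x) \<le> M 0 ls i" for ls i x using M(2)[of x 0] by simp
  note d = infsum_has_derivative[OF smooth M(1)[of 0] M0]
  have eq: "partials ls (\<lambda>x. \<Sum>\<^sub>\<infinity>i. v i x) = (\<lambda>x. \<Sum>\<^sub>\<infinity>i. partials ls (v i) x)" for ls
  proof (induction ls)
    case (Cons l ls)
    have "partials (l # ls) (\<lambda>x. \<Sum>\<^sub>\<infinity>i. v i x) = partials [l] (\<lambda>x. \<Sum>\<^sub>\<infinity>i. partials ls (v i) x)"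
      using Cons by simp
    also have "\<dots> = (\<lambda>x. \<Sum>\<^sub>\<infinity>i. partials (l # ls) (v i) x)"
      by (subst has_derivative_imp_partial[OF d])
        (simp add: axis_def if_distrib if_distribR sum.delta del: partials.simps cong: if_cong)
    finally show ?case .
  qed simp
  show ?thesis
  proof (rule schwartzI)
    show "smooth (\<lambda>x. \<Sum>\<^sub>\<infinity>i. v i x)"
      unfolding smooth_def eq using d unfolding differentiable_def by blast
    fix k ls
    have "(1 + norm x) ^ k * norm (partials ls (\<lambda>x. \<Sum>\<^sub>\<infinity>i. v i x) x) \<le> (\<Sum>\<^sub>\<infinity>i. M k ls i)" for x
    proof -
      have "((\<lambda>i. (1 + norm x) ^ k *\<^sub>R partials ls (v i) x) has_sum
          (1 + norm x) ^ k *\<^sub>R (\<Sum>\<^sub>\<infinity>i. partials ls (v i) x)) UNIV"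
        by (intro has_sum_bounded_linear[OF bounded_linear_scaleR_right] norm_summable_dominated(1)[OF M(1)[of 0] M0])
      from norm_infsum_le[OF this has_sum_infsum[OF M(1)[of k ls]]] M(2)[of x k ls]
      show ?thesis unfolding eq by simp
    qed
    then show "\<exists>C. \<forall>x. (1 + norm x) ^ k * norm (partials ls (\<lambda>x. \<Sum>\<^sub>\<infinity>i. v i x) x) \<le> C" by blast
  qed
qed

text \<open>Convergence runs along finite subsets of an arbitrary index set, where dominated
  convergence for sequences is not at hand. The tail of \<open>M\<close> bounds the error uniformly
  in \<open>x\<close>, and integrating against |\<phi>| keeps this control.\<close>

lemma has_sum_integral_mult:
  fixes v :: "'i \<Rightarrow> real ^ 'n::finite \<Rightarrow> complex"
  assumes \<phi>: "integrable lborel \<phi>" and M: "M summable_on UNIV" "\<And>i x. norm (v i x) \<le> M i"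
    and v: "\<And>i. v i \<in> borel_measurable borel" and g: "g \<in> borel_measurable borel"
    and sum: "\<And>x. ((\<lambda>i. v i x) has_sum g x) UNIV"
  shows "((\<lambda>i. LBINT x. v i x * \<phi> x) has_sum (LBINT x. g x * \<phi> x)) UNIV"
proof -
  note [measurable] = v g
  have [measurable]: "\<phi> \<in> borel_measurable borel" using \<phi> by (auto dest: borel_measurable_integrable)
  let ?S = "\<Sum>\<^sub>\<infinity>i. M i" and ?I = "LBINT x. norm (\<phi> x)"
  have M0: "M i \<ge> 0" for i using order_trans[OF norm_ge_zero M(2)[of i 0]] .
  have mult: "integrable lborel (\<lambda>x. u x * \<phi> x)"
    if "u \<in> borel_measurable borel" "\<And>x. norm (u x) \<le> C" for u :: "real ^ 'n \<Rightarrow> complex" and C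
  proof (rule Bochner_Integration.integrable_bound)
    show "integrable lborel (\<lambda>x. C * norm (\<phi> x))" using \<phi> by simp
    show "(\<lambda>x. u x * \<phi> x) \<in> borel_measurable lborel" using that(1) by measurable
    show "AE x in lborel. norm (u x * \<phi> x) \<le> norm (C * norm (\<phi> x))"
      using that(2) by (intro always_eventually allI)
        (auto simp: norm_mult intro!: mult_right_mono intro: order_trans[OF _ abs_ge_self])
  qed
  have gS: "norm (g x) \<le> ?S" for x
    by (rule norm_infsum_le[OF sum[of x] has_sum_infsum[OF M(1)]]) (rule M(2))
  have rest: "norm (g x - (\<Sum>i\<in>X. v i x)) \<le> ?S - (\<Sum>i\<in>X. M i)" if X: "finite X" for X x
  proof -
    have 1: "((\<lambda>i. v i x) has_sum (g x - (\<Sum>i\<in>X. v i x))) (UNIV - X)"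
      using X by (intro has_sum_Diff sum has_sum_finite) auto
    have 2: "(M has_sum (?S - (\<Sum>i\<in>X. M i))) (UNIV - X)"
      using X by (intro has_sum_Diff has_sum_infsum M has_sum_finite) auto
    show ?thesis by (rule norm_infsum_le[OF 1 2]) (rule M(2))
  qed
  have "norm ((\<Sum>i\<in>X. LBINT x. v i x * \<phi> x) - (LBINT x. g x * \<phi> x)) \<le> (?S - (\<Sum>i\<in>X. M i)) * ?I"
    if X: "finite X" for X
  proof -
    have iv: "integrable lborel (\<lambda>x. v i x * \<phi> x)" for i by (rule mult[OF v M(2)])
    have ig: "integrable lborel (\<lambda>x. g x * \<phi> x)" by (rule mult[OF g gS])
    have "(LBINT x. g x * \<phi> x) - (\<Sum>i\<in>X. LBINT x. v i x * \<phi> x) =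
        (LBINT x. (g x - (\<Sum>i\<in>X. v i x)) * \<phi> x)"
      unfolding left_diff_distrib sum_distrib_right
      by (subst Bochner_Integration.integral_diff[OF ig Bochner_Integration.integrable_sum[OF iv]],
          subst Bochner_Integration.integral_sum[OF iv]) (rule refl)
    also have "norm \<dots> \<le> (LBINT x. (?S - (\<Sum>i\<in>X. M i)) * norm (\<phi> x))"
    proof (rule Bochner_Integration.integral_norm_bound_integral)
      show "integrable lborel (\<lambda>x. (g x - (\<Sum>i\<in>X. v i x)) * \<phi> x)"
        by (rule mult[OF _ rest[OF X]]) measurable
      show "norm ((g x - (\<Sum>i\<in>X. v i x)) * \<phi> x) \<le> (?S - (\<Sum>i\<in>X. M i)) * norm (\<phi> x)" for x
        unfolding norm_mult by (intro mult_right_mono rest X) simp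
    qed (use \<phi> in simp)
    finally show ?thesis by (simp add: norm_minus_commute)
  qed
  then have "\<forall>\<^sub>F X in finite_subsets_at_top UNIV.
      norm ((\<Sum>i\<in>X. LBINT x. v i x * \<phi> x) - (LBINT x. g x * \<phi> x)) \<le> (?S - (\<Sum>i\<in>X. M i)) * ?I"
    by (intro eventually_finite_subsets_at_top_weakI)
  moreover have "((\<lambda>X. (?S - (\<Sum>i\<in>X. M i)) * ?I) \<longlongrightarrow> (?S - ?S) * ?I) (finite_subsets_at_top UNIV)"
    using has_sum_infsum[OF M(1)] unfolding has_sum_def by (intro tendsto_intros)
  ultimately have "((\<lambda>X. (\<Sum>i\<in>X. LBINT x. v i x * \<phi> x) - (LBINT x. g x * \<phi> x)) \<longlongrightarrow> 0) (finite_subsets_at_top UNIV)"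
    unfolding diff_self mult_zero_left by (rule Lim_null_comparison)
  then show ?thesis unfolding has_sum_def by (rule LIM_zero_cancel)
qed

section \<open>Quark series with rapidly decaying coefficients\<close>

lemma supp_comp_scaleR_subset:
  fixes f :: "real ^ 'n::finite \<Rightarrow> 'b::real_normed_vector"
  shows "supp (\<lambda>z. f (c *\<^sub>R z)) \<subseteq> {z. c *\<^sub>R z \<in> supp f}"
  unfolding supp_def
proof (rule closure_minimal)
  show "{x. f (c *\<^sub>R x) \<noteq> 0} \<subseteq> {z. c *\<^sub>R z \<in> closure {x. f x \<noteq> 0}}"
    using closure_subset[of "{x. f x \<noteq> 0}"] by auto
  have "closed ((\<lambda>z. c *\<^sub>R z) -` closure {x. f x \<noteq> 0})"
    by (intro closed_vimage closed_closure continuous_intros)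
  then show "closed {z. c *\<^sub>R z \<in> closure {x. f x \<noteq> 0}}" by (simp add: vimage_def)
qed

lemma supp_of_real: "supp (\<lambda>z. complex_of_real (k z)) = supp k"
  by (simp add: supp_def)

lemma supp_scaleR_subset:
  fixes k :: "real ^ 'n::finite \<Rightarrow> real"
  shows "supp (\<lambda>z. complex_of_real (k (c *\<^sub>R z))) \<subseteq> {z. c *\<^sub>R z \<in> supp k}"
  unfolding supp_of_real[of "\<lambda>z. k (c *\<^sub>R z)"] by (rule supp_comp_scaleR_subset)

lemma supp_norm_bound:
  fixes k :: "real ^ 'n::finite \<Rightarrow> real"
  assumes "supp k \<subseteq> {y. norm y < B}" "B > 0"
  shows "\<exists>\<rho>. 0 < \<rho> \<and> \<rho> < 1 \<and> (\<forall>y\<in>supp k. norm y \<le> \<rho> * B)"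
proof -
  have "bounded (supp k)" using assms(1) by (intro boundedI[of _ B]) auto
  then have c: "compact (supp k)" by (simp add: supp_def compact_eq_bounded_closed)
  show ?thesis
  proof (cases "supp k = {}")
    case True
    then show ?thesis by (intro exI[of _ "1 / 2"]) auto
  next
    case False
    then obtain y where y: "y \<in> supp k" "\<And>z. z \<in> supp k \<Longrightarrow> norm z \<le> norm y"
      using continuous_attains_sup[OF c, of norm] by (auto intro: continuous_intros)
    have lt: "norm y < B" using y(1) assms(1) by blast
    \<comment> \<open>The maximum with 1/2 keeps the ratio positive when the support reduces to the
      origin.\<close>
    define \<rho> where "\<rho> = max (1 / 2) (norm y / B)"
    have "norm y / B \<le> \<rho>" unfolding \<rho>_def by simp
    then have "norm y \<le> \<rho> * B" using pos_divide_le_eq[OF assms(2)] by blast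
    moreover have "0 < \<rho>" "\<rho> < 1" unfolding \<rho>_def using lt assms(2) by auto
    ultimately show ?thesis using y(2) order_trans by blast
  qed
qed

text \<open>Measuring length in units of 2^J turns the quark into a plain monomial times a cut-off
  supported in a ball of radius below 1.\<close>

lemma quark_jm_altdef:
  "quark_jm J k \<beta> j m = (\<lambda>x. (\<lambda>z. monomial \<beta> z * complex_of_real (k (2 ^ J *\<^sub>R z)))
    ((2 ^ j / 2 ^ J) *\<^sub>R x + (- (1 / 2 ^ J) *\<^sub>R lattice_point m)))"
proof -
  have "(2 ^ j / 2 ^ J) *\<^sub>R x + (- (1 / 2 ^ J) *\<^sub>R lattice_point m) = (1 / 2 ^ J) *\<^sub>R (2 ^ j *\<^sub>R x - lattice_point m)" for x
    by (simp add: scaleR_diff_right)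
  then show ?thesis
    by (simp add: quark_jm_def quark_def monomial_def fun_eq_iff)
qed

lemma smooth_scaled_cutoff:
  fixes k :: "real ^ 'n::finite \<Rightarrow> real"
  assumes "smooth k" shows "smooth (\<lambda>z. complex_of_real (k (c *\<^sub>R z)))"
  using smooth_bounded_linear[OF bounded_linear_of_real smooth_affine[OF assms, of c 0]] by simp

lemma smooth_quark_jm:
  assumes "smooth k" shows "smooth (quark_jm J k \<beta> j m)"
  unfolding quark_jm_altdef by (intro smooth_affine smooth_mult smooth_monomial smooth_scaled_cutoff assms)

lemma scaled_cutoff_schwartz:
  fixes k :: "real ^ 'n::finite \<Rightarrow> real"
  assumes k: "smooth k" and b: "bounded (supp k)" and c: "c \<noteq> 0"
  shows "(\<lambda>z. complex_of_real (k (c *\<^sub>R z))) \<in> schwartz"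
proof (rule smooth_compact_support_schwartz[OF smooth_scaled_cutoff[OF k]])
  obtain B where B: "\<And>y. y \<in> supp k \<Longrightarrow> norm y \<le> B" using b unfolding bounded_iff by blast
  show "bounded (supp (\<lambda>z. complex_of_real (k (c *\<^sub>R z))))"
  proof (rule boundedI)
    fix z assume "z \<in> supp (\<lambda>z. complex_of_real (k (c *\<^sub>R z)))"
    then have "norm (c *\<^sub>R z) \<le> B" using supp_scaleR_subset B by blast
    then show "norm z \<le> B / \<bar>c\<bar>" using c by (simp add: field_simps)
  qed
qed

text \<open>The rate is chosen before \<open>N\<close>: all orders of derivatives share the same
  geometric factor, and only the constant depends on the order.\<close>

lemma quark_jm_bound:
  fixes k :: "real ^ 'n::finite \<Rightarrow> real"
  assumes k: "smooth k" and supp: "supp k \<subseteq> {y. norm y < 2 ^ J}"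
  shows "\<exists>\<sigma>. 0 < \<sigma> \<and> \<sigma> < 1 \<and> (\<forall>N. \<exists>C\<ge>0. \<forall>\<beta> j m ls x. length ls \<le> N \<longrightarrow>
    norm (partials ls (quark_jm J k \<beta> j m) x) \<le> C * 2 ^ (j * N) * \<sigma> ^ mi_abs \<beta>)"
proof -
  let ?k = "\<lambda>z. complex_of_real (k (2 ^ J *\<^sub>R z))"
  have "bounded (supp k)" using supp by (intro boundedI[of _ "2 ^ J"]) auto
  then have ks: "?k \<in> schwartz" using k by (intro scaled_cutoff_schwartz) auto
  obtain \<rho> where \<rho>: "0 < \<rho>" "\<rho> < 1" "\<And>y. y \<in> supp k \<Longrightarrow> norm y \<le> \<rho> * 2 ^ J"
    using supp_norm_bound[OF supp] by auto
  have sk: "norm z \<le> \<rho>" if "z \<in> supp ?k" for z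
  proof -
    have "2 ^ J *\<^sub>R z \<in> supp k" using that supp_scaleR_subset[of k "2 ^ J"] by blast
    from \<rho>(3)[OF this] show ?thesis by simp
  qed
  \<comment> \<open>The rate of the support is \<rho> = \<sigma> \<sigma>. One factor absorbs the
    power of 1 + |\<beta>|, the other remains for the summation over \<beta>.\<close>
  define \<sigma> where "\<sigma> = sqrt \<rho>"
  have \<sigma>: "0 < \<sigma>" "\<sigma> < 1" "\<rho> = \<sigma> * \<sigma>" using \<rho> by (auto simp: \<sigma>_def)
  have "\<exists>C\<ge>0. \<forall>\<beta> j m ls x. length ls \<le> N \<longrightarrow>
    norm (partials ls (quark_jm J k \<beta> j m) x) \<le> C * 2 ^ (j * N) * \<sigma> ^ mi_abs \<beta>" for N
  proof -
    obtain A where A: "A \<ge> 0" "\<And>\<beta> ls x. length ls \<le> N \<Longrightarrow>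
        norm (partials ls (\<lambda>z. monomial \<beta> z * ?k z) x) \<le> A * (1 + real (mi_abs \<beta>)) ^ N * \<rho> ^ mi_abs \<beta>"
      using partials_monomial_mult_bound[OF ks \<rho>(1) sk] by blast
    obtain B where B: "B \<ge> 0" "\<And>b. (1 + real b) ^ N * \<sigma> ^ b \<le> B"
      using power_times_geometric_bound[OF \<sigma>(1,2)] by blast
    have "norm (partials ls (quark_jm J k \<beta> j m) x) \<le> (A * B) * 2 ^ (j * N) * \<sigma> ^ mi_abs \<beta>"
      if ls: "length ls \<le> N" for \<beta> j m ls x
    proof -
      let ?z = "(2 ^ j / 2 ^ J) *\<^sub>R x + (- (1 / 2 ^ J) *\<^sub>R lattice_point m)"
      have "norm (partials ls (quark_jm J k \<beta> j m) x) =
          (2 ^ j / 2 ^ J) ^ length ls * norm (partials ls (\<lambda>z. monomial \<beta> z * ?k z) ?z)"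
        unfolding quark_jm_altdef
        by (subst partials_affine) (auto intro!: smooth_mult smooth_monomial smooth_scaled_cutoff k)
      also have "\<dots> \<le> 2 ^ (j * N) * (A * (1 + real (mi_abs \<beta>)) ^ N * \<rho> ^ mi_abs \<beta>)"
      proof (intro mult_mono A(2) ls)
        have "(2 ^ j / 2 ^ J :: real) ^ length ls \<le> (2 ^ j) ^ length ls"
          by (intro power_mono) (auto simp: divide_le_eq)
        also have "\<dots> \<le> (2 ^ j) ^ N" using ls by (intro power_increasing) auto
        finally show "(2 ^ j / 2 ^ J :: real) ^ length ls \<le> 2 ^ (j * N)" by (simp add: power_mult)
      qed auto
      also have "\<dots> = 2 ^ (j * N) * A * ((1 + real (mi_abs \<beta>)) ^ N * \<sigma> ^ mi_abs \<beta>) * \<sigma> ^ mi_abs \<beta>"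
        unfolding \<sigma>(3) by (simp add: power_mult_distrib mult_ac)
      also have "\<dots> \<le> 2 ^ (j * N) * A * B * \<sigma> ^ mi_abs \<beta>"
        using A(1) B \<sigma> by (intro mult_right_mono mult_left_mono) auto
      finally show ?thesis by (simp add: mult_ac)
    qed
    then show ?thesis using A(1) B(1) by (intro exI[of _ "A * B"]) auto
  qed
  then show ?thesis using \<sigma> by blast
qed

text \<open>Localisation near 2^{-j} m, through which the weight in x is exchanged for the weight 1
  + 2^{-j} |m| of the coefficients.\<close>

lemma partials_quark_jm_zero:
  fixes k :: "real ^ 'n::finite \<Rightarrow> real"
  assumes k: "smooth k" and supp: "supp k \<subseteq> {y. norm y < 2 ^ J}"
    and nz: "partials ls (quark_jm J k \<beta> j m) x \<noteq> 0"
  shows "norm (2 ^ j *\<^sub>R x - lattice_point m) < 2 ^ J"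
proof -
  let ?k = "\<lambda>z. complex_of_real (k (2 ^ J *\<^sub>R z))"
  let ?z = "(2 ^ j / 2 ^ J) *\<^sub>R x + (- (1 / 2 ^ J) *\<^sub>R lattice_point m)"
  have "partials ls (\<lambda>z. monomial \<beta> z * ?k z) ?z \<noteq> 0"
    using nz unfolding quark_jm_altdef
    by (subst (asm) partials_affine) (auto intro!: smooth_mult smooth_monomial smooth_scaled_cutoff k)
  then have "?z \<in> supp (\<lambda>z. monomial \<beta> z * ?k z)" using partials_outside_supp by blast
  then have "?z \<in> supp ?k" by (rule subsetD[OF supp_mult_subset])
  then have "2 ^ J *\<^sub>R ?z \<in> supp k" using subsetD[OF supp_scaleR_subset] by blast
  moreover have "2 ^ J *\<^sub>R ?z = 2 ^ j *\<^sub>R x - lattice_point m" by (simp add: scaleR_diff_right)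
  ultimately show ?thesis using supp by auto
qed

lemma summable_on_triple:
  assumes "a summable_on UNIV" "b summable_on UNIV" "c summable_on UNIV"
    "\<And>x. 0 \<le> (a x :: real)" "\<And>y. 0 \<le> b y" "\<And>z. 0 \<le> c z"
  shows "(\<lambda>(x, y, z). a x * (b y * c z)) summable_on UNIV"
proof -
  have prod: "(\<lambda>(x, y). f x * g y) summable_on UNIV"
    if "f summable_on UNIV" "g summable_on UNIV" "\<And>x. 0 \<le> (f x :: real)" "\<And>y. 0 \<le> g y" for f :: "'x \<Rightarrow> real" and g :: "'y \<Rightarrow> real"
    unfolding UNIV_Times_UNIV[symmetric]
    by (rule summable_on_SigmaI[where g = "\<lambda>x. f x * infsum g UNIV"])
      (use that in \<open>auto intro!: has_sum_cmult_right summable_on_cmult_left has_sum_infsum\<close>)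
  have "(\<lambda>(y, z). b y * c z) summable_on UNIV" by (rule prod) (use assms in auto)
  then have "(\<lambda>(x, p). a x * (case p of (y, z) \<Rightarrow> b y * c z)) summable_on UNIV"
    by (intro prod) (use assms in \<open>auto split: prod.split\<close>)
  then show ?thesis by (simp add: case_prod_unfold)
qed

lemma quark_series_dominated:
  fixes k :: "real ^ 'n::finite \<Rightarrow> real"
  assumes k: "smooth k" and supp: "supp k \<subseteq> {y. norm y < 2 ^ J}" and \<mu>: "rapidly_decreasing \<mu>"
  shows "\<exists>M. M summable_on UNIV \<and> (\<forall>\<beta> j m x.
    (1 + norm x) ^ K * norm (partials ls (\<lambda>x. \<mu> \<beta> j m * quark_jm J k \<beta> j m x) x) \<le> M (\<beta>, j, m))"
proof -
  let ?P = "2 * CARD('n)"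
  define N where "N = length ls"
  define q where "q j m = 1 + norm (lattice_point m :: real ^ 'n) / 2 ^ j" for j :: nat and m
  have q: "q j m \<ge> 1" for j m by (simp add: q_def)
  obtain \<sigma> where \<sigma>: "0 < \<sigma>" "\<sigma> < 1" and "\<forall>N. \<exists>C\<ge>0. \<forall>\<beta> j m ls x. length ls \<le> N \<longrightarrow>
    norm (partials ls (quark_jm J k \<beta> j m) x) \<le> C * 2 ^ (j * N) * \<sigma> ^ mi_abs \<beta>"
    using quark_jm_bound[OF k supp] by blast
  then obtain A where A: "A \<ge> 0" "\<And>\<beta> j m x. norm (partials ls (quark_jm J k \<beta> j m) x) \<le> A * 2 ^ (j * N) * \<sigma> ^ mi_abs \<beta>"
    unfolding N_def by (meson order_refl)
  \<comment> \<open>In the power of 2^j, N pays for the derivatives, 1 for the sum over j, and 2n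
    for passing from 1 + 2^{-j} |m| to 1 + |m|. In the power of \<open>q\<close>, K pays for the
    weight in x and 2n for the sum over the lattice.\<close>
  obtain C where C: "C \<ge> 0" "\<And>\<beta> j m. 2 ^ (j * (N + 1 + ?P)) * q j m ^ (K + ?P) * norm (\<mu> \<beta> j m) \<le> C"
    using \<mu> unfolding rapidly_decreasing_def q_def by blast
  define D where "D = (1 + 2 ^ J) ^ K * (A * C)"
  define M where "M = (\<lambda>(\<beta> :: nat ^ 'n, j :: nat, m :: int ^ 'n).
    (D * \<sigma> ^ mi_abs \<beta>) * ((1 / 2) ^ j * (1 / (1 + norm (lattice_point m)) ^ ?P)))"
  have D: "D \<ge> 0" using A C by (simp add: D_def)
  have "M summable_on UNIV"
    unfolding M_def
  proof (rule summable_on_triple)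
    show "(\<lambda>\<beta> :: nat ^ 'n. D * \<sigma> ^ mi_abs \<beta>) summable_on UNIV"
      using \<sigma> by (intro summable_on_cmult_right summable_on_mi_abs) auto
    show "(\<lambda>j. (1 / 2 :: real) ^ j) summable_on UNIV"
      by (intro summable_nonneg_imp_summable_on) auto
  qed (use D \<sigma> summable_on_lattice in auto)
  moreover have "(1 + norm x) ^ K * norm (partials ls (\<lambda>x. \<mu> \<beta> j m * quark_jm J k \<beta> j m x) x) \<le> M (\<beta>, j, m)" for \<beta> j m x
  proof (cases "partials ls (quark_jm J k \<beta> j m) x = 0")
    case True
    then have "partials ls (\<lambda>x. \<mu> \<beta> j m * quark_jm J k \<beta> j m x) x = 0"
      using partials_bounded_linear[OF bounded_linear_mult_right smooth_quark_jm[OF k]] by simp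
    then show ?thesis using D \<sigma> by (simp add: M_def)
  next
    case False
    let ?\<mu> = "norm (\<mu> \<beta> j m)"
    have eq: "norm (partials ls (\<lambda>x. \<mu> \<beta> j m * quark_jm J k \<beta> j m x) x) = ?\<mu> * norm (partials ls (quark_jm J k \<beta> j m) x)"
      using partials_bounded_linear[OF bounded_linear_mult_right smooth_quark_jm[OF k], of ls "\<mu> \<beta> j m"]
      by (simp add: norm_mult)
    have near: "norm (2 ^ j *\<^sub>R x - lattice_point m) < 2 ^ J"
      by (rule partials_quark_jm_zero[OF k supp False])
    have "2 ^ j * norm x \<le> norm (lattice_point m) + 2 ^ J"
      using norm_triangle_sub[of "2 ^ j *\<^sub>R x" "lattice_point m"] near by simp
    then have "norm x \<le> (norm (lattice_point m) + 2 ^ J) / 2 ^ j"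
      by (simp add: pos_le_divide_eq mult.commute)
    also have "\<dots> \<le> norm (lattice_point m) / 2 ^ j + 2 ^ J"
      by (simp add: add_divide_distrib divide_le_eq)
    finally have "1 + norm x \<le> q j m + 2 ^ J" by (simp add: q_def)
    also have "\<dots> \<le> q j m + 2 ^ J * q j m" using q[of j m] by simp
    finally have x: "1 + norm x \<le> (1 + 2 ^ J) * q j m" by (simp add: distrib_right)
    then have xK: "(1 + norm x) ^ K \<le> (1 + 2 ^ J) ^ K * q j m ^ K"
      by (metis add_nonneg_nonneg norm_ge_zero power_mono power_mult_distrib zero_le_one)
    have q2: "1 + norm (lattice_point m) \<le> 2 ^ j * q j m"
      by (simp add: q_def distrib_left)
    have pos: "q j m > 0" using q[of j m] by simp
    have \<mu>le: "?\<mu> \<le> C / (2 ^ (j * (N + 1 + ?P)) * q j m ^ (K + ?P))"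
      using C(2)[of j m \<beta>] pos by (simp add: pos_le_divide_eq mult.commute)
    have "(1 + norm x) ^ K * norm (partials ls (\<lambda>x. \<mu> \<beta> j m * quark_jm J k \<beta> j m x) x) \<le>
        ((1 + 2 ^ J) ^ K * q j m ^ K) * (C / (2 ^ (j * (N + 1 + ?P)) * q j m ^ (K + ?P)) * (A * 2 ^ (j * N) * \<sigma> ^ mi_abs \<beta>))"
      unfolding eq using C(1) pos by (intro mult_mono xK \<mu>le A(2)) auto
    also have "\<dots> = D * \<sigma> ^ mi_abs \<beta> * ((1 / 2) ^ j * (1 / (2 ^ j * q j m) ^ ?P))"
      using pos unfolding D_def
      by (simp add: power_add power_mult power_mult_distrib power_divide field_simps)
    also have "\<dots> \<le> M (\<beta>, j, m)"
      unfolding M_def case_prod_conv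
      using D \<sigma> q2 pos by (intro mult_left_mono divide_left_mono power_mono mult_pos_pos zero_less_power)
        (auto simp: add_pos_nonneg)
    finally show ?thesis .
  qed
  ultimately show ?thesis by blast
qed

text \<open>One family of majorants serves three purposes: all weights and derivatives for
  membership in \<open>schwartz\<close>, and the unweighted bound on the terms for the pointwise sum
  and for pairing with a test function.\<close>

lemma
  fixes k :: "real ^ 'n::finite \<Rightarrow> real"
  assumes k: "smooth k" and supp: "supp k \<subseteq> {y. norm y < 2 ^ J}" and \<mu>: "rapidly_decreasing \<mu>"
  defines "v \<equiv> \<lambda>(\<beta>, j, m) x. \<mu> \<beta> j m * quark_jm J k \<beta> j m x"
  shows quark_series_schwartz: "(\<lambda>x. \<Sum>\<^sub>\<infinity>i. v i x) \<in> schwartz"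
    and quark_series_has_sum: "((\<lambda>i. v i x) has_sum (\<Sum>\<^sub>\<infinity>i. v i x)) UNIV"
    and quark_series_regular_distribution: "\<phi> \<in> schwartz \<Longrightarrow>
      ((\<lambda>(\<beta>, j, m). \<mu> \<beta> j m * regular_distribution (quark_jm J k \<beta> j m) \<phi>) has_sum
        regular_distribution (\<lambda>x. \<Sum>\<^sub>\<infinity>i. v i x) \<phi>) UNIV"
proof -
  have "\<exists>M. M summable_on UNIV \<and> (\<forall>i x. (1 + norm x) ^ K * norm (partials ls (v i) x) \<le> M i)" for K ls
    using quark_series_dominated[OF k supp \<mu>, of K ls] by (fastforce simp: v_def)
  then obtain M where M: "\<And>K ls. M K ls summable_on UNIV"
    "\<And>K ls i x. (1 + norm x) ^ K * norm (partials ls (v i) x) \<le> M K ls i" by metis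
  have sm: "smooth (v i)" for i
    unfolding v_def by (cases i) (auto intro!: smooth_bounded_linear[OF bounded_linear_mult_right] smooth_quark_jm k)
  show s: "(\<lambda>x. \<Sum>\<^sub>\<infinity>i. v i x) \<in> schwartz"
    by (rule schwartz_infsum[OF sm M])
  have M0: "norm (v i x) \<le> M 0 [] i" for i x using M(2)[of x 0 "[]" i] by simp
  show hs: "((\<lambda>i. v i x) has_sum (\<Sum>\<^sub>\<infinity>i. v i x)) UNIV" for x
    by (rule norm_summable_dominated(1)[OF M(1) M0])
  assume \<phi>: "\<phi> \<in> schwartz"
  have "((\<lambda>i. LBINT x. v i x * \<phi> x) has_sum (\<integral>x. (\<Sum>\<^sub>\<infinity>i. v i x) * \<phi> x \<partial>lborel)) UNIV"
    by (rule has_sum_integral_mult[OF schwartz_integrable[OF \<phi>] M(1) M0])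
      (use sm s schwartz_smooth smooth_measurable hs in blast)+
  moreover have "(\<lambda>i. LBINT x. v i x * \<phi> x) =
      (\<lambda>(\<beta>, j, m). \<mu> \<beta> j m * regular_distribution (quark_jm J k \<beta> j m) \<phi>)"
    by (auto simp: v_def regular_distribution_def mult.assoc fun_eq_iff)
  ultimately show "((\<lambda>(\<beta>, j, m). \<mu> \<beta> j m * regular_distribution (quark_jm J k \<beta> j m) \<phi>) has_sum
        regular_distribution (\<lambda>x. \<Sum>\<^sub>\<infinity>i. v i x) \<phi>) UNIV"
    unfolding regular_distribution_def by simp
qed

section \<open>The coefficients of a Schwartz function\<close>

lemma inv_fourier_affine:
  fixes \<phi> :: "real ^ 'n::finite \<Rightarrow> complex"
  assumes \<phi>: "\<phi> \<in> schwartz" and c: "c > 0"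
  shows "inv_fourier (\<lambda>x. \<phi> (c *\<^sub>R x - t)) \<xi> =
    1 / complex_of_real c ^ CARD('n) * iexp (\<xi> \<bullet> ((1 / c) *\<^sub>R t)) * inv_fourier \<phi> ((1 / c) *\<^sub>R \<xi>)"
proof -
  note [measurable] = schwartz_measurable[OF \<phi>]
  have "(LBINT y. iexp (y \<bullet> ((1 / c) *\<^sub>R \<xi>)) * \<phi> y) =
      c ^ CARD('n) *\<^sub>R (LBINT x. iexp ((- t + c *\<^sub>R x) \<bullet> ((1 / c) *\<^sub>R \<xi>)) * \<phi> (- t + c *\<^sub>R x))"
    using c by (subst integral_lborel_affine[of c _ "- t"]) auto
  also have "(\<lambda>x. iexp ((- t + c *\<^sub>R x) \<bullet> ((1 / c) *\<^sub>R \<xi>)) * \<phi> (- t + c *\<^sub>R x)) =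
      (\<lambda>x. iexp (- (\<xi> \<bullet> ((1 / c) *\<^sub>R t))) * (iexp (x \<bullet> \<xi>) * \<phi> (c *\<^sub>R x - t)))"
  proof
    fix x
    have "(- t + c *\<^sub>R x) \<bullet> ((1 / c) *\<^sub>R \<xi>) = - (\<xi> \<bullet> ((1 / c) *\<^sub>R t)) + x \<bullet> \<xi>"
      using c by (simp add: inner_add_left inner_add_right inner_diff_right inner_diff_left inner_commute field_simps)
    then have "iexp ((- t + c *\<^sub>R x) \<bullet> ((1 / c) *\<^sub>R \<xi>)) = iexp (- (\<xi> \<bullet> ((1 / c) *\<^sub>R t))) * iexp (x \<bullet> \<xi>)"
      by (simp only: of_real_add distrib_left exp_add)
    then show "iexp ((- t + c *\<^sub>R x) \<bullet> ((1 / c) *\<^sub>R \<xi>)) * \<phi> (- t + c *\<^sub>R x) =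
        iexp (- (\<xi> \<bullet> ((1 / c) *\<^sub>R t))) * (iexp (x \<bullet> \<xi>) * \<phi> (c *\<^sub>R x - t))"
      by simp
  qed
  finally have "(LBINT y. iexp (y \<bullet> ((1 / c) *\<^sub>R \<xi>)) * \<phi> y) =
      complex_of_real c ^ CARD('n) * (iexp (- (\<xi> \<bullet> ((1 / c) *\<^sub>R t))) * (LBINT x. iexp (x \<bullet> \<xi>) * \<phi> (c *\<^sub>R x - t)))"
    by (simp only: integral_mult_right_zero scaleR_conv_of_real of_real_power)
  moreover have "1 / C * a * (C * (b * X)) = X" if "a * b = 1" "C \<noteq> 0" for a b C X :: complex
  proof -
    have "1 / C * a * (C * (b * X)) = (a * b) * X" using that(2) by simp
    then show ?thesis using that(1) by simp
  qed
  moreover have "iexp s * iexp (- s) = 1" for s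
    by (simp add: exp_add[symmetric])
  moreover have "complex_of_real c ^ CARD('n) \<noteq> 0" using c by simp
  ultimately have "1 / complex_of_real c ^ CARD('n) * iexp (\<xi> \<bullet> ((1 / c) *\<^sub>R t)) * (LBINT y. iexp (y \<bullet> ((1 / c) *\<^sub>R \<xi>)) * \<phi> y) =
      (LBINT x. iexp (x \<bullet> \<xi>) * \<phi> (c *\<^sub>R x - t))"
    by presburger
  then show ?thesis unfolding inv_fourier_def by (simp only: mult_ac)
qed

section \<open>Fourier side of the analysing functions\<close>

definition quark_factor :: "nat \<Rightarrow> nat ^ 'n::finite \<Rightarrow> complex" where
  "quark_factor J \<beta> = \<i> ^ mi_abs \<beta> * complex_of_real (2 ^ (J * mi_abs \<beta>) / mi_fact \<beta>)"

lemma omega_beta_altdef: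
  fixes \<beta> :: "nat ^ 'n::finite"
  shows "omega_beta J \<omega> \<beta> x =
    quark_factor J \<beta> / complex_of_real ((2 * pi) ^ CARD('n)) * (monomial \<beta> x * complex_of_real (\<omega> x))"
  by (simp add: omega_beta_def quark_factor_def monomial_def field_simps)

text \<open>For norm x <= 2 the cut-off \<open>\<omega>\<close> equals 1, and 2 < pi puts
  \<open>x\<close> in the open cube where the Fourier series represents the function. The constant
  is (2 pi)^(n/2) from the series over (2 pi)^n from \<open>omega_beta\<close>.\<close>

lemma Omega_beta_eq:
  fixes \<omega> :: "real ^ 'n::finite \<Rightarrow> real"
  assumes \<omega>: "smooth \<omega>" and supp: "supp \<omega> \<subseteq> {y. \<forall>l. - pi < y $ l \<and> y $ l < pi}"
    and one: "\<And>x. norm x \<le> 2 \<Longrightarrow> \<omega> x = 1" and x: "norm x \<le> 2"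
  shows "Omega_beta J \<omega> \<beta> x = complex_of_real (1 / sqrt (2 * pi) ^ CARD('n)) * (quark_factor J \<beta> * monomial \<beta> x)"
proof -
  let ?d = "sqrt (2 * pi) ^ CARD('n)"
  let ?w = "\<lambda>x. monomial \<beta> x * complex_of_real (\<omega> x)"
  have "bounded {y :: real ^ 'n. \<forall>l. - pi < y $ l \<and> y $ l < pi}"
    by (rule bounded_subset[OF bounded_cbox[of "\<chi> l. - pi" "\<chi> l. pi"]]) (auto simp: mem_box_cart less_imp_le)
  then have b: "bounded (supp \<omega>)" using supp bounded_subset by blast
  have sw: "supp ?w \<subseteq> supp \<omega>"
    using supp_mult_subset[of "monomial \<beta>" "\<lambda>x. complex_of_real (\<omega> x)"] supp_of_real[of \<omega>] by simp
  have "?w \<in> schwartz"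
    by (intro smooth_compact_support_schwartz bounded_subset[OF b sw] smooth_mult smooth_monomial
        smooth_bounded_linear[OF bounded_linear_of_real \<omega>])
  then have w: "omega_beta J \<omega> \<beta> \<in> schwartz"
    unfolding omega_beta_altdef[abs_def] by (rule schwartz_cmult)
  have "supp (omega_beta J \<omega> \<beta>) \<subseteq> supp ?w"
    unfolding omega_beta_altdef[abs_def] by (rule supp_mult_subset)
  then have sub: "supp (omega_beta J \<omega> \<beta>) \<subseteq> {y. \<forall>l. - pi < y $ l \<and> y $ l < pi}"
    using sw supp by blast
  have "\<bar>x $ l\<bar> < pi" for l
    using component_le_norm_cart[of x l] x pi_gt3 by linarith
  then have "- pi < x $ l \<and> x $ l < pi" for l by (simp add: abs_less_iff) (smt (verit))
  from fourier_series_of_inv_fourier[OF w sub this]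
  have "Omega_beta J \<omega> \<beta> x = complex_of_real ?d * omega_beta J \<omega> \<beta> x"
    unfolding Omega_beta_def .
  also have "\<dots> = complex_of_real (?d / (2 * pi) ^ CARD('n)) * (quark_factor J \<beta> * monomial \<beta> x)"
    unfolding omega_beta_altdef using one[OF x] by simp
  also have "?d / (2 * pi) ^ CARD('n) = 1 / ?d"
  proof -
    have "(2 * pi) ^ CARD('n) = ?d * ?d" by (subst power_mult_distrib[symmetric]) simp
    then show ?thesis by (simp add: field_simps)
  qed
  finally show ?thesis .
qed

section \<open>Dyadic cut-offs and frequency symbols\<close>

definition dyadic_cutoff :: "(real ^ 'n::finite \<Rightarrow> real) \<Rightarrow> nat \<Rightarrow> real ^ 'n \<Rightarrow> complex" where
  "dyadic_cutoff \<phi>0 j x = complex_of_real (if j = 0 then \<phi>0 x else \<phi>0 x - \<phi>0 (2 *\<^sub>R x))"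

definition unit_cutoff :: "(real ^ 'n::finite \<Rightarrow> real) \<Rightarrow> bool" where
  "unit_cutoff \<phi>0 \<longleftrightarrow>
    smooth \<phi>0 \<and> (\<forall>x. norm x \<le> 1 \<longrightarrow> \<phi>0 x = 1) \<and> (\<forall>x. norm x \<ge> 3 / 2 \<longrightarrow> \<phi>0 x = 0)"

lemma dyadic_cutoff_zero: "unit_cutoff \<phi>0 \<Longrightarrow> norm x \<ge> 3 / 2 \<Longrightarrow> dyadic_cutoff \<phi>0 j x = 0"
  by (auto simp: dyadic_cutoff_def unit_cutoff_def)

lemma supp_dyadic_cutoff:
  fixes \<phi>0 :: "real ^ 'n::finite \<Rightarrow> real"
  assumes \<phi>0: "unit_cutoff \<phi>0" and x: "x \<in> supp (dyadic_cutoff \<phi>0 j)"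
  shows "norm x \<le> 3 / 2" and "j > 0 \<Longrightarrow> norm x \<ge> 1 / 2"
proof -
  have "supp (dyadic_cutoff \<phi>0 j) \<subseteq> cball 0 (3 / 2)"
    unfolding supp_def
  proof (rule closure_minimal)
    show "{x. dyadic_cutoff \<phi>0 j x \<noteq> 0} \<subseteq> cball 0 (3 / 2)"
      using dyadic_cutoff_zero[OF \<phi>0] by (auto simp: not_le[symmetric]) (metis less_imp_le not_le)
  qed simp
  then show "norm x \<le> 3 / 2" using x by auto
  assume j: "j > 0"
  have "supp (dyadic_cutoff \<phi>0 j) \<subseteq> - ball 0 (1 / 2)"
    unfolding supp_def
  proof (rule closure_minimal)
    have "dyadic_cutoff \<phi>0 j x = 0" if "norm x < 1 / 2" for x
      using that j \<phi>0 by (simp add: dyadic_cutoff_def unit_cutoff_def)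
    then show "{x. dyadic_cutoff \<phi>0 j x \<noteq> 0} \<subseteq> - ball 0 (1 / 2)" by auto
    show "closed (- ball 0 (1 / 2) :: (real ^ 'n) set)" by (intro closed_Compl open_ball)
  qed
  then show "norm x \<ge> 1 / 2" using x by auto
qed

lemma smooth_dyadic_cutoff:
  assumes "unit_cutoff \<phi>0" shows "smooth (dyadic_cutoff \<phi>0 j)"
proof -
  have s: "smooth \<phi>0" using assms by (simp add: unit_cutoff_def)
  have "smooth (\<lambda>x. \<phi>0 (2 *\<^sub>R x))" using smooth_affine[OF s, of 2 0] by simp
  then show ?thesis
    unfolding dyadic_cutoff_def[abs_def]
    by (cases "j = 0") (auto intro!: smooth_bounded_linear[OF bounded_linear_of_real] smooth_diff s)
qed

lemma dyadic_cutoff_schwartz: "unit_cutoff \<phi>0 \<Longrightarrow> dyadic_cutoff \<phi>0 j \<in> schwartz"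
  by (intro smooth_compact_support_schwartz smooth_dyadic_cutoff boundedI[of _ "3 / 2"] supp_dyadic_cutoff)

lemma dyadic_cutoff_telescope:
  "(\<Sum>j\<le>N. dyadic_cutoff \<phi>0 j ((1 / 2 ^ j) *\<^sub>R \<xi>)) = complex_of_real (\<phi>0 ((1 / 2 ^ N) *\<^sub>R \<xi>))"
  by (induction N) (simp_all add: dyadic_cutoff_def)

text \<open>What remains of \<open>G\<close> after multiplication by the inverse transform of
  \<open>Phi_jm\<close>, apart from constants and the phase of the lattice point.\<close>

definition quark_symbol ::
    "(real ^ 'n::finite \<Rightarrow> real) \<Rightarrow> (real ^ 'n \<Rightarrow> complex) \<Rightarrow> nat ^ 'n \<Rightarrow> nat \<Rightarrow> real ^ 'n \<Rightarrow> complex" where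
  "quark_symbol \<phi>0 G \<beta> j \<xi> =
    G \<xi> * (monomial \<beta> ((1 / 2 ^ j) *\<^sub>R \<xi>) * dyadic_cutoff \<phi>0 j ((1 / 2 ^ j) *\<^sub>R \<xi>))"

text \<open>For j > 0 the support of the symbol satisfies 2^j <= 2 |\<xi>|. The factor 2^(j K) is
  thus paid for by K more powers of decay of \<open>G\<close>. The base 3/2 is the radius of the
  support of the cut-offs.\<close>

lemma
  fixes \<phi>0 :: "real ^ 'n::finite \<Rightarrow> real"
  assumes \<phi>0: "unit_cutoff \<phi>0"
    and G: "G \<in> schwartz"
  shows quark_symbol_schwartz: "quark_symbol \<phi>0 G \<beta> j \<in> schwartz"
    and quark_symbol_bound: "\<exists>C\<ge>0. \<forall>\<beta> j ls \<xi>. length ls \<le> N \<longrightarrow>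
      2 ^ (j * K) * ((1 + norm \<xi>) ^ P * norm (partials ls (quark_symbol \<phi>0 G \<beta> j) \<xi>)) \<le>
        C * (1 + real (mi_abs \<beta>)) ^ N * (3 / 2) ^ mi_abs \<beta>"
proof -
  let ?H = "\<lambda>\<beta> j \<eta>. monomial \<beta> \<eta> * dyadic_cutoff \<phi>0 j \<eta>"
  let ?S = "\<lambda>\<beta> j \<xi>. ?H \<beta> j ((1 / 2 ^ j) *\<^sub>R \<xi> + 0)"
  have cut: "dyadic_cutoff \<phi>0 j \<in> schwartz" for j
    by (intro dyadic_cutoff_schwartz \<phi>0)
  have Hs: "?H \<beta> j \<in> schwartz" for \<beta> j
  proof (rule smooth_compact_support_schwartz)
    show "smooth (?H \<beta> j)" by (intro smooth_mult smooth_monomial smooth_dyadic_cutoff \<phi>0)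
    have "norm x \<le> 3 / 2" if "x \<in> supp (?H \<beta> j)" for x
      using that supp_dyadic_cutoff(1)[OF \<phi>0] subsetD[OF supp_mult_subset] by blast
    then show "bounded (supp (?H \<beta> j))" by (rule boundedI)
  qed
  have Ss: "?S \<beta> j \<in> schwartz" for \<beta> j by (intro schwartz_affine Hs) simp
  have W: "quark_symbol \<phi>0 G \<beta> j = (\<lambda>\<xi>. G \<xi> * ?S \<beta> j \<xi>)" for \<beta> j
    by (simp add: quark_symbol_def fun_eq_iff)
  show "quark_symbol \<phi>0 G \<beta> j \<in> schwartz"
    unfolding W by (intro schwartz_mult schwartz_imp_slowly_increasing G Ss)
  obtain A where A: "A \<ge> 0" "\<And>a \<xi>. length a \<le> N \<Longrightarrow> (1 + norm \<xi>) ^ (P + K) * norm (partials a G \<xi>) \<le> A"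
    using schwartz_bound_uniform[OF G, of N "P + K"] by blast
  have cutS: "norm x \<le> 3 / 2" if "x \<in> supp (dyadic_cutoff \<phi>0 j)" for j x
    by (rule supp_dyadic_cutoff(1)[OF \<phi>0 that])
  obtain B0 where B0: "B0 \<ge> 0" "\<And>\<beta> ls x. length ls \<le> N \<Longrightarrow>
      norm (partials ls (?H \<beta> 0) x) \<le> B0 * (1 + real (mi_abs \<beta>)) ^ N * (3 / 2) ^ mi_abs \<beta>"
    using partials_monomial_mult_bound[OF cut[of 0], of "3 / 2" N] cutS by auto
  obtain B1 where B1: "B1 \<ge> 0" "\<And>\<beta> ls x. length ls \<le> N \<Longrightarrow>
      norm (partials ls (?H \<beta> 1) x) \<le> B1 * (1 + real (mi_abs \<beta>)) ^ N * (3 / 2) ^ mi_abs \<beta>"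
    using partials_monomial_mult_bound[OF cut[of 1], of "3 / 2" N] cutS by auto
  \<comment> \<open>Before dilation there are only two different cut-offs, one for j = 0 and one for
    all j > 0; the sum of their bounds serves every j.\<close>
  define B where "B = B0 + B1"
  have B: "B \<ge> 0" "norm (partials ls (?H \<beta> j) x) \<le> B * (1 + real (mi_abs \<beta>)) ^ N * (3 / 2) ^ mi_abs \<beta>"
    if "length ls \<le> N" for \<beta> j ls x
  proof -
    show "B \<ge> 0" using B0 B1 by (simp add: B_def)
    have mono: "b * (1 + real (mi_abs \<beta>)) ^ N * (3 / 2) ^ mi_abs \<beta> \<le> B * (1 + real (mi_abs \<beta>)) ^ N * (3 / 2) ^ mi_abs \<beta>"
      if "b \<le> B" for b
      using that by (intro mult_right_mono) auto
    show "norm (partials ls (?H \<beta> j) x) \<le> B * (1 + real (mi_abs \<beta>)) ^ N * (3 / 2) ^ mi_abs \<beta>"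
    proof (cases "j = 0")
      case True
      then show ?thesis using order_trans[OF B0(2)[OF that] mono[of B0]] B1(1) by (simp add: B_def)
    next
      case False
      then have "dyadic_cutoff \<phi>0 j = dyadic_cutoff \<phi>0 1" by (simp add: dyadic_cutoff_def fun_eq_iff)
      then show ?thesis using order_trans[OF B1(2)[OF that] mono[of B1]] B0(1) by (simp add: B_def)
    qed
  qed
  have "2 ^ (j * K) * ((1 + norm \<xi>) ^ P * norm (partials ls (quark_symbol \<phi>0 G \<beta> j) \<xi>)) \<le>
      (2 ^ N * 2 ^ K * A * B) * (1 + real (mi_abs \<beta>)) ^ N * (3 / 2) ^ mi_abs \<beta>"
    if ls: "length ls \<le> N" for \<beta> j ls \<xi>
  proof (cases "\<xi> \<in> supp (quark_symbol \<phi>0 G \<beta> j)")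
    case False
    then show ?thesis using partials_outside_supp[OF False, of ls] A B(1)[of "[]"] by simp
  next
    case True
    let ?D = "B * (1 + real (mi_abs \<beta>)) ^ N * (3 / 2) ^ mi_abs \<beta>"
    have p: "1 + norm \<xi> > 0" by (simp add: add_pos_nonneg)
    have sG: "norm (partials a G \<xi>) \<le> A / (1 + norm \<xi>) ^ (P + K)" if "length a \<le> length ls" for a
      using A(2)[of a \<xi>] that ls p by (simp add: pos_le_divide_eq mult.commute)
    have sS: "norm (partials b (?S \<beta> j) \<xi>) \<le> ?D" if "length b \<le> length ls" for b
    proof -
      \<comment> \<open>Dilation by 2^{-j} only shrinks derivatives, so the undilated bound remains
        valid for all j.\<close>
      have "norm (partials b (?S \<beta> j) \<xi>) = (1 / 2 ^ j) ^ length b * norm (partials b (?H \<beta> j) ((1 / 2 ^ j) *\<^sub>R \<xi> + 0))"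
        by (subst partials_affine[OF schwartz_smooth[OF Hs]]) simp
      also have "\<dots> \<le> 1 * ?D"
        using that ls by (intro mult_mono B(2) power_le_one) auto
      finally show ?thesis by simp
    qed
    have "norm (partials ls (quark_symbol \<phi>0 G \<beta> j) \<xi>) \<le> 2 ^ length ls * (A / (1 + norm \<xi>) ^ (P + K) * ?D)"
      unfolding W by (rule norm_partials_mult_le[OF schwartz_smooth[OF G] schwartz_smooth[OF Ss] sG sS])
    also have "\<dots> \<le> 2 ^ N * (A / (1 + norm \<xi>) ^ (P + K) * ?D)"
      using ls A(1) B(1)[of "[]"] p by (intro mult_right_mono power_increasing) auto
    finally have 1: "norm (partials ls (quark_symbol \<phi>0 G \<beta> j) \<xi>) \<le> 2 ^ N * A * ?D / (1 + norm \<xi>) ^ (P + K)"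
      by simp
    have "(2 :: real) ^ j \<le> 2 * (1 + norm \<xi>)"
    proof (cases "j = 0")
      case False
      have "\<xi> \<in> supp (\<lambda>\<xi>. ?H \<beta> j ((1 / 2 ^ j) *\<^sub>R \<xi>))"
        using True unfolding W add_0_right by (rule subsetD[OF supp_mult_subset])
      then have "(1 / 2 ^ j) *\<^sub>R \<xi> \<in> supp (?H \<beta> j)"
        using subsetD[OF supp_comp_scaleR_subset[of "?H \<beta> j" "1 / 2 ^ j"]] by blast
      then have "(1 / 2 ^ j) *\<^sub>R \<xi> \<in> supp (dyadic_cutoff \<phi>0 j)" by (rule subsetD[OF supp_mult_subset])
      then have "norm ((1 / 2 ^ j) *\<^sub>R \<xi>) \<ge> 1 / 2"
        using supp_dyadic_cutoff(2)[OF \<phi>0] False by blast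
      then have "2 ^ j \<le> 2 * norm \<xi>" by (simp add: field_simps)
      then show ?thesis by simp
    qed (simp add: add_increasing2)
    then have "((2 :: real) ^ j) ^ K \<le> (2 * (1 + norm \<xi>)) ^ K" by (intro power_mono) auto
    then have 2: "2 ^ (j * K) \<le> 2 ^ K * (1 + norm \<xi>) ^ K" by (simp only: power_mult power_mult_distrib)
    have "2 ^ (j * K) * ((1 + norm \<xi>) ^ P * norm (partials ls (quark_symbol \<phi>0 G \<beta> j) \<xi>)) \<le>
        (2 ^ K * (1 + norm \<xi>) ^ K) * ((1 + norm \<xi>) ^ P * (2 ^ N * A * ?D / (1 + norm \<xi>) ^ (P + K)))"
      by (intro mult_mono 2 mult_left_mono 1) auto
    also have "\<dots> = (2 ^ N * 2 ^ K * A * B) * (1 + real (mi_abs \<beta>)) ^ N * (3 / 2) ^ mi_abs \<beta>"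
      using p by (simp add: power_add)
    finally show ?thesis .
  qed
  then show "\<exists>C\<ge>0. \<forall>\<beta> j ls \<xi>. length ls \<le> N \<longrightarrow>
      2 ^ (j * K) * ((1 + norm \<xi>) ^ P * norm (partials ls (quark_symbol \<phi>0 G \<beta> j) \<xi>)) \<le>
        C * (1 + real (mi_abs \<beta>)) ^ N * (3 / 2) ^ mi_abs \<beta>"
    using A(1) B(1)[of "[]"] by (intro exI[of _ "2 ^ N * 2 ^ K * A * B"]) auto
qed

lemma quark_factor_bound:
  "\<exists>C\<ge>0. \<forall>\<beta> :: nat ^ 'n::finite. norm (quark_factor J \<beta>) * ((1 + real (mi_abs \<beta>)) ^ N * (3 / 2) ^ mi_abs \<beta>) \<le> C"
proof -
  \<comment> \<open>Collects the geometric factors: 2^J from the quark factor, 3/2 from the symbol,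
    and e from (1 + |\<beta>|)^N <= N! e^(1 + |\<beta>|). Then a^|\<beta>| / \<beta>! is a product
    over coordinates, each factor at most e^a.\<close>
  define a where "a = 2 ^ J * (3 / 2) * exp (1 :: real)"
  have a: "a \<ge> 0" by (simp add: a_def)
  have "norm (quark_factor J \<beta>) * ((1 + real (mi_abs \<beta>)) ^ N * (3 / 2) ^ mi_abs \<beta>) \<le> fact N * exp 1 * exp a ^ CARD('n)"
    for \<beta> :: "nat ^ 'n"
  proof -
    let ?b = "mi_abs \<beta>"
    have f: "mi_fact \<beta> > 0" unfolding mi_fact_def by (intro prod_pos) simp
    have q: "norm (quark_factor J \<beta>) = (2 ^ J) ^ ?b / mi_fact \<beta>"
      using f unfolding quark_factor_def by (simp add: norm_mult norm_divide norm_power power_mult)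
    have "(1 + real ?b) ^ N \<le> fact N * exp (1 + real ?b)" by (rule power_le_fact_exp) simp
    also have "exp (1 + real ?b) = exp 1 * exp 1 ^ ?b"
      using exp_of_nat_mult[of ?b "1 :: real"] by (simp add: exp_add)
    finally have "(2 ^ J) ^ ?b / mi_fact \<beta> * ((1 + real ?b) ^ N * (3 / 2) ^ ?b) \<le>
        (2 ^ J) ^ ?b / mi_fact \<beta> * ((fact N * (exp 1 * exp 1 ^ ?b)) * (3 / 2) ^ ?b)"
      using f by (intro mult_left_mono mult_right_mono) auto
    also have "(2 ^ J) ^ ?b / mi_fact \<beta> * ((fact N * (exp 1 * exp 1 ^ ?b)) * (3 / 2) ^ ?b) =
        fact N * exp 1 * (a ^ ?b / mi_fact \<beta>)"
      unfolding a_def power_mult_distrib by (simp only: mult_ac times_divide_eq_right times_divide_eq_left)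
    also have "a ^ ?b / mi_fact \<beta> = (\<Prod>l\<in>UNIV. a ^ (\<beta> $ l) / fact (\<beta> $ l))"
      by (simp add: mi_abs_def mi_fact_def power_sum prod_dividef)
    also have "\<dots> \<le> (\<Prod>l\<in>(UNIV :: 'n set). exp a)"
    proof (intro prod_mono conjI)
      show "a ^ (\<beta> $ l) / fact (\<beta> $ l) \<le> exp a" for l
        using power_le_fact_exp[OF a, of "\<beta> $ l"] by (simp add: divide_le_eq mult.commute)
    qed (use a in simp)
    finally show ?thesis unfolding q by simp
  qed
  then show ?thesis by (intro exI[of _ "fact N * exp 1 * exp a ^ CARD('n)"]) auto
qed

text \<open>Evaluating the Fourier decay at 2^{-j} m produces exactly the weight of the sequence
  space. N derivatives of the symbol give the N-th power, and 2n additional powers of decay make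
  their integrals finite, uniformly in \<beta> and j once the quark factor is included.\<close>

lemma quark_coefficients_rapidly_decreasing:
  fixes \<phi>0 :: "real ^ 'n::finite \<Rightarrow> real"
  assumes \<phi>0: "unit_cutoff \<phi>0"
    and G: "G \<in> schwartz"
  shows "rapidly_decreasing (\<lambda>\<beta> j m. quark_factor J \<beta> * inv_fourier (quark_symbol \<phi>0 G \<beta> j) ((1 / 2 ^ j) *\<^sub>R lattice_point m))"
  unfolding rapidly_decreasing_def
proof (intro allI)
  fix K N :: nat
  let ?P = "2 * CARD('n)" and ?n = "real CARD('n)"
  let ?k = "norm (complex_of_real ((2 * pi) powr (- real CARD('n) / 2)))"
  obtain A where A: "A \<ge> 0" "\<And>\<beta> j ls \<xi>. length ls \<le> N \<Longrightarrow>
      2 ^ (j * K) * ((1 + norm \<xi>) ^ ?P * norm (partials ls (quark_symbol \<phi>0 G \<beta> j) \<xi>)) \<le>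
        A * (1 + real (mi_abs \<beta>)) ^ N * (3 / 2) ^ mi_abs \<beta>"
    using quark_symbol_bound[OF \<phi>0 G] by blast
  obtain C where C: "C \<ge> 0" "\<And>\<beta> :: nat ^ 'n. norm (quark_factor J \<beta>) * ((1 + real (mi_abs \<beta>)) ^ N * (3 / 2) ^ mi_abs \<beta>) \<le> C"
    using quark_factor_bound by blast
  define I where "I = (\<integral>\<xi>. 1 / (1 + norm (\<xi> :: real ^ 'n)) ^ ?P \<partial>lborel)"
  have Ii: "integrable lborel (\<lambda>\<xi> :: real ^ 'n. 1 / (1 + norm \<xi>) ^ ?P)"
    by (rule integrable_of_decay[of _ 1]) (auto simp: add_pos_nonneg less_imp_neq[symmetric])
  have I0: "I \<ge> 0" unfolding I_def by (intro integral_nonneg_AE) auto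
  have "2 ^ (j * K) * (1 + norm (lattice_point m) / 2 ^ j) ^ N *
      norm (quark_factor J \<beta> * inv_fourier (quark_symbol \<phi>0 G \<beta> j) ((1 / 2 ^ j) *\<^sub>R lattice_point m))
      \<le> ?k * ((?n + 1) ^ N * ((?n + 1) * (A * I * C)))" for \<beta> :: "nat ^ 'n" and j and m :: "int ^ 'n"
  proof -
    let ?W = "quark_symbol \<phi>0 G \<beta> j" and ?y = "(1 / 2 ^ j) *\<^sub>R lattice_point m :: real ^ 'n"
    let ?D = "A * (1 + real (mi_abs \<beta>)) ^ N * (3 / 2) ^ mi_abs \<beta>"
    let ?q = "norm (quark_factor J \<beta>)"
    have W: "?W \<in> schwartz" by (rule quark_symbol_schwartz[OF \<phi>0 G])
    have int: "2 ^ (j * K) * (LBINT \<xi>. norm (partials ls ?W \<xi>)) \<le> ?D * I" if ls: "length ls \<le> N" for ls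
    proof -
      have "2 ^ (j * K) * (LBINT \<xi>. norm (partials ls ?W \<xi>)) = (LBINT \<xi>. 2 ^ (j * K) * norm (partials ls ?W \<xi>))"
        by simp
      also have "\<dots> \<le> (LBINT \<xi>. ?D * (1 / (1 + norm (\<xi> :: real ^ 'n)) ^ ?P))"
      proof (rule Bochner_Integration.integral_mono)
        show "integrable lborel (\<lambda>\<xi>. 2 ^ (j * K) * norm (partials ls ?W \<xi>))"
          by (intro integrable_mult_right integrable_norm schwartz_integrable schwartz_partials W)
        show "integrable lborel (\<lambda>\<xi> :: real ^ 'n. ?D * (1 / (1 + norm \<xi>) ^ ?P))"
          by (intro integrable_mult_right Ii)
        show "2 ^ (j * K) * norm (partials ls ?W \<xi>) \<le> ?D * (1 / (1 + norm \<xi>) ^ ?P)" for \<xi>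
        proof -
          have "(1 + norm \<xi>) ^ ?P > 0" by (simp add: add_pos_nonneg)
          then show ?thesis using A(2)[OF ls, of j \<xi> \<beta>] by (simp add: pos_le_divide_eq mult_ac)
        qed
      qed
      also have "\<dots> = ?D * I" unfolding I_def by (rule integral_mult_right_zero)
      finally show ?thesis .
    qed
    have "2 ^ (j * K) * ((1 + norm ?y) ^ N * norm (LBINT x. iexp (x \<bullet> ?y) * ?W x)) \<le>
        2 ^ (j * K) * ((?n + 1) ^ N * ((LBINT x. norm (?W x)) +
          (\<Sum>l\<in>UNIV. LBINT x. norm (partials (replicate N l) ?W x))))"
      using fourier_integral_decay[OF W, of ?y N] by (intro mult_left_mono) (auto simp: add.commute)
    also have "\<dots> = (?n + 1) ^ N * (2 ^ (j * K) * (LBINT x. norm (partials [] ?W x)) +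
          (\<Sum>l\<in>UNIV. 2 ^ (j * K) * (LBINT x. norm (partials (replicate N l) ?W x))))"
      by (simp add: algebra_simps sum_distrib_left)
    also have "\<dots> \<le> (?n + 1) ^ N * (?D * I + (\<Sum>l\<in>(UNIV :: 'n set). ?D * I))"
      by (intro mult_left_mono add_mono sum_mono int) auto
    also have "\<dots> = (?n + 1) ^ N * ((?n + 1) * (?D * I))" by (simp add: algebra_simps)
    finally have 1: "2 ^ (j * K) * ((1 + norm ?y) ^ N * norm (LBINT x. iexp (x \<bullet> ?y) * ?W x)) \<le>
        (?n + 1) ^ N * ((?n + 1) * (?D * I))" .
    have "2 ^ (j * K) * (1 + norm (lattice_point m) / 2 ^ j) ^ N * norm (quark_factor J \<beta> * inv_fourier ?W ?y) =
        (?k * ?q) * (2 ^ (j * K) * ((1 + norm ?y) ^ N * norm (LBINT x. iexp (x \<bullet> ?y) * ?W x)))"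
      unfolding inv_fourier_def norm_mult by (simp add: mult_ac)
    also have "\<dots> \<le> (?k * ?q) * ((?n + 1) ^ N * ((?n + 1) * (?D * I)))"
      by (rule mult_left_mono[OF 1]) simp
    also have "\<dots> = ?k * ((?n + 1) ^ N * ((?n + 1) * (A * I * (?q * ((1 + real (mi_abs \<beta>)) ^ N * (3 / 2) ^ mi_abs \<beta>)))))"
      by (simp only: mult_ac)
    also have "\<dots> \<le> ?k * ((?n + 1) ^ N * ((?n + 1) * (A * I * C)))"
      using A(1) I0 by (intro mult_left_mono C(2)) auto
    finally show ?thesis .
  qed
  then show "\<exists>C\<ge>0. \<forall>\<beta> j m. 2 ^ (j * K) * (1 + norm (lattice_point m) / 2 ^ j) ^ N *
      norm (quark_factor J \<beta> * inv_fourier (quark_symbol \<phi>0 G \<beta> j) ((1 / 2 ^ j) *\<^sub>R lattice_point m)) \<le> C"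
    using A(1) I0 C(1) by (intro exI[of _ "?k * ((?n + 1) ^ N * ((?n + 1) * (A * I * C)))"]) auto
qed

text \<open>Inversion writes \<open>g\<close> as an inverse transform, and the multiplication
  formula moves the integral to the frequency side. There the Jacobian 2^{-j n} of the dilation
  cancels the factor 2^{j n} in \<open>quark_coeff\<close>.\<close>

lemma quark_coeff_schwartz:
  fixes k \<omega> \<phi>0 :: "real ^ 'n::finite \<Rightarrow> real"
  assumes \<omega>: "smooth \<omega>" "supp \<omega> \<subseteq> {y. \<forall>l. - pi < y $ l \<and> y $ l < pi}" "\<And>x. norm x \<le> 2 \<Longrightarrow> \<omega> x = 1"
    and \<phi>0: "unit_cutoff \<phi>0"
    and \<Phi>F: "\<And>\<beta>. \<Phi>F \<beta> \<in> schwartz"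
      "\<And>\<beta>. inv_fourier (\<Phi>F \<beta>) = (\<lambda>x. complex_of_real (\<phi>0 x) * Omega_beta J \<omega> \<beta> x)"
    and \<Phi>M: "\<And>\<beta>. \<Phi>M \<beta> \<in> schwartz"
      "\<And>\<beta>. inv_fourier (\<Phi>M \<beta>) = (\<lambda>x. complex_of_real (\<phi>0 x - \<phi>0 (2 *\<^sub>R x)) * Omega_beta J \<omega> \<beta> x)"
    and g: "g \<in> schwartz" and f: "\<And>\<phi>. \<phi> \<in> schwartz \<Longrightarrow> f \<phi> = regular_distribution g \<phi>"
  shows "quark_coeff \<Phi>F \<Phi>M f \<beta> j m = quark_factor J \<beta> *
    inv_fourier (quark_symbol \<phi>0 (\<lambda>\<xi>. inv_fourier g (- \<xi>)) \<beta> j) ((1 / 2 ^ j) *\<^sub>R lattice_point m)"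
proof -
  let ?G = "\<lambda>\<xi>. inv_fourier g (- \<xi>)"
  let ?c = "complex_of_real (1 / sqrt (2 * pi) ^ CARD('n))" and ?n = "CARD('n)"
  let ?y = "(1 / 2 ^ j) *\<^sub>R lattice_point m :: real ^ 'n"
  define \<Phi> where "\<Phi> = (if j = 0 then \<Phi>F \<beta> else \<Phi>M \<beta>)"
  have \<Phi>: "\<Phi> \<in> schwartz" using \<Phi>F(1) \<Phi>M(1) by (simp add: \<Phi>_def)
  have F\<Phi>: "inv_fourier \<Phi> \<eta> = ?c * quark_factor J \<beta> * (monomial \<beta> \<eta> * dyadic_cutoff \<phi>0 j \<eta>)" for \<eta>
  proof -
    have "inv_fourier \<Phi> \<eta> = dyadic_cutoff \<phi>0 j \<eta> * Omega_beta J \<omega> \<beta> \<eta>"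
      by (simp add: \<Phi>_def dyadic_cutoff_def \<Phi>F(2) \<Phi>M(2))
    also have "\<dots> = dyadic_cutoff \<phi>0 j \<eta> * (?c * (quark_factor J \<beta> * monomial \<beta> \<eta>))"
    \<comment> \<open>The closed form of \<open>Omega_beta\<close> is available only in the ball of
      radius 2; outside it the cut-off vanishes.\<close>
    proof (cases "norm \<eta> \<le> 2")
      case True
      have "Omega_beta J \<omega> \<beta> \<eta> = ?c * (quark_factor J \<beta> * monomial \<beta> \<eta>)"
        by (rule Omega_beta_eq[of \<omega>, OF \<omega> True])
      then show ?thesis by (rule arg_cong)
    next
      case False
      then have "dyadic_cutoff \<phi>0 j \<eta> = 0" by (intro dyadic_cutoff_zero[OF \<phi>0]) auto
      then show ?thesis by simp
    qed
    finally show ?thesis by (simp only: mult_ac)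
  qed
  have \<Phi>jm: "Phi_jm \<Phi>F \<Phi>M \<beta> j m = (\<lambda>x. \<Phi> (2 ^ j *\<^sub>R x - lattice_point m))"
    by (auto simp: Phi_jm_def \<Phi>_def fun_eq_iff)
  have \<Phi>s: "(\<lambda>x. \<Phi> (2 ^ j *\<^sub>R x - lattice_point m)) \<in> schwartz"
    using schwartz_affine[OF \<Phi>, of "2 ^ j" "- lattice_point m"] by simp
  have G: "?G \<in> schwartz" by (rule inv_fourier_reflect_schwartz[OF g])
  have F\<Phi>jm: "inv_fourier (\<lambda>x. \<Phi> (2 ^ j *\<^sub>R x - lattice_point m)) \<xi> =
      1 / 2 ^ (j * ?n) * iexp (\<xi> \<bullet> ?y) * inv_fourier \<Phi> ((1 / 2 ^ j) *\<^sub>R \<xi>)" for \<xi>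
    using inv_fourier_affine[OF \<Phi>, of "2 ^ j" "lattice_point m" \<xi>] by (simp add: power_mult)
  have "f (Phi_jm \<Phi>F \<Phi>M \<beta> j m) = (LBINT x. inv_fourier ?G x * \<Phi> (2 ^ j *\<^sub>R x - lattice_point m))"
    unfolding \<Phi>jm f[OF \<Phi>s] regular_distribution_def fourier_inversion[OF g] ..
  also have "\<dots> = (LBINT \<xi>. ?G \<xi> * inv_fourier (\<lambda>x. \<Phi> (2 ^ j *\<^sub>R x - lattice_point m)) \<xi>)"
    by (intro inv_fourier_multiplication schwartz_integrable G \<Phi>s)
  also have "\<dots> = (LBINT \<xi>. (1 / 2 ^ (j * ?n) * ?c * quark_factor J \<beta>) *
      (iexp (\<xi> \<bullet> ?y) * quark_symbol \<phi>0 ?G \<beta> j \<xi>))"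
    unfolding F\<Phi>jm F\<Phi> quark_symbol_def by (simp only: mult_ac)
  also have "\<dots> = 1 / 2 ^ (j * ?n) * quark_factor J \<beta> * inv_fourier (quark_symbol \<phi>0 ?G \<beta> j) ?y"
    unfolding inv_fourier_def[of "quark_symbol \<phi>0 ?G \<beta> j"] powr_half_power integral_mult_right_zero
    by (simp only: mult_ac)
  finally show ?thesis unfolding quark_coeff_def by simp
qed

text \<open>The powers of 2^J in the quark factor and in the quark cancel, which leaves the Taylor
  series of the exponential of i (2^j x - m) . (2^{-j} \<xi>) under the integral. The cut-off
  confines 2^{-j} \<xi> to a ball, so for fixed x, j and m the series is dominated uniformly in
  \<xi>.\<close>

lemma quark_taylor_sum:
  fixes k \<phi>0 :: "real ^ 'n::finite \<Rightarrow> real"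
  assumes \<phi>0: "unit_cutoff \<phi>0"
    and G: "G \<in> schwartz"
  shows "((\<lambda>\<beta>. quark_factor J \<beta> * inv_fourier (quark_symbol \<phi>0 G \<beta> j) ((1 / 2 ^ j) *\<^sub>R lattice_point m) *
      quark_jm J k \<beta> j m x) has_sum
    complex_of_real (k (2 ^ j *\<^sub>R x - lattice_point m)) *
      inv_fourier (\<lambda>\<xi>. dyadic_cutoff \<phi>0 j ((1 / 2 ^ j) *\<^sub>R \<xi>) * G \<xi>) x) UNIV"
proof -
  define z where "z = 2 ^ j *\<^sub>R x - lattice_point m"
  let ?y = "(1 / 2 ^ j) *\<^sub>R lattice_point m :: real ^ 'n"
  let ?k = "complex_of_real ((2 * pi) powr (- real CARD('n) / 2))"
  let ?\<eta> = "\<lambda>\<xi>. (1 / 2 ^ j) *\<^sub>R \<xi> :: real ^ 'n"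
  let ?t = "\<lambda>\<xi> \<beta>. \<Prod>l\<in>UNIV. (\<i> * complex_of_real (z $ l * ?\<eta> \<xi> $ l)) ^ (\<beta> $ l) / fact (\<beta> $ l)"
  let ?v = "\<lambda>\<beta> \<xi>. dyadic_cutoff \<phi>0 j (?\<eta> \<xi>) * ?t \<xi> \<beta>"
  let ?e = "\<lambda>\<xi>. exp (\<Sum>l\<in>UNIV. \<i> * complex_of_real (z $ l * ?\<eta> \<xi> $ l))"
  \<comment> \<open>Argument of the majorant series: coordinates of 2^{-j} \<xi> are at most 3/2 in
    modulus where the cut-off does not vanish.\<close>
  let ?a = "\<lambda>l. complex_of_real (\<bar>z $ l\<bar> * (3 / 2))"
  have cut: "dyadic_cutoff \<phi>0 j \<in> schwartz" by (intro dyadic_cutoff_schwartz \<phi>0)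
  obtain B where B: "\<And>\<eta>. norm (dyadic_cutoff \<phi>0 j \<eta>) \<le> B"
    using schwartz_bound[OF cut, of 0 "[]"] by auto
  have B0: "B \<ge> 0" using order_trans[OF norm_ge_zero B[of 0]] .
  have Gi: "integrable lborel (\<lambda>\<xi>. iexp (\<xi> \<bullet> ?y) * G \<xi>)"
    by (intro integrable_iexp_mult schwartz_integrable G)
  have cutc: "continuous_on UNIV (\<lambda>\<xi>. dyadic_cutoff \<phi>0 j (?\<eta> \<xi>))"
    by (rule continuous_on_compose2[OF smooth_continuous[OF smooth_dyadic_cutoff[OF \<phi>0]]])
      (auto intro!: continuous_intros)
  have hs: "((\<lambda>\<beta>. LBINT \<xi>. ?v \<beta> \<xi> * (iexp (\<xi> \<bullet> ?y) * G \<xi>)) has_sum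
      (LBINT \<xi>. (dyadic_cutoff \<phi>0 j (?\<eta> \<xi>) * ?e \<xi>) * (iexp (\<xi> \<bullet> ?y) * G \<xi>))) UNIV"
  proof (rule has_sum_integral_mult[OF Gi])
    show "(\<lambda>\<beta> :: nat ^ 'n. B * norm (\<Prod>l\<in>UNIV. ?a l ^ (\<beta> $ l) / fact (\<beta> $ l))) summable_on UNIV"
      by (intro summable_on_cmult_right abs_summable_on_mi_exp)
    show "norm (?v \<beta> \<xi>) \<le> B * norm (\<Prod>l\<in>UNIV. ?a l ^ (\<beta> $ l) / fact (\<beta> $ l))" for \<beta> \<xi>
    proof (cases "norm (?\<eta> \<xi>) \<ge> 3 / 2")
      case True
      then show ?thesis using dyadic_cutoff_zero[OF \<phi>0] B0 by simp
    next
      case False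
      have "\<bar>?\<eta> \<xi> $ l\<bar> \<le> 3 / 2" for l using component_le_norm_cart[of "?\<eta> \<xi>" l] False by linarith
      then have le: "\<bar>z $ l * ?\<eta> \<xi> $ l\<bar> \<le> \<bar>z $ l\<bar> * (3 / 2)" for l
        unfolding abs_mult by (intro mult_left_mono) auto
      have "norm (?t \<xi> \<beta>) = (\<Prod>l\<in>UNIV. \<bar>z $ l * ?\<eta> \<xi> $ l\<bar> ^ (\<beta> $ l) / fact (\<beta> $ l))"
        unfolding prod_norm[symmetric] norm_divide norm_power norm_mult norm_of_real by simp
      also have "\<dots> \<le> (\<Prod>l\<in>UNIV. (\<bar>z $ l\<bar> * (3 / 2)) ^ (\<beta> $ l) / fact (\<beta> $ l))"
        by (intro prod_mono conjI divide_right_mono power_mono le) auto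
      also have "\<dots> = norm (\<Prod>l\<in>UNIV. ?a l ^ (\<beta> $ l) / fact (\<beta> $ l))"
        unfolding prod_norm[symmetric] norm_divide norm_power norm_of_real by (simp add: abs_mult)
      finally show ?thesis unfolding norm_mult by (intro mult_mono B B0) auto
    qed
    show "?v \<beta> \<in> borel_measurable borel" for \<beta>
      by (intro borel_measurable_continuous_onI continuous_intros cutc) auto
    show "(\<lambda>\<xi>. dyadic_cutoff \<phi>0 j (?\<eta> \<xi>) * ?e \<xi>) \<in> borel_measurable borel"
      by (intro borel_measurable_continuous_onI continuous_intros cutc)
    show "((\<lambda>\<beta>. ?v \<beta> \<xi>) has_sum dyadic_cutoff \<phi>0 j (?\<eta> \<xi>) * ?e \<xi>) UNIV" for \<xi>
      by (intro has_sum_cmult_right has_sum_mi_exp)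
  qed
  have "(\<lambda>\<xi>. (dyadic_cutoff \<phi>0 j (?\<eta> \<xi>) * ?e \<xi>) * (iexp (\<xi> \<bullet> ?y) * G \<xi>)) =
      (\<lambda>\<xi>. iexp (\<xi> \<bullet> x) * (dyadic_cutoff \<phi>0 j (?\<eta> \<xi>) * G \<xi>))"
  proof
    fix \<xi>
    \<comment> \<open>The lattice point drops out: its contribution to \<open>z\<close> is
      compensated by the phase of the coefficient.\<close>
    have "z \<bullet> ?\<eta> \<xi> + \<xi> \<bullet> ?y = \<xi> \<bullet> x"
      by (simp add: z_def inner_diff_left inner_diff_right inner_commute diff_divide_distrib)
    moreover have "?e \<xi> = iexp (z \<bullet> ?\<eta> \<xi>)"
      unfolding inner_vec_def inner_real_def of_real_sum sum_distrib_left ..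
    ultimately have "?e \<xi> * iexp (\<xi> \<bullet> ?y) = iexp (\<xi> \<bullet> x)"
      by (simp only: exp_add[symmetric] distrib_left[symmetric] of_real_add[symmetric])
    then show "(dyadic_cutoff \<phi>0 j (?\<eta> \<xi>) * ?e \<xi>) * (iexp (\<xi> \<bullet> ?y) * G \<xi>) =
        iexp (\<xi> \<bullet> x) * (dyadic_cutoff \<phi>0 j (?\<eta> \<xi>) * G \<xi>)"
    proof -
      have "(a * b) * (c * d) = (b * c) * (a * d)" for a b c d :: complex by (simp only: mult_ac)
      from this[of _ "?e \<xi>" "iexp (\<xi> \<bullet> ?y)"] show ?thesis
        unfolding \<open>?e \<xi> * iexp (\<xi> \<bullet> ?y) = iexp (\<xi> \<bullet> x)\<close> .
    qed
  qed
  then have "((\<lambda>\<beta>. complex_of_real (k z) * (?k * (LBINT \<xi>. ?v \<beta> \<xi> * (iexp (\<xi> \<bullet> ?y) * G \<xi>)))) has_sum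
      complex_of_real (k z) * inv_fourier (\<lambda>\<xi>. dyadic_cutoff \<phi>0 j (?\<eta> \<xi>) * G \<xi>) x) UNIV"
    unfolding inv_fourier_def using hs by (intro has_sum_cmult_right) simp
  moreover have "complex_of_real (k z) * (?k * (LBINT \<xi>. ?v \<beta> \<xi> * (iexp (\<xi> \<bullet> ?y) * G \<xi>))) =
      quark_factor J \<beta> * inv_fourier (quark_symbol \<phi>0 G \<beta> j) ?y * quark_jm J k \<beta> j m x" for \<beta>
  proof -
    have f: "mi_fact \<beta> \<noteq> 0" unfolding mi_fact_def by simp
    have t: "(\<Prod>l\<in>UNIV. (\<i> * complex_of_real (z $ l * w $ l)) ^ (\<beta> $ l) / fact (\<beta> $ l)) =
        \<i> ^ mi_abs \<beta> * complex_of_real (mi_power z \<beta> / mi_fact \<beta>) * monomial \<beta> w" for w :: "real ^ 'n"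
      unfolding monomial_altdef mi_abs_def mi_fact_def mi_power_def
      by (simp add: power_mult_distrib prod.distrib prod_dividef power_sum)
    have q: "quark_factor J \<beta> * quark_jm J k \<beta> j m x =
        \<i> ^ mi_abs \<beta> * complex_of_real (mi_power z \<beta> / mi_fact \<beta>) * complex_of_real (k z)"
    proof -
      have "mi_power ((1 / 2 ^ J) *\<^sub>R z) \<beta> = mi_power z \<beta> / 2 ^ (J * mi_abs \<beta>)"
        unfolding mi_power_def mi_abs_def
        by (simp add: power_divide prod_dividef power_mult power_sum)
      then show ?thesis
        using f by (simp add: quark_factor_def quark_jm_def quark_def z_def[symmetric])
    qed
    have "(LBINT \<xi>. ?v \<beta> \<xi> * (iexp (\<xi> \<bullet> ?y) * G \<xi>)) =
        (LBINT \<xi>. (\<i> ^ mi_abs \<beta> * complex_of_real (mi_power z \<beta> / mi_fact \<beta>)) * (iexp (\<xi> \<bullet> ?y) * quark_symbol \<phi>0 G \<beta> j \<xi>))"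
      unfolding t quark_symbol_def by (simp only: mult_ac)
    also have "\<dots> = (\<i> ^ mi_abs \<beta> * complex_of_real (mi_power z \<beta> / mi_fact \<beta>)) * (LBINT \<xi>. iexp (\<xi> \<bullet> ?y) * quark_symbol \<phi>0 G \<beta> j \<xi>)"
      by (rule integral_mult_right_zero)
    finally have i: "(LBINT \<xi>. ?v \<beta> \<xi> * (iexp (\<xi> \<bullet> ?y) * G \<xi>)) = \<dots>" .
    have "quark_factor J \<beta> * inv_fourier (quark_symbol \<phi>0 G \<beta> j) ?y * quark_jm J k \<beta> j m x =
        (quark_factor J \<beta> * quark_jm J k \<beta> j m x) * inv_fourier (quark_symbol \<phi>0 G \<beta> j) ?y"
      by (simp only: mult_ac)
    then show ?thesis unfolding i q inv_fourier_def by (simp only: mult_ac)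
  qed
  ultimately show ?thesis by (simp only: z_def)
qed

text \<open>Rapid decrease already guarantees the unordered triple sum, so its value may be computed
  by iterated sums. Only the limit over j remains, and it is taken on the frequency side.\<close>

lemma quark_reconstruction:
  fixes k \<phi>0 :: "real ^ 'n::finite \<Rightarrow> real"
  assumes k: "smooth k" and supp: "supp k \<subseteq> {y. norm y < 2 ^ J}"
    and partition: "\<And>x. ((\<lambda>m. k (x - lattice_point m)) has_sum 1) UNIV"
    and \<phi>0: "unit_cutoff \<phi>0"
    and g: "g \<in> schwartz"
  defines "\<mu> \<equiv> \<lambda>\<beta> j m. quark_factor J \<beta> *
    inv_fourier (quark_symbol \<phi>0 (\<lambda>\<xi>. inv_fourier g (- \<xi>)) \<beta> j) ((1 / 2 ^ j) *\<^sub>R lattice_point m)"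
  shows "(\<Sum>\<^sub>\<infinity>i. (case i of (\<beta>, j, m) \<Rightarrow> \<lambda>x. \<mu> \<beta> j m * quark_jm J k \<beta> j m x) x) = g x"
proof -
  let ?G = "\<lambda>\<xi>. inv_fourier g (- \<xi>)"
  let ?v = "\<lambda>(\<beta>, j, m) x. \<mu> \<beta> j m * quark_jm J k \<beta> j m x"
  let ?S = "\<Sum>\<^sub>\<infinity>i. ?v i x"
  have G: "?G \<in> schwartz" by (rule inv_fourier_reflect_schwartz[OF g])
  have \<mu>: "rapidly_decreasing \<mu>"
    unfolding \<mu>_def by (rule quark_coefficients_rapidly_decreasing[OF \<phi>0 G])
  let ?g = "\<lambda>j. inv_fourier (\<lambda>\<xi>. dyadic_cutoff \<phi>0 j ((1 / 2 ^ j) *\<^sub>R \<xi>) * ?G \<xi>) x"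
  have "((\<lambda>i. ?v i x) has_sum ?S) UNIV"
    by (rule quark_series_has_sum[OF k supp \<mu>])
  \<comment> \<open>The multi-index goes innermost, because the sum over \<beta> has a closed form
    for each fixed (j, m).\<close>
  then have "((\<lambda>((j, m), \<beta>). ?v (\<beta>, j, m) x) has_sum ?S) UNIV"
    by (subst has_sum_reindex_bij_witness[of UNIV "\<lambda>(\<beta>, j, m). ((j, m), \<beta>)" "\<lambda>((j, m), \<beta>). (\<beta>, j, m)" UNIV]) auto
  then have "((\<lambda>(p, \<beta>). ?v (\<beta>, fst p, snd p) x) has_sum ?S) (Sigma UNIV (\<lambda>_. UNIV))"
    by (simp add: case_prod_unfold)
  then have "((\<lambda>p. complex_of_real (k (2 ^ fst p *\<^sub>R x - lattice_point (snd p))) * ?g (fst p)) has_sum ?S) UNIV"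
  proof (rule has_sum_SigmaD)
    fix p :: "nat \<times> (int ^ 'n)"
    show "((\<lambda>\<beta>. case (p, \<beta>) of (p, \<beta>) \<Rightarrow> ?v (\<beta>, fst p, snd p) x) has_sum
        complex_of_real (k (2 ^ fst p *\<^sub>R x - lattice_point (snd p))) * ?g (fst p)) UNIV"
      using quark_taylor_sum[OF \<phi>0 G, of J "fst p" "snd p" k x]
      by (simp add: \<mu>_def case_prod_unfold)
  qed
  then have "((\<lambda>(j, m). complex_of_real (k (2 ^ j *\<^sub>R x - lattice_point m)) * ?g j) has_sum ?S) (Sigma UNIV (\<lambda>_. UNIV))"
    by (simp add: case_prod_unfold)
  then have "(?g has_sum ?S) UNIV"
  proof (rule has_sum_SigmaD)
    fix j :: nat
    have "((\<lambda>m. complex_of_real (k (2 ^ j *\<^sub>R x - lattice_point m)) * ?g j) has_sum complex_of_real 1 * ?g j) UNIV"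
      by (intro has_sum_cmult_left has_sum_of_real partition)
    then show "((\<lambda>m. case (j, m) of (j, m) \<Rightarrow> complex_of_real (k (2 ^ j *\<^sub>R x - lattice_point m)) * ?g j) has_sum ?g j) UNIV"
      by simp
  qed
  then have "?g sums ?S" by (rule has_sum_imp_sums)
  then have lim1: "(\<lambda>N. \<Sum>j\<le>N. ?g j) \<longlonglongrightarrow> ?S" by (simp add: sums_def_le)
  \<comment> \<open>At level 0 the dyadic cut-off is \<open>\<phi>0\<close> itself, so
    \<open>B\<close> also bounds the telescoped cut-offs in the dominated convergence below.\<close>
  obtain B where B: "\<And>\<eta>. norm (dyadic_cutoff \<phi>0 0 \<eta>) \<le> B"
    using schwartz_bound[OF dyadic_cutoff_schwartz[OF \<phi>0], of 0 "[]"] by auto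
  let ?k = "complex_of_real ((2 * pi) powr (- real CARD('n) / 2))"
  have \<phi>0': "smooth \<phi>0" "\<phi>0 0 = 1" using \<phi>0 by (auto simp: unit_cutoff_def)
  note [measurable] = smooth_measurable[OF \<phi>0'(1)] schwartz_measurable[OF G]
  have int: "integrable lborel (\<lambda>\<xi>. dyadic_cutoff \<phi>0 j ((1 / 2 ^ j) *\<^sub>R \<xi>) * ?G \<xi>)" for j
  proof -
    have "(\<lambda>\<xi>. dyadic_cutoff \<phi>0 j ((1 / 2 ^ j) *\<^sub>R \<xi> + 0)) \<in> schwartz"
      by (intro schwartz_affine dyadic_cutoff_schwartz \<phi>0) simp_all
    then show ?thesis
      using schwartz_integrable[OF schwartz_mult[OF schwartz_imp_slowly_increasing G]] by fastforce
  qed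
  \<comment> \<open>The dyadic cut-offs telescope to \<open>\<phi>0\<close> at 2^{-N} \<xi>, which
    tends to \<open>\<phi>0 0 = 1\<close> for every \<xi>.\<close>
  have "(\<Sum>j\<le>N. ?g j) = ?k * (LBINT \<xi>. iexp (\<xi> \<bullet> x) * (complex_of_real (\<phi>0 ((1 / 2 ^ N) *\<^sub>R \<xi>)) * ?G \<xi>))" for N
  proof -
    have "(\<Sum>j\<le>N. ?g j) = ?k * (\<Sum>j\<le>N. LBINT \<xi>. iexp (\<xi> \<bullet> x) * (dyadic_cutoff \<phi>0 j ((1 / 2 ^ j) *\<^sub>R \<xi>) * ?G \<xi>))"
      unfolding sum_distrib_left by (intro sum.cong refl inv_fourier_def)
    also have "(\<Sum>j\<le>N. LBINT \<xi>. iexp (\<xi> \<bullet> x) * (dyadic_cutoff \<phi>0 j ((1 / 2 ^ j) *\<^sub>R \<xi>) * ?G \<xi>)) =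
        (\<integral>\<xi>. (\<Sum>j\<le>N. iexp (\<xi> \<bullet> x) * (dyadic_cutoff \<phi>0 j ((1 / 2 ^ j) *\<^sub>R \<xi>) * ?G \<xi>)) \<partial>lborel)"
      by (intro Bochner_Integration.integral_sum[symmetric] integrable_iexp_mult int)
    finally show ?thesis
      unfolding sum_distrib_left[symmetric] sum_distrib_right[symmetric] dyadic_cutoff_telescope .
  qed
  moreover have "(\<lambda>N. ?k * (LBINT \<xi>. iexp (\<xi> \<bullet> x) * (complex_of_real (\<phi>0 ((1 / 2 ^ N) *\<^sub>R \<xi>)) * ?G \<xi>))) \<longlonglongrightarrow>
      ?k * (LBINT \<xi>. iexp (\<xi> \<bullet> x) * (complex_of_real 1 * ?G \<xi>))"
  proof (intro tendsto_mult tendsto_const integral_dominated_convergence)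
    show "(\<lambda>\<xi>. iexp (\<xi> \<bullet> x) * (complex_of_real 1 * ?G \<xi>)) \<in> borel_measurable lborel"
      "\<And>N. (\<lambda>\<xi>. iexp (\<xi> \<bullet> x) * (complex_of_real (\<phi>0 ((1 / 2 ^ N) *\<^sub>R \<xi>)) * ?G \<xi>)) \<in> borel_measurable lborel"
      by measurable
    show "integrable lborel (\<lambda>\<xi>. B * norm (?G \<xi>))"
      by (intro integrable_mult_right integrable_norm schwartz_integrable G)
    show "AE \<xi> in lborel. (\<lambda>N. iexp (\<xi> \<bullet> x) * (complex_of_real (\<phi>0 ((1 / 2 ^ N) *\<^sub>R \<xi>)) * ?G \<xi>)) \<longlonglongrightarrow>
        iexp (\<xi> \<bullet> x) * (complex_of_real 1 * ?G \<xi>)"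
    proof (intro always_eventually allI tendsto_mult tendsto_const tendsto_of_real)
      fix \<xi> :: "real ^ 'n"
      have "(\<lambda>N. (1 / 2 :: real) ^ N) \<longlonglongrightarrow> 0" by (rule LIMSEQ_realpow_zero) auto
      from tendsto_scaleR[OF this tendsto_const]
      have "(\<lambda>N. (1 / 2) ^ N *\<^sub>R \<xi>) \<longlonglongrightarrow> 0 *\<^sub>R \<xi>" .
      moreover have "isCont \<phi>0 0"
        using smooth_continuous[OF \<phi>0'(1)] by (simp add: continuous_on_eq_continuous_at)
      ultimately have "(\<lambda>N. \<phi>0 ((1 / 2) ^ N *\<^sub>R \<xi>)) \<longlonglongrightarrow> \<phi>0 0"
        using isCont_tendsto_compose[of 0 \<phi>0] by simp
      then show "(\<lambda>N. \<phi>0 ((1 / 2 ^ N) *\<^sub>R \<xi>)) \<longlonglongrightarrow> 1"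
        using \<phi>0'(2) by (simp add: power_one_over)
    qed
    show "AE \<xi> in lborel. norm (iexp (\<xi> \<bullet> x) * (complex_of_real (\<phi>0 ((1 / 2 ^ N) *\<^sub>R \<xi>)) * ?G \<xi>)) \<le> B * norm (?G \<xi>)" for N
      using B unfolding norm_mult by (intro always_eventually allI) (auto simp: dyadic_cutoff_def intro!: mult_right_mono)
  qed
  ultimately have lim2: "(\<lambda>N. \<Sum>j\<le>N. ?g j) \<longlonglongrightarrow> inv_fourier ?G x"
    unfolding inv_fourier_def[of ?G] by simp
  have "?S = inv_fourier ?G x" by (rule LIMSEQ_unique[OF lim1 lim2])
  then show ?thesis unfolding fourier_inversion[OF g] .
qed

theorem theorem2p29:
  fixes J :: nat
    and k \<omega> \<phi>0 :: "real ^ 'n::finite \<Rightarrow> real"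
    and \<Phi>F \<Phi>M :: "nat ^ 'n \<Rightarrow> real ^ 'n \<Rightarrow> complex"
    and f :: "(real ^ 'n \<Rightarrow> complex) \<Rightarrow> complex"
  assumes J: "J \<ge> 1"
    and k_smooth: "smooth k"
    and k_nonneg: "\<And>x. k x \<ge> 0"
    and k_supp: "supp k \<subseteq> {y. norm y < 2 ^ J \<and> (\<forall>l. y $ l > 0)}"
    and k_partition: "\<And>x. ((\<lambda>m. k (x - lattice_point m)) has_sum 1) UNIV"
    and \<omega>_smooth: "smooth \<omega>"
    and \<omega>_supp: "supp \<omega> \<subseteq> {y. \<forall>l. - pi < y $ l \<and> y $ l < pi}"
    and \<omega>_one: "\<And>x. norm x \<le> 2 \<Longrightarrow> \<omega> x = 1"
    and \<phi>0_smooth: "smooth \<phi>0"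
    and \<phi>0_nonneg: "\<And>x. \<phi>0 x \<ge> 0"
    and \<phi>0_one: "\<And>x. norm x \<le> 1 \<Longrightarrow> \<phi>0 x = 1"
    and \<phi>0_zero: "\<And>x. norm x \<ge> 3 / 2 \<Longrightarrow> \<phi>0 x = 0"
    and \<Phi>F_schwartz: "\<And>\<beta>. \<Phi>F \<beta> \<in> schwartz"
    and \<Phi>F: "\<And>\<beta>. inv_fourier (\<Phi>F \<beta>) =
               (\<lambda>x. complex_of_real (\<phi>0 x) * Omega_beta J \<omega> \<beta> x)"
    and \<Phi>M_schwartz: "\<And>\<beta>. \<Phi>M \<beta> \<in> schwartz"
    and \<Phi>M: "\<And>\<beta>. inv_fourier (\<Phi>M \<beta>) =
               (\<lambda>x. complex_of_real (\<phi>0 x - \<phi>0 (2 *\<^sub>R x)) * Omega_beta J \<omega> \<beta> x)"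
    and f: "tempered_distribution f"
  shows "in_schwartz f \<longleftrightarrow>
    (\<forall>s>0. \<forall>\<delta>>0.
      has_distribution_sum
        (\<lambda>(\<beta>, j, m) \<phi>. quark_coeff \<Phi>F \<Phi>M f \<beta> j m * regular_distribution (quark_jm J k \<beta> j m) \<phi>) f \<and>
      quark_coeff \<Phi>F \<Phi>M f \<in> c_space s \<delta>)"
proof -
  have supp: "supp k \<subseteq> {y. norm y < 2 ^ J}" using k_supp by blast
  have \<phi>0: "unit_cutoff \<phi>0" using \<phi>0_smooth \<phi>0_one \<phi>0_zero by (simp add: unit_cutoff_def)
  let ?\<mu> = "quark_coeff \<Phi>F \<Phi>M f"
  let ?u = "\<lambda>(\<beta>, j, m) \<phi>. ?\<mu> \<beta> j m * regular_distribution (quark_jm J k \<beta> j m) \<phi>"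
  let ?g = "\<lambda>x. \<Sum>\<^sub>\<infinity>i. (case i of (\<beta>, j, m) \<Rightarrow> \<lambda>x. ?\<mu> \<beta> j m * quark_jm J k \<beta> j m x) x"
  have u: "(\<lambda>i. ?u i \<phi>) = (\<lambda>(\<beta>, j, m). ?\<mu> \<beta> j m * regular_distribution (quark_jm J k \<beta> j m) \<phi>)" for \<phi>
    by (simp add: case_prod_unfold)
  have sum: "((\<lambda>i. ?u i \<phi>) has_sum regular_distribution ?g \<phi>) UNIV"
    if "rapidly_decreasing ?\<mu>" "\<phi> \<in> schwartz" for \<phi>
    unfolding u by (rule quark_series_regular_distribution[OF k_smooth supp that])
  have "in_schwartz f \<longleftrightarrow> has_distribution_sum ?u f \<and> rapidly_decreasing ?\<mu>"
  proof
    assume "has_distribution_sum ?u f \<and> rapidly_decreasing ?\<mu>"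
    then have r: "rapidly_decreasing ?\<mu>" and h: "\<And>\<phi>. \<phi> \<in> schwartz \<Longrightarrow> ((\<lambda>i. ?u i \<phi>) has_sum f \<phi>) UNIV"
      by (auto simp: has_distribution_sum_def)
    have "?g \<in> schwartz" by (rule quark_series_schwartz[OF k_smooth supp r])
    \<comment> \<open>Both values are unordered sums of the same series tested against
      \<open>\<phi>\<close>, so uniqueness of sums identifies the distribution with the Schwartz
      function.\<close>
    moreover have "f \<phi> = regular_distribution ?g \<phi>" if "\<phi> \<in> schwartz" for \<phi>
      by (rule has_sum_unique[OF h[OF that] sum[OF r that]])
    ultimately show "in_schwartz f" unfolding in_schwartz_def by blast
  next
    assume "in_schwartz f"
    then obtain g where g: "g \<in> schwartz" "\<And>\<phi>. \<phi> \<in> schwartz \<Longrightarrow> f \<phi> = regular_distribution g \<phi>"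
      unfolding in_schwartz_def by blast
    have G: "(\<lambda>\<xi>. inv_fourier g (- \<xi>)) \<in> schwartz"
      by (rule inv_fourier_reflect_schwartz[OF g(1)])
    have \<mu>: "?\<mu> = (\<lambda>\<beta> j m. quark_factor J \<beta> *
        inv_fourier (quark_symbol \<phi>0 (\<lambda>\<xi>. inv_fourier g (- \<xi>)) \<beta> j) ((1 / 2 ^ j) *\<^sub>R lattice_point m))"
      using quark_coeff_schwartz[of \<omega> \<phi>0 \<Phi>F J \<Phi>M g f, OF \<omega>_smooth \<omega>_supp \<omega>_one \<phi>0 \<Phi>F_schwartz \<Phi>F \<Phi>M_schwartz \<Phi>M g]
      by (simp add: fun_eq_iff)
    have r: "rapidly_decreasing ?\<mu>"
      unfolding \<mu> by (rule quark_coefficients_rapidly_decreasing[OF \<phi>0 G])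
    have "?g = g"
      unfolding \<mu>
      by (rule ext) (rule quark_reconstruction[OF k_smooth supp k_partition \<phi>0 g(1)])
    then have "((\<lambda>i. ?u i \<phi>) has_sum f \<phi>) UNIV" if "\<phi> \<in> schwartz" for \<phi>
      using sum[OF r that] g(2)[OF that] by simp
    then show "has_distribution_sum ?u f \<and> rapidly_decreasing ?\<mu>"
      using r unfolding has_distribution_sum_def by blast
  qed
  \<comment> \<open>The ranges of \<open>s\<close> and \<open>\<delta>\<close> are nonempty and
    convergence depends on neither, so it can be moved out of the quantifiers.\<close>
  moreover have "(\<forall>s>0. \<forall>\<delta>>0. has_distribution_sum ?u f \<and> ?\<mu> \<in> c_space s \<delta>) \<longleftrightarrow>
      has_distribution_sum ?u f \<and> rapidly_decreasing ?\<mu>"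
    unfolding rapidly_decreasing_iff_c_space by (meson zero_less_one)
  ultimately show ?thesis by blast
qed

end
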